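(* Let $E$ be an $SL(n,\mathbb{C})$-vector bundle with fiber $\mathbb{C}^n$ over a smooth manifold $M$, let $P$ be the principal $SL(n,\mathbb{C})$-bundle to which $E$ is associated, and let $\mathbf{A}=\Gamma(\mathrm{End}(E))$ be the algebra of smooth sections of the bundle of endomorphisms of $E$. Then the Lie algebroid $\mathrm{Der}(\mathbf{A})$ of derivations of $\mathbf{A}$ is isomorphic to the Atiyah Lie algebroid $\Gamma_G(TP)$ of the $SL(n,\mathbb{C})$-principal fiber bundle $P$.
   Context: $C^\infty(M)=\Gamma(M\times\mathbb{C})$ is the algebra of smooth functions on $M$ and $\Gamma(TM)$ the space of smooth vector fields on $M$. A Lie algebroid over $M$ is a finite projective $C^\infty(M)$-module $\mathsf{A}$ with a Lie bracket and a $C^\infty(M)$-linear Lie morphism $\rho:\mathsf{A}\to\Gamma(TM)$ (the anchor) such that $[\mathfrak{X},f\mathfrak{Y}]=f[\mathfrak{X},\mathfrak{Y}]+(\rho(\mathfrak{X})\cdot f)\mathfrak{Y}$. A morphism of Lie algebroids over $M$ is a morphism of Lie algebras and $C^\infty(M)$-modules compatible with the anchors. Derivations: the center of $\mathbf{A}$ is $C^\infty(M)$, and $\mathrm{Der}(\mathbf{A})$ is the Lie algebra and $C^\infty(M)$-module of derivations of $\mathbf{A}$. With $\mathbf{A}_0\subset\mathbf{A}$ the traceless elements, the short exact sequence $0\to\mathbf{A}_0\xrightarrow{\mathrm{ad}}\mathrm{Der}(\mathbf{A})\xrightarrow{\rho}\Gamma(TM)\to0$, where $\rho$ is the restriction of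 a derivation to the center, makes $\mathrm{Der}(\mathbf{A})$ a Lie algebroid over $M$ with anchor $\rho$. Atiyah Lie algebroid: with $G=SL(n,\mathbb{C})$, Lie algebra $\mathfrak{g}$, projection $\pi:P\to M$ and right action $\widetilde R_g(p)=p\cdot g$, let $\Gamma_G(TP)=\{\mathsf{X}\in\Gamma(TP)\ :\ \widetilde R_{g*}\mathsf{X}=\mathsf{X}\text{ for all }g\in G\}$ be the right-invariant vector fields on $P$, and $\Gamma_G(P,\mathfrak{g})=\{v:P\to\mathfrak{g}\ :\ v(p\cdot g)=\mathrm{Ad}_{g^{-1}}v(p)\text{ for all }g\in G\}$. With $\iota(v)(p)=\left(\frac{d}{dt}\,p\cdot e^{-tv(p)}\right)_{|t=0}$, the short exact sequence $0\to\Gamma_G(P,\mathfrak{g})\xrightarrow{\iota}\Gamma_G(TP)\xrightarrow{\pi_*}\Gamma(TM)\to0$ of Lie algebras and $C^\infty(M)$-modules defines $\Gamma_G(TP)$ as a Lie algebroid over $M$ with anchor $\pi_*$.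
   Formalization: Vector fields on M and P are real and the module scalars are real smooth functions; Der(A) is taken to be the derivations whose restriction to the center is a real vector field on M, since with complex functions and all derivations the two algebroids are not isomorphic. *)

theory Defs
  imports "HOL-Analysis.Analysis"
begin

section \<open>Smooth manifolds and smooth maps\<close>

text \<open>For an open subset \<open>U\<close> of a Euclidean space, \<open>Ck_on k U f\<close> says that \<open>f\<close> is of class
  $C^k$ on \<open>U\<close>.\<close>

primrec Ck_on :: "nat \<Rightarrow> 'a::real_normed_vector set \<Rightarrow> ('a \<Rightarrow> 'b::real_normed_vector) \<Rightarrow> bool" where
  "Ck_on 0 U f \<longleftrightarrow> continuous_on U f"
| "Ck_on (Suc k) U f \<longleftrightarrow>
     (\<forall>x\<in>U. f differentiable (at x)) \<and> (\<forall>v. Ck_on k U (\<lambda>x. frechet_derivative f (at x) v))"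

text \<open>Smoothness on an arbitrary subset of a Euclidean space means local extendability to smooth
  functions on open sets.  It is the usual smoothness when \<open>S\<close> is open or is an embedded
  submanifold.\<close>

definition smooth_on :: "'a::real_normed_vector set \<Rightarrow> ('a \<Rightarrow> 'b::real_normed_vector) \<Rightarrow> bool" where
  "smooth_on S f \<longleftrightarrow>
     (\<forall>x\<in>S. \<exists>U g. open U \<and> x \<in> U \<and> (\<forall>k. Ck_on k U g) \<and> (\<forall>y\<in>S \<inter> U. g y = f y))"

text \<open>The charts take values in a linear subspace \<open>model\<close> of a Euclidean space, which plays the
  role of $\mathbb{R}^d$.  (Euclidean spaces as types have positive dimension; the subspace also
  allows $d = 0$.)  The underlying set of a manifold is the whole type.\<close>

record ('m, 'e) manifold =
  model :: "'e set"
  charts :: "('m set \<times> ('m \<Rightarrow> 'e)) set"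

definition smooth_manifold ::
  "('m::{t2_space,second_countable_topology}, 'e::euclidean_space) manifold \<Rightarrow> bool" where
  "smooth_manifold M \<longleftrightarrow>
     subspace (model M) \<and>
     (\<Union>(U, \<phi>)\<in>charts M. U) = UNIV \<and>
     (\<forall>(U, \<phi>)\<in>charts M.
        open U \<and> openin (top_of_set (model M)) (\<phi> ` U) \<and>
        homeomorphism U (\<phi> ` U) \<phi> (inv_into U \<phi>)) \<and>
     (\<forall>(U, \<phi>)\<in>charts M. \<forall>(V, \<psi>)\<in>charts M.
        smooth_on (\<phi> ` (U \<inter> V)) (\<psi> \<circ> inv_into U \<phi>))"

definition euclid :: "('a::euclidean_space, 'a) manifold" where
  "euclid = \<lparr>model = UNIV, charts = {(UNIV, \<lambda>x. x)}\<rparr>"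

definition product_manifold ::
  "('m, 'e) manifold \<Rightarrow> ('n, 'f) manifold \<Rightarrow> ('m \<times> 'n, 'e \<times> 'f) manifold" where
  "product_manifold M N =
     \<lparr>model = model M \<times> model N,
      charts = {(U \<times> V, map_prod \<phi> \<psi>) |U \<phi> V \<psi>. (U, \<phi>) \<in> charts M \<and> (V, \<psi>) \<in> charts N}\<rparr>"

text \<open>Smoothness of the restriction to \<open>S \<subseteq> M\<close> of a map \<open>F\<close> from \<open>M\<close> to \<open>N\<close>; \<open>S\<close> need not be open
  (below it is also a product of an open set with the submanifold $SL(n,\mathbb{C})$ of the
  space of matrices).\<close>

definition smooth_map ::
  "('m::topological_space, 'e::euclidean_space) manifold \<Rightarrow>
   ('n::topological_space, 'f::euclidean_space) manifold \<Rightarrow> 'm set \<Rightarrow> ('m \<Rightarrow> 'n) \<Rightarrow> bool" where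
  "smooth_map M N S F \<longleftrightarrow>
     continuous_on S F \<and>
     (\<forall>(U, \<phi>)\<in>charts M. \<forall>(V, \<psi>)\<in>charts N.
        smooth_on (\<phi> ` (S \<inter> U \<inter> F -` V)) (\<psi> \<circ> F \<circ> inv_into U \<phi>))"

definition smooth_functions ::
  "('m::topological_space, 'e::euclidean_space) manifold \<Rightarrow> ('m \<Rightarrow> 'b::euclidean_space) set" where
  "smooth_functions M = {f. smooth_map M euclid UNIV f}"


section \<open>Vector fields\<close>

text \<open>Tangent vectors are derivations at a point of the algebra of smooth real functions; to make
  equality of tangent vectors meaningful they vanish on non-smooth arguments.\<close>

definition tangent_space ::
  "('m::topological_space, 'e::euclidean_space) manifold \<Rightarrow> 'm \<Rightarrow> (('m \<Rightarrow> real) \<Rightarrow> real) set" where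
  "tangent_space M p =
     {v. (\<forall>f\<in>smooth_functions M. \<forall>g\<in>smooth_functions M.
            (\<forall>a b. v (\<lambda>x. a * f x + b * g x) = a * v f + b * v g) \<and>
            v (\<lambda>x. f x * g x) = f p * v g + g p * v f) \<and>
         (\<forall>f. f \<notin> smooth_functions M \<longrightarrow> v f = 0)}"

type_synonym 'm vfield = "'m \<Rightarrow> ('m \<Rightarrow> real) \<Rightarrow> real"

definition vector_fields ::
  "('m::topological_space, 'e::euclidean_space) manifold \<Rightarrow> 'm vfield set" where
  "vector_fields M =
     {X. (\<forall>p. X p \<in> tangent_space M p) \<and>
         (\<forall>f\<in>smooth_functions M. (\<lambda>p. X p f) \<in> smooth_functions M)}"

definition vf_add :: "'m vfield \<Rightarrow> 'm vfield \<Rightarrow> 'm vfield" where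
  "vf_add X Y = (\<lambda>p f. X p f + Y p f)"

definition vf_bracket :: "'m vfield \<Rightarrow> 'm vfield \<Rightarrow> 'm vfield" where
  "vf_bracket X Y = (\<lambda>p f. X p (\<lambda>q. Y q f) - Y p (\<lambda>q. X q f))"

text \<open>The differential of \<open>F\<close>, applied to a tangent vector \<open>v\<close>; \<open>N\<close> is the target manifold.\<close>

definition differential ::
  "('n::topological_space, 'f::euclidean_space) manifold \<Rightarrow> ('m \<Rightarrow> 'n) \<Rightarrow>
   (('m \<Rightarrow> real) \<Rightarrow> real) \<Rightarrow> ('n \<Rightarrow> real) \<Rightarrow> real" where
  "differential N F v = (\<lambda>f. if f \<in> smooth_functions N then v (f \<circ> F) else 0)"

definition vf_apply_complex :: "'m vfield \<Rightarrow> ('m \<Rightarrow> complex) \<Rightarrow> 'm \<Rightarrow> complex" where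
  "vf_apply_complex X f = (\<lambda>x. Complex (X x (\<lambda>y. Re (f y))) (X x (\<lambda>y. Im (f y))))"


section \<open>Lie algebroids and their isomorphisms\<close>

text \<open>The data of a Lie algebroid over a manifold with points in \<open>'m\<close>.  The scalars are the smooth
  real functions, as befits modules with an anchor to (real) vector fields.\<close>

record ('m, 'a) lie_algebroid =
  la_carrier :: "'a set"
  la_add :: "'a \<Rightarrow> 'a \<Rightarrow> 'a"
  la_scale :: "('m \<Rightarrow> real) \<Rightarrow> 'a \<Rightarrow> 'a"
  la_bracket :: "'a \<Rightarrow> 'a \<Rightarrow> 'a"
  la_anchor :: "'a \<Rightarrow> 'm vfield"

definition lie_algebroid_morphism ::
  "('m::topological_space, 'e::euclidean_space) manifold \<Rightarrow>
   ('m, 'a) lie_algebroid \<Rightarrow> ('m, 'b) lie_algebroid \<Rightarrow> ('a \<Rightarrow> 'b) \<Rightarrow> bool" where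
  "lie_algebroid_morphism M L L' \<Phi> \<longleftrightarrow>
     \<Phi> \<in> la_carrier L \<rightarrow> la_carrier L' \<and>
     (\<forall>X\<in>la_carrier L. \<forall>Y\<in>la_carrier L.
        \<Phi> (la_add L X Y) = la_add L' (\<Phi> X) (\<Phi> Y) \<and>
        \<Phi> (la_bracket L X Y) = la_bracket L' (\<Phi> X) (\<Phi> Y)) \<and>
     (\<forall>f\<in>smooth_functions M. \<forall>X\<in>la_carrier L. \<Phi> (la_scale L f X) = la_scale L' f (\<Phi> X)) \<and>
     (\<forall>X\<in>la_carrier L. la_anchor L' (\<Phi> X) = la_anchor L X)"

definition lie_algebroid_isomorphic ::
  "('m::topological_space, 'e::euclidean_space) manifold \<Rightarrow>
   ('m, 'a) lie_algebroid \<Rightarrow> ('m, 'b) lie_algebroid \<Rightarrow> bool" where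
  "lie_algebroid_isomorphic M L L' \<longleftrightarrow>
     (\<exists>\<Phi>. lie_algebroid_morphism M L L' \<Phi> \<and> bij_betw \<Phi> (la_carrier L) (la_carrier L'))"


section \<open>Principal bundles and the Atiyah Lie algebroid\<close>

definition SL :: "(complex^'n^'n::finite) set" where
  "SL = {g. det g = 1}"

text \<open>The action is only meaningful for matrices in \<open>SL\<close>.\<close>

record ('p, 'f, 'm, 'n) principal_bundle =
  bundle_space :: "('p, 'f) manifold"
  bundle_proj :: "'p \<Rightarrow> 'm"
  bundle_act :: "'p \<Rightarrow> complex^'n^'n \<Rightarrow> 'p"

text \<open>A local trivialization over \<open>U\<close> is given by an equivariant map \<open>\<tau>\<close> from the part of the bundle
  over \<open>U\<close> to \<open>SL\<close> that, paired with the projection, is a diffeomorphism onto \<open>U \<times> SL\<close>.\<close>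

definition principal_SL_bundle ::
  "('m::{t2_space,second_countable_topology}, 'e::euclidean_space) manifold \<Rightarrow>
   ('p::{t2_space,second_countable_topology}, 'f::euclidean_space, 'm, 'n::finite)
     principal_bundle \<Rightarrow> bool" where
  "principal_SL_bundle M P \<longleftrightarrow>
     smooth_manifold (bundle_space P) \<and>
     smooth_map (bundle_space P) M UNIV (bundle_proj P) \<and>
     smooth_map (product_manifold (bundle_space P) euclid) (bundle_space P) (UNIV \<times> SL)
       (\<lambda>(p, g). bundle_act P p g) \<and>
     (\<forall>p. bundle_act P p (mat 1) = p) \<and>
     (\<forall>p. \<forall>g\<in>SL. \<forall>h\<in>SL. bundle_act P (bundle_act P p g) h = bundle_act P p (g ** h)) \<and>
     (\<forall>p. \<forall>g\<in>SL. bundle_proj P (bundle_act P p g) = bundle_proj P p) \<and>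
     (\<forall>x. \<exists>U \<tau>. open U \<and> x \<in> U \<and>
        (let W = bundle_proj P -` U; \<Psi> = (\<lambda>p. (bundle_proj P p, \<tau> p)) in
          bij_betw \<Psi> W (U \<times> SL) \<and>
          smooth_map (bundle_space P) (product_manifold M euclid) W \<Psi> \<and>
          smooth_map (product_manifold M euclid) (bundle_space P) (U \<times> SL) (inv_into W \<Psi>) \<and>
          (\<forall>p\<in>W. \<forall>g\<in>SL. \<tau> (bundle_act P p g) = \<tau> p ** g)))"

definition right_invariant_fields ::
  "('p::topological_space, 'f::euclidean_space, 'm, 'n::finite) principal_bundle \<Rightarrow> 'p vfield set" where
  "right_invariant_fields P =
     {X \<in> vector_fields (bundle_space P).
        \<forall>g\<in>SL. \<forall>p. differential (bundle_space P) (\<lambda>q. bundle_act P q g) (X p) = X (bundle_act P p g)}"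

definition projects_to ::
  "('m::topological_space, 'e::euclidean_space) manifold \<Rightarrow>
   ('p, 'f, 'm, 'n::finite) principal_bundle \<Rightarrow> 'p vfield \<Rightarrow> 'm vfield \<Rightarrow> bool" where
  "projects_to M P X Y \<longleftrightarrow> (\<forall>p. Y (bundle_proj P p) = differential M (bundle_proj P) (X p))"

definition Atiyah_algebroid ::
  "('m::topological_space, 'e::euclidean_space) manifold \<Rightarrow>
   ('p::topological_space, 'f::euclidean_space, 'm, 'n::finite) principal_bundle \<Rightarrow>
   ('m, 'p vfield) lie_algebroid" where
  "Atiyah_algebroid M P =
     \<lparr>la_carrier = right_invariant_fields P,
      la_add = vf_add,
      la_scale = (\<lambda>f X p h. f (bundle_proj P p) * X p h),
      la_bracket = vf_bracket,
      la_anchor = (\<lambda>X. THE Y. Y \<in> vector_fields M \<and> projects_to M P X Y)\<rparr>"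


section \<open>Vector bundles and derivations of the endomorphism algebra\<close>

text \<open>The total space is the whole type \<open>'v\<close>; addition and scalar multiplication are only meaningful
  within a fiber.  An element \<open>(U, \<tau>)\<close> of \<open>frames\<close> is a local trivialization
  \<open>(x, v) \<mapsto> \<tau> x v\<close> over \<open>U\<close>.\<close>

record ('v, 'm, 'n) vector_bundle =
  vb_proj :: "'v \<Rightarrow> 'm"
  vb_add :: "'v \<Rightarrow> 'v \<Rightarrow> 'v"
  vb_scale :: "complex \<Rightarrow> 'v \<Rightarrow> 'v"
  frames :: "('m set \<times> ('m \<Rightarrow> complex^'n \<Rightarrow> 'v)) set"

text \<open>The vector space structure of each fiber and the smooth structure of the total space are
  those transported by the trivializations.\<close>

definition SL_vector_bundle ::
  "('m::topological_space, 'e::euclidean_space) manifold \<Rightarrow>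
   ('v, 'm, 'n::finite) vector_bundle \<Rightarrow> bool" where
  "SL_vector_bundle M E \<longleftrightarrow>
     (\<Union>(U, \<tau>)\<in>frames E. U) = UNIV \<and>
     (\<forall>(U, \<tau>)\<in>frames E. open U \<and>
        (\<forall>x\<in>U. bij_betw (\<tau> x) UNIV (vb_proj E -` {x}) \<and>
          (\<forall>v w. vb_add E (\<tau> x v) (\<tau> x w) = \<tau> x (v + w)) \<and>
          (\<forall>a v. vb_scale E a (\<tau> x v) = \<tau> x (a *s v)))) \<and>
     (\<forall>(U, \<tau>)\<in>frames E. \<forall>(V, \<sigma>)\<in>frames E. \<exists>g.
        smooth_map M euclid (U \<inter> V) g \<and>
        (\<forall>x\<in>U \<inter> V. g x \<in> SL \<and> (\<forall>v. \<sigma> x v = \<tau> x (g x *v v))))"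

text \<open>\<open>E\<close> is associated to \<open>P\<close>: \<open>E\<close> is the quotient of \<open>P \<times> \<complex>\<^sup>n\<close>, by a map \<open>(p, v) \<mapsto> q p v\<close>,
  under the identification of \<open>(p g, v)\<close> with \<open>(p, g v)\<close>, as bundles with structure group \<open>SL\<close>.\<close>

definition associated ::
  "('p::topological_space, 'f::euclidean_space, 'm, 'n::finite) principal_bundle \<Rightarrow>
   ('v, 'm, 'n) vector_bundle \<Rightarrow> bool" where
  "associated P E \<longleftrightarrow>
     (\<exists>q :: 'p \<Rightarrow> complex^'n \<Rightarrow> 'v.
        (\<forall>p v. vb_proj E (q p v) = bundle_proj P p) \<and>
        (\<forall>p v. \<forall>g\<in>SL. q (bundle_act P p g) v = q p (g *v v)) \<and>
        (\<forall>(U, \<tau>)\<in>frames E. \<exists>h.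
           smooth_map (bundle_space P) euclid (bundle_proj P -` U) h \<and>
           (\<forall>p\<in>bundle_proj P -` U. h p \<in> SL \<and> (\<forall>v. q p v = \<tau> (bundle_proj P p) (h p *v v)))))"

text \<open>A section of the bundle of endomorphisms, i.e. a family of linear endomorphisms of the fibers,
  is encoded as the self-map of the total space that restricts to its value at \<open>x\<close> on the fiber
  over \<open>x\<close>.  It is smooth if its matrix in each trivialization is.\<close>

definition end_sections ::
  "('m::topological_space, 'e::euclidean_space) manifold \<Rightarrow>
   ('v, 'm, 'n::finite) vector_bundle \<Rightarrow> ('v \<Rightarrow> 'v) set" where
  "end_sections M E =
     {T. (\<forall>u. vb_proj E (T u) = vb_proj E u) \<and>
         (\<forall>u w. vb_proj E u = vb_proj E w \<longrightarrow> T (vb_add E u w) = vb_add E (T u) (T w)) \<and>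
         (\<forall>a u. T (vb_scale E a u) = vb_scale E a (T u)) \<and>
         (\<forall>(U, \<tau>)\<in>frames E. \<exists>B :: 'm \<Rightarrow> complex^'n^'n.
            smooth_map M euclid U B \<and> (\<forall>x\<in>U. \<forall>v. T (\<tau> x v) = \<tau> x (B x *v v)))}"

definition end_add ::
  "('v, 'm, 'n::finite) vector_bundle \<Rightarrow> ('v \<Rightarrow> 'v) \<Rightarrow> ('v \<Rightarrow> 'v) \<Rightarrow> 'v \<Rightarrow> 'v" where
  "end_add E S T = (\<lambda>u. vb_add E (S u) (T u))"

definition end_scale ::
  "('v, 'm, 'n::finite) vector_bundle \<Rightarrow> ('m \<Rightarrow> complex) \<Rightarrow> ('v \<Rightarrow> 'v) \<Rightarrow> 'v \<Rightarrow> 'v" where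
  "end_scale E f T = (\<lambda>u. vb_scale E (f (vb_proj E u)) (T u))"

text \<open>The product of the algebra of sections is composition.\<close>

definition derivations ::
  "('m::topological_space, 'e::euclidean_space) manifold \<Rightarrow>
   ('v, 'm, 'n::finite) vector_bundle \<Rightarrow> (('v \<Rightarrow> 'v) \<Rightarrow> 'v \<Rightarrow> 'v) set" where
  "derivations M E =
     {D \<in> end_sections M E \<rightarrow>\<^sub>E end_sections M E.
        \<forall>S\<in>end_sections M E. \<forall>T\<in>end_sections M E.
          D (end_add E S T) = end_add E (D S) (D T) \<and>
          (\<forall>a. D (end_scale E (\<lambda>_. a) T) = end_scale E (\<lambda>_. a) (D T)) \<and>
          D (S \<circ> T) = end_add E (D S \<circ> T) (S \<circ> D T)}"

text \<open>The restriction of \<open>D\<close> to the center, i.e. to the complex smooth functions times the identity,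
  is the vector field \<open>X\<close>.\<close>

definition center_restriction ::
  "('m::topological_space, 'e::euclidean_space) manifold \<Rightarrow>
   ('v, 'm, 'n::finite) vector_bundle \<Rightarrow> (('v \<Rightarrow> 'v) \<Rightarrow> 'v \<Rightarrow> 'v) \<Rightarrow> 'm vfield \<Rightarrow> bool" where
  "center_restriction M E D X \<longleftrightarrow>
     (\<forall>f\<in>smooth_functions M. D (end_scale E f id) = end_scale E (vf_apply_complex X f) id)"

text \<open>A derivation of the complex algebra of sections restricts to a derivation of the complex
  smooth functions, that is, to a complex vector field.  As the anchor of a Lie algebroid takes values
  in the vector fields of \<open>M\<close>, the elements of the Lie algebroid of derivations are those whose
  restriction to the center is a vector field of \<open>M\<close>.\<close>

definition Der_algebroid ::
  "('m::topological_space, 'e::euclidean_space) manifold \<Rightarrow>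
   ('v, 'm, 'n::finite) vector_bundle \<Rightarrow> ('m, ('v \<Rightarrow> 'v) \<Rightarrow> 'v \<Rightarrow> 'v) lie_algebroid" where
  "Der_algebroid M E =
     \<lparr>la_carrier = {D \<in> derivations M E. \<exists>X\<in>vector_fields M. center_restriction M E D X},
      la_add = (\<lambda>D D'. \<lambda>T\<in>end_sections M E. end_add E (D T) (D' T)),
      la_scale = (\<lambda>f D. \<lambda>T\<in>end_sections M E. end_scale E (\<lambda>x. complex_of_real (f x)) (D T)),
      la_bracket = (\<lambda>D D'. \<lambda>T\<in>end_sections M E.
         end_add E (D (D' T)) (end_scale E (\<lambda>_. -1) (D' (D T)))),
      la_anchor = (\<lambda>D. THE X. X \<in> vector_fields M \<and> center_restriction M E D X)\<rparr>"

end

theory Submission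
  imports Defs
begin

text \<open>A section of \<open>End(E)\<close> is the same as an equivariant matrix-valued function on \<open>P\<close>, and an invariant
  vector field on \<open>P\<close> acts on these functions entrywise; this gives the map from the Atiyah algebroid
  to the derivations.  It is injective because a tangent vector \<open>v\<close> of \<open>P\<close> is determined by its action
  on equivariant functions: writing these locally as $\sigma^{-1} A \sigma$ with \<open>\<sigma>\<close> a trivialization and
  \<open>A\<close> constant, vanishing on all of them forces \<open>v \<sigma> = c \<sigma>\<close> with \<open>c\<close> scalar, and
  $\det \sigma = 1$ forces $c = 0$.  For surjectivity, a derivation with anchor \<open>X\<close> is locally
  $A \mapsto X A + [G, A]$ with \<open>G\<close> traceless, hence is induced by the tangent vectors that consist of
  the lift of \<open>X\<close> in a trivialization and the vertical vector of $-G$.  By the uniqueness just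
  described these vectors do not depend on the trivialization and form an invariant field.\<close>

section \<open>Smooth functions on Euclidean spaces\<close>

text \<open>Smoothness on a set means existence of local smooth extensions, so functions on
  \<open>SL\<close> or on a chart image inside \<open>model\<close> have no preferred ambient
  derivative. Calculus therefore goes through derivations at a point: Hadamard's lemma gives the
  chain rule \<open>tangent_chain\<close>, where any ambient extension may be used, because
  agreement is asked for along the coordinates only. Coordinates on P near a point are a chart of
  the base paired with the matrix of a trivialization. Tangent vectors and derivations act on global
  objects, so each local formula has to be applied to a cut-off version of itself; this explains the
  nested neighbourhoods on which some \<kappa> is 1. The generator G has to be traceless for this to
  reach it; scalar parts are invisible in a commutator, so it can be chosen so.\<close>

lemma continuous_on_local:
  fixes f :: "'a::t2_space \<Rightarrow> 'b::topological_space"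
  assumes "\<And>x. x \<in> S \<Longrightarrow> \<exists>U. open U \<and> x \<in> U \<and> continuous_on (S \<inter> U) f"
  shows "continuous_on S f"
  unfolding continuous_on_eq_continuous_within
proof
  fix x assume "x \<in> S"
  with assms obtain U where "open U" "x \<in> U" "continuous_on (S \<inter> U) f" by blast
  moreover from this have "at x within (S \<inter> U) = at x within S"
    by (intro at_within_nhd[where S = U]) auto
  ultimately show "continuous (at x within S) f"
    using \<open>x \<in> S\<close> by (metis IntI continuous_on_eq_continuous_within)
qed

section \<open>Functions of class C^k\<close>

lemma Ck_on_SucD: "Ck_on (Suc k) U f \<Longrightarrow> Ck_on k U f"
proof (induction k arbitrary: f)
  case 0
  then show ?case
    by (auto intro!: continuous_at_imp_continuous_on differentiable_imp_continuous_within)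
qed auto

lemma Ck_on_subset: "Ck_on k U f \<Longrightarrow> V \<subseteq> U \<Longrightarrow> Ck_on k V f"
  by (induction k arbitrary: f) (auto intro: continuous_on_subset)

lemma differentiable_cong_open:
  assumes "open U" "x \<in> U" "\<And>y. y \<in> U \<Longrightarrow> f y = g y" "f differentiable (at x)"
  shows "g differentiable (at x)"
  using assms by (auto simp: differentiable_def intro: has_derivative_transform_within_open)

lemma Ck_on_cong:
  assumes "open U" "\<And>x. x \<in> U \<Longrightarrow> f x = g x" "Ck_on k U f"
  shows "Ck_on k U g"
  using assms(2,3)
proof (induction k arbitrary: f g)
  case 0
  then show ?case by (auto cong: continuous_on_cong)
next
  case (Suc k)
  have diff: "f differentiable (at x)" if "x \<in> U" for x
    using Suc.prems that by auto
  have "Ck_on k U (\<lambda>x. frechet_derivative g (at x) v)" for v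
  proof (rule Suc.IH)
    show "Ck_on k U (\<lambda>x. frechet_derivative f (at x) v)"
      using Suc.prems by auto
    show "frechet_derivative f (at x) v = frechet_derivative g (at x) v" if "x \<in> U" for x
      using frechet_derivative_transform_within_open[OF diff[OF that] assms(1) that] Suc.prems(1)
      by simp
  qed
  then show ?case
    using differentiable_cong_open[OF assms(1) _ Suc.prems(1)] diff by auto
qed

text \<open>\<open>Ck_on\<close> takes derivatives \<open>at x\<close> in the full space, so apart
  from the range of points the set enters only through continuity at level 0, which is
  local.\<close>

lemma Ck_on_local:
  assumes "\<And>x. x \<in> S \<Longrightarrow> \<exists>U. open U \<and> x \<in> U \<and> Ck_on k (S \<inter> U) f"
  shows "Ck_on k S f"
  using assms
proof (induction k arbitrary: f)
  case 0
  show ?case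
    unfolding Ck_on.simps by (rule continuous_on_local) (use 0 in auto)
next
  case (Suc k)
  have "Ck_on k S (\<lambda>x. frechet_derivative f (at x) v)" for v
    by (rule Suc.IH) (use Suc.prems in fastforce)
  then show ?case using Suc.prems by fastforce
qed

lemma Ck_on_const: "Ck_on k U (\<lambda>x. c)"
  by (induction k arbitrary: c) auto

lemma Ck_on_add:
  assumes "open U" "Ck_on k U f" "Ck_on k U g"
  shows "Ck_on k U (\<lambda>x. f x + g x)"
  using assms(2,3)
proof (induction k arbitrary: f g)
  case 0
  then show ?case by (auto intro: continuous_intros)
next
  case (Suc k)
  have *: "frechet_derivative (\<lambda>x. f x + g x) (at x)
      = (\<lambda>v. frechet_derivative f (at x) v + frechet_derivative g (at x) v)" if "x \<in> U" for x
    using Suc.prems that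
    by (intro frechet_derivative_at[symmetric] has_derivative_add)
       (auto simp: frechet_derivative_works)
  have "Ck_on k U (\<lambda>x. frechet_derivative (\<lambda>x. f x + g x) (at x) v)" for v
    by (rule Ck_on_cong[OF assms(1) _ Suc.IH, of "\<lambda>x. frechet_derivative f (at x) v"
          "\<lambda>x. frechet_derivative g (at x) v"]) (use Suc.prems * in auto)
  with Suc.prems show ?case by auto
qed

lemma Ck_on_sum:
  assumes "open U" "\<And>i. i \<in> I \<Longrightarrow> Ck_on k U (f i)"
  shows "Ck_on k U (\<lambda>x. \<Sum>i\<in>I. f i x)"
  using assms(2)
  by (induction I rule: infinite_finite_induct) (auto intro: Ck_on_const Ck_on_add[OF assms(1)])

text \<open>One rule for scalar, inner and matrix products. The induction closes because each term
  of the Leibniz rule pairs a differentiated factor with an undifferentiated one, and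
  \<open>Ck_on_SucD\<close> lowers the class of the latter.\<close>

lemma Ck_on_bilinear:
  assumes "bounded_bilinear pr" "open U" "Ck_on k U f" "Ck_on k U g"
  shows "Ck_on k U (\<lambda>x. pr (f x) (g x))"
  using assms(3,4)
proof (induction k arbitrary: f g)
  case 0
  then show ?case by (auto intro: bounded_bilinear.continuous_on[OF assms(1)])
next
  case (Suc k)
  have D: "((\<lambda>x. pr (f x) (g x)) has_derivative
      (\<lambda>v. pr (f x) (frechet_derivative g (at x) v) + pr (frechet_derivative f (at x) v) (g x)))
      (at x)" if "x \<in> U" for x
    using Suc.prems that
    by (intro bounded_bilinear.FDERIV[OF assms(1)]) (auto simp: frechet_derivative_works)
  have *: "frechet_derivative (\<lambda>x. pr (f x) (g x)) (at x) v
      = pr (f x) (frechet_derivative g (at x) v) + pr (frechet_derivative f (at x) v) (g x)"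
    if "x \<in> U" for x v
    using frechet_derivative_at[OF D[OF that]] by metis
  have "Ck_on k U (\<lambda>x. frechet_derivative (\<lambda>x. pr (f x) (g x)) (at x) v)" for v
    by (rule Ck_on_cong[OF assms(2) _ Ck_on_add[OF assms(2) Suc.IH Suc.IH], of f
          "\<lambda>x. frechet_derivative g (at x) v" "\<lambda>x. frechet_derivative f (at x) v" g])
       (use Suc.prems Ck_on_SucD[OF Suc.prems(1)] Ck_on_SucD[OF Suc.prems(2)] * in auto)
  with D show ?case by (auto simp: differentiable_def)
qed

lemma Ck_on_linear_compose:
  assumes "bounded_linear L" "open U" "Ck_on k U f"
  shows "Ck_on k U (\<lambda>x. L (f x))"
  using assms(3)
proof (induction k arbitrary: f)
  case 0
  then show ?case by (auto intro: bounded_linear.continuous_on[OF assms(1)])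
next
  case (Suc k)
  have D: "((\<lambda>x. L (f x)) has_derivative (\<lambda>v. L (frechet_derivative f (at x) v))) (at x)"
    if "x \<in> U" for x
    using Suc.prems that
    by (intro bounded_linear.has_derivative[OF assms(1)]) (auto simp: frechet_derivative_works)
  have *: "frechet_derivative (\<lambda>x. L (f x)) (at x) v = L (frechet_derivative f (at x) v)"
    if "x \<in> U" for x v
    using frechet_derivative_at[OF D[OF that]] by metis
  have "Ck_on k U (\<lambda>x. frechet_derivative (\<lambda>x. L (f x)) (at x) v)" for v
    by (rule Ck_on_cong[OF assms(2) _ Suc.IH, of "\<lambda>x. frechet_derivative f (at x) v"])
       (use Suc.prems * in auto)
  with D show ?case by (auto simp: differentiable_def)
qed

lemma Ck_on_bounded_linear:
  assumes "bounded_linear L"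
  shows "Ck_on k U L"
proof -
  have "frechet_derivative L (at x) v = L v" for x v
    using frechet_derivative_at[OF bounded_linear_imp_has_derivative[OF assms]] by metis
  then show ?thesis
    using assms
    by (cases k) (auto simp: Ck_on_const bounded_linear_imp_differentiable linear_continuous_on)
qed

lemma frechet_derivative_componentwise:
  fixes f :: "'a::euclidean_space \<Rightarrow> 'b::real_normed_vector"
  assumes "f differentiable (at x)"
  shows "frechet_derivative f (at x) w = (\<Sum>b\<in>Basis. (w \<bullet> b) *\<^sub>R frechet_derivative f (at x) b)"
proof -
  have lin: "linear (frechet_derivative f (at x))"
    using assms by (rule linear_frechet_derivative)
  have "frechet_derivative f (at x) w = frechet_derivative f (at x) (\<Sum>b\<in>Basis. (w \<bullet> b) *\<^sub>R b)"
    by (simp add: euclidean_representation)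
  then show ?thesis
    by (simp add: linear_sum[OF lin] linear_scale[OF lin])
qed

text \<open>The chain rule evaluates the derivative of g in a direction that moves with x, while
  \<open>Ck_on\<close> controls fixed directions. Expanding over \<open>Basis\<close> gives a finite
  sum of products whose g-factors have fixed directions; the induction hypothesis, kept general in
  g, covers these.\<close>

lemma Ck_on_compose:
  fixes g :: "'b::euclidean_space \<Rightarrow> 'c::real_normed_vector"
  assumes "open U" "open V" "f ` U \<subseteq> V" "Ck_on k U f" "Ck_on k V g"
  shows "Ck_on k U (\<lambda>x. g (f x))"
  using assms(4,5)
proof (induction k arbitrary: g)
  case 0
  then show ?case using assms(3) by (auto intro: continuous_on_compose2)
next
  case (Suc k)
  have diff: "f differentiable (at x)" "g differentiable (at (f x))" if "x \<in> U" for x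
    using Suc.prems that assms(3) by auto
  have D: "((\<lambda>x. g (f x)) has_derivative
      (\<lambda>v. frechet_derivative g (at (f x)) (frechet_derivative f (at x) v))) (at x)"
    if "x \<in> U" for x
    using has_derivative_compose[OF diff(1)[OF that, unfolded frechet_derivative_works]
        diff(2)[OF that, unfolded frechet_derivative_works]] .
  have *: "frechet_derivative (\<lambda>x. g (f x)) (at x) v = (\<Sum>b\<in>Basis.
      (frechet_derivative f (at x) v \<bullet> b) *\<^sub>R frechet_derivative g (at (f x)) b)"
    if "x \<in> U" for x v
    unfolding frechet_derivative_at[OF D[OF that], symmetric]
    by (rule frechet_derivative_componentwise[OF diff(2)[OF that]])
  have "Ck_on k U (\<lambda>x. \<Sum>b\<in>Basis.
      (frechet_derivative f (at x) v \<bullet> b) *\<^sub>R frechet_derivative g (at (f x)) b)" for v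
    using Suc.prems
    by (intro Ck_on_sum Ck_on_bilinear[OF bounded_bilinear_scaleR]
          Ck_on_linear_compose[OF bounded_linear_inner_left] assms(1)
          Suc.IH[OF Ck_on_SucD[OF Suc.prems(1)], where g = "\<lambda>y. frechet_derivative g (at y) b" for b])
       auto
  then have "Ck_on k U (\<lambda>x. frechet_derivative (\<lambda>x. g (f x)) (at x) v)" for v
    by (rule Ck_on_cong[OF assms(1), rotated]) (simp add: *)
  with D show ?case by (auto simp: differentiable_def)
qed

section \<open>Smoothness on open sets and, by local extension, on arbitrary sets\<close>

definition Cinf_on ::
  "'a::real_normed_vector set \<Rightarrow> ('a \<Rightarrow> 'b::real_normed_vector) \<Rightarrow> bool" where
  "Cinf_on U f \<longleftrightarrow> (\<forall>k. Ck_on k U f)"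

lemma Cinf_on_differentiable: "Cinf_on U f \<Longrightarrow> x \<in> U \<Longrightarrow> f differentiable (at x)"
  unfolding Cinf_on_def by (metis Ck_on.simps(2))

lemma Cinf_on_continuous: "Cinf_on U f \<Longrightarrow> continuous_on U f"
  unfolding Cinf_on_def by (metis Ck_on.simps(1))

lemma Cinf_on_derivative: "Cinf_on U f \<Longrightarrow> Cinf_on U (\<lambda>x. frechet_derivative f (at x) v)"
  unfolding Cinf_on_def by (metis Ck_on.simps(2))

lemma Cinf_on_subset: "Cinf_on U f \<Longrightarrow> V \<subseteq> U \<Longrightarrow> Cinf_on V f"
  unfolding Cinf_on_def by (blast intro: Ck_on_subset)

lemma Cinf_on_const: "Cinf_on U (\<lambda>x. c)"
  by (simp add: Cinf_on_def Ck_on_const)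

lemma Cinf_on_bounded_linear: "bounded_linear L \<Longrightarrow> Cinf_on U L"
  by (simp add: Cinf_on_def Ck_on_bounded_linear)

lemma Cinf_on_add: "open U \<Longrightarrow> Cinf_on U f \<Longrightarrow> Cinf_on U g \<Longrightarrow> Cinf_on U (\<lambda>x. f x + g x)"
  by (simp add: Cinf_on_def Ck_on_add)

lemma Cinf_on_bilinear:
  "bounded_bilinear pr \<Longrightarrow> open U \<Longrightarrow> Cinf_on U f \<Longrightarrow> Cinf_on U g
    \<Longrightarrow> Cinf_on U (\<lambda>x. pr (f x) (g x))"
  by (simp add: Cinf_on_def Ck_on_bilinear)

lemma Cinf_on_compose:
  fixes g :: "'b::euclidean_space \<Rightarrow> 'c::real_normed_vector"
  shows "open U \<Longrightarrow> open V \<Longrightarrow> f ` U \<subseteq> V \<Longrightarrow> Cinf_on U f \<Longrightarrow> Cinf_on V g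
    \<Longrightarrow> Cinf_on U (\<lambda>x. g (f x))"
  by (simp add: Cinf_on_def Ck_on_compose)

lemma smooth_on_iff_Cinf_on: "smooth_on S f \<longleftrightarrow>
    (\<forall>x\<in>S. \<exists>U g. open U \<and> x \<in> U \<and> Cinf_on U g \<and> (\<forall>y\<in>S \<inter> U. g y = f y))"
  by (simp add: smooth_on_def Cinf_on_def)

lemma Cinf_on_imp_smooth_on: "open U \<Longrightarrow> Cinf_on U f \<Longrightarrow> S \<subseteq> U \<Longrightarrow> smooth_on S f"
  unfolding smooth_on_iff_Cinf_on by blast

lemma smooth_on_subset:
  assumes "smooth_on S f" "T \<subseteq> S"
  shows "smooth_on T f"
  unfolding smooth_on_iff_Cinf_on
proof
  fix x assume "x \<in> T"
  with assms obtain U g where "open U" "x \<in> U" "Cinf_on U g" "\<forall>y\<in>S \<inter> U. g y = f y"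
    unfolding smooth_on_iff_Cinf_on by (meson subsetD)
  with assms(2) show "\<exists>U g. open U \<and> x \<in> U \<and> Cinf_on U g \<and> (\<forall>y\<in>T \<inter> U. g y = f y)"
    by (intro exI[of _ U] exI[of _ g]) auto
qed

lemma smooth_on_cong: "smooth_on S f \<Longrightarrow> (\<And>x. x \<in> S \<Longrightarrow> f x = g x) \<Longrightarrow> smooth_on S g"
  unfolding smooth_on_iff_Cinf_on by (metis IntD1)

lemma smooth_on_local:
  assumes "\<And>x. x \<in> S \<Longrightarrow> \<exists>U. open U \<and> x \<in> U \<and> smooth_on (S \<inter> U) f"
  shows "smooth_on S f"
  unfolding smooth_on_iff_Cinf_on
proof
  fix x assume "x \<in> S"
  with assms obtain U where U: "open U" "x \<in> U" "smooth_on (S \<inter> U) f" by blast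
  with \<open>x \<in> S\<close> obtain V g where "open V" "x \<in> V" "Cinf_on V g" "\<forall>y\<in>S \<inter> U \<inter> V. g y = f y"
    unfolding smooth_on_iff_Cinf_on by blast
  with U show "\<exists>U g. open U \<and> x \<in> U \<and> Cinf_on U g \<and> (\<forall>y\<in>S \<inter> U. g y = f y)"
    by (intro exI[of _ "U \<inter> V"] exI[of _ g]) (auto intro: Cinf_on_subset)
qed

lemma smooth_on_continuous: "smooth_on S f \<Longrightarrow> continuous_on S f"
proof -
  assume smooth: "smooth_on S f"
  have "\<exists>U. open U \<and> x \<in> U \<and> continuous_on (S \<inter> U) f" if "x \<in> S" for x
  proof -
    from smooth that obtain U g where
      "open U" "x \<in> U" "Cinf_on U g" "\<forall>y\<in>S \<inter> U. g y = f y"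
      unfolding smooth_on_iff_Cinf_on by blast
    then show ?thesis
      by (metis Cinf_on_continuous continuous_on_cong continuous_on_subset inf_le2)
  qed
  then show ?thesis
    using Ck_on_local[of S 0 f] by simp
qed

lemma smooth_on_const: "smooth_on S (\<lambda>x. c)"
  by (rule Cinf_on_imp_smooth_on[OF open_UNIV Cinf_on_const]) simp

lemma smooth_on_bounded_linear: "bounded_linear L \<Longrightarrow> smooth_on S L"
  by (rule Cinf_on_imp_smooth_on[OF open_UNIV Cinf_on_bounded_linear]) auto

lemma smooth_on_compose:
  fixes g :: "'b::euclidean_space \<Rightarrow> 'c::real_normed_vector"
  assumes "smooth_on T g" "smooth_on S f" "f ` S \<subseteq> T"
  shows "smooth_on S (\<lambda>x. g (f x))"
  unfolding smooth_on_iff_Cinf_on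
proof
  fix x assume "x \<in> S"
  with assms(2) obtain U f' where U: "open U" "x \<in> U" "Cinf_on U f'" "\<forall>y\<in>S \<inter> U. f' y = f y"
    unfolding smooth_on_iff_Cinf_on by blast
  from assms(1,3) \<open>x \<in> S\<close> obtain V g' where
    V: "open V" "f x \<in> V" "Cinf_on V g'" "\<forall>y\<in>T \<inter> V. g' y = g y"
    unfolding smooth_on_iff_Cinf_on by blast
  have op: "open (U \<inter> f' -` V)"
    using continuous_open_preimage[OF Cinf_on_continuous[OF U(3)] U(1) V(1)] .
  have "Cinf_on (U \<inter> f' -` V) (\<lambda>x. g' (f' x))"
    by (rule Cinf_on_compose[OF op V(1) _ Cinf_on_subset[OF U(3)] V(3)]) auto
  with op U V assms(3) \<open>x \<in> S\<close>
  show "\<exists>U h. open U \<and> x \<in> U \<and> Cinf_on U h \<and> (\<forall>y\<in>S \<inter> U. h y = g (f y))"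
    by (intro exI[of _ "U \<inter> f' -` V"] exI[of _ "\<lambda>x. g' (f' x)"]) auto
qed

lemma smooth_on_bilinear:
  assumes "bounded_bilinear pr" "smooth_on S f" "smooth_on S g"
  shows "smooth_on S (\<lambda>x. pr (f x) (g x))"
  unfolding smooth_on_iff_Cinf_on
proof
  fix x assume "x \<in> S"
  with assms(2) obtain U f' where U: "open U" "x \<in> U" "Cinf_on U f'" "\<forall>y\<in>S \<inter> U. f' y = f y"
    unfolding smooth_on_iff_Cinf_on by blast
  from assms(3) \<open>x \<in> S\<close> obtain V g' where
    V: "open V" "x \<in> V" "Cinf_on V g'" "\<forall>y\<in>S \<inter> V. g' y = g y"
    unfolding smooth_on_iff_Cinf_on by blast
  have "Cinf_on (U \<inter> V) (\<lambda>x. pr (f' x) (g' x))"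
    using U V by (intro Cinf_on_bilinear[OF assms(1)]) (auto intro: Cinf_on_subset)
  with U V show "\<exists>U h. open U \<and> x \<in> U \<and> Cinf_on U h \<and> (\<forall>y\<in>S \<inter> U. h y = pr (f y) (g y))"
    by (intro exI[of _ "U \<inter> V"] exI[of _ "\<lambda>x. pr (f' x) (g' x)"]) auto
qed

lemma smooth_on_linear_compose:
  assumes "bounded_linear L" "smooth_on S f"
  shows "smooth_on S (\<lambda>x. L (f x))"
proof -
  \<comment> \<open>Seen as a product with the constant function 1, the composition falls under
    \<open>smooth_on_bilinear\<close>, which allows any normed space between f and L, whereas
    \<open>smooth_on_compose\<close> asks for a Euclidean one.\<close>
  have "bounded_bilinear (\<lambda>(c::real) y. c *\<^sub>R L y)"
    using bounded_bilinear.comp[OF bounded_bilinear_scaleR bounded_linear_ident assms(1)] .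
  from smooth_on_bilinear[OF this smooth_on_const[of S 1] assms(2)]
  show ?thesis by simp
qed

lemma smooth_on_add:
  assumes "smooth_on S f" "smooth_on S g"
  shows "smooth_on S (\<lambda>x. f x + g x)"
  unfolding smooth_on_iff_Cinf_on
proof
  fix x assume "x \<in> S"
  with assms(1) obtain U f' where U: "open U" "x \<in> U" "Cinf_on U f'" "\<forall>y\<in>S \<inter> U. f' y = f y"
    unfolding smooth_on_iff_Cinf_on by blast
  from assms(2) \<open>x \<in> S\<close> obtain V g' where
    V: "open V" "x \<in> V" "Cinf_on V g'" "\<forall>y\<in>S \<inter> V. g' y = g y"
    unfolding smooth_on_iff_Cinf_on by blast
  have "Cinf_on (U \<inter> V) (\<lambda>x. f' x + g' x)"
    using U V by (intro Cinf_on_add) (auto intro: Cinf_on_subset)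
  with U V show "\<exists>U h. open U \<and> x \<in> U \<and> Cinf_on U h \<and> (\<forall>y\<in>S \<inter> U. h y = f y + g y)"
    by (intro exI[of _ "U \<inter> V"] exI[of _ "\<lambda>x. f' x + g' x"]) auto
qed

lemma smooth_on_sum:
  assumes "\<And>i. i \<in> I \<Longrightarrow> smooth_on S (f i)"
  shows "smooth_on S (\<lambda>x. \<Sum>i\<in>I. f i x)"
  using assms
  by (induction I rule: infinite_finite_induct) (auto intro: smooth_on_const smooth_on_add)

lemma smooth_on_Pair:
  assumes "smooth_on S f" "smooth_on S g"
  shows "smooth_on S (\<lambda>x. (f x, g x))"
proof -
  have "bounded_linear (\<lambda>y. (y, 0))" "bounded_linear (\<lambda>y. (0, y))"
    by (intro bounded_linear_Pair bounded_linear_ident bounded_linear_zero)+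
  from smooth_on_add[OF smooth_on_linear_compose[OF this(1) assms(1)]
      smooth_on_linear_compose[OF this(2) assms(2)]]
  show ?thesis by simp
qed

lemma smooth_on_euclidean_components:
  fixes f :: "'a::real_normed_vector \<Rightarrow> 'b::euclidean_space"
  assumes "\<And>b. b \<in> Basis \<Longrightarrow> smooth_on S (\<lambda>x. f x \<bullet> b)"
  shows "smooth_on S f"
proof -
  have "smooth_on S (\<lambda>x. \<Sum>b\<in>Basis. (f x \<bullet> b) *\<^sub>R b)"
    by (intro smooth_on_sum smooth_on_bilinear[OF bounded_bilinear_scaleR] smooth_on_const assms)
  then show ?thesis by (simp add: euclidean_representation)
qed

lemma Cinf_on_eq_smooth_on:
  assumes "open S"
  shows "Cinf_on S f \<longleftrightarrow> smooth_on S f"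
proof
  assume f: "smooth_on S f"
  show "Cinf_on S f"
    unfolding Cinf_on_def
  proof (intro allI Ck_on_local)
    fix k x assume "x \<in> S"
    with f obtain U g where U: "open U" "x \<in> U" "Cinf_on U g" "\<forall>y\<in>S \<inter> U. g y = f y"
      unfolding smooth_on_iff_Cinf_on by blast
    have "Ck_on k (S \<inter> U) g"
      using U(3) unfolding Cinf_on_def by (auto intro: Ck_on_subset)
    with U show "\<exists>U. open U \<and> x \<in> U \<and> Ck_on k (S \<inter> U) f"
      by (intro exI[of _ U]) (auto intro!: Ck_on_cong[of "S \<inter> U" g f] assms)
  qed
qed (auto intro: Cinf_on_imp_smooth_on[OF assms])

text \<open>Differentiating under the integral produces a factor t from the inner map. With the
  weight t^j in the statement, the derivative in direction v is the same kind of integral for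
  \<open>Suc j\<close> and the directional derivative of K, so the induction runs with j and K
  general.\<close>

lemma Ck_on_param_integral:
  fixes K :: "'a::euclidean_space \<Rightarrow> 'b::euclidean_space"
  assumes "Cinf_on (ball y0 r) K"
  shows "Ck_on k (ball y0 r)
    (\<lambda>y. integral (cbox 0 1) (\<lambda>t. t ^ j *\<^sub>R K (y0 + t *\<^sub>R (y - y0))))"
  using assms
proof (induction k arbitrary: j K)
  case (0 j K)
  have seg: "y0 + t *\<^sub>R (y - y0) \<in> ball y0 r" if "y \<in> ball y0 r" "t \<in> cbox 0 1" for y and t :: real
    using that mult_left_le_one_le[of "norm (y - y0)" t]
    by (auto simp: dist_norm norm_minus_commute)
  have "continuous_on (ball y0 r \<times> cbox 0 1) (\<lambda>z. K (y0 + snd z *\<^sub>R (fst z - y0)))"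
    by (rule continuous_on_compose2[OF Cinf_on_continuous[OF 0]])
       (use seg in \<open>force intro: continuous_intros\<close>)+
  then have "continuous_on (ball y0 r \<times> cbox 0 1)
      (\<lambda>(y, t). t ^ j *\<^sub>R K (y0 + t *\<^sub>R (y - y0)))"
    unfolding case_prod_beta by (intro continuous_intros)
  from integral_continuous_on_param[OF this] show ?case
    by simp
next
  case (Suc k j K)
  let ?D = "\<lambda>y. frechet_derivative K (at y)"
  let ?I = "\<lambda>y. integral (cbox 0 1) (\<lambda>t. t ^ j *\<^sub>R K (y0 + t *\<^sub>R (y - y0)))"
  \<comment> \<open>\<open>leibniz_rule\<close> expects the derivative as a function of (y, t) with
    values in the bounded linear maps. The extra factor t is the derivative of y0 + t (y - y0) with
    respect to y.\<close>
  define B :: "'a \<Rightarrow> real \<Rightarrow> 'a \<Rightarrow>\<^sub>L 'b"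
    where "B y t = Blinfun (\<lambda>v. t ^ Suc j *\<^sub>R ?D (y0 + t *\<^sub>R (y - y0)) v)" for y t
  have seg: "y0 + t *\<^sub>R (y - y0) \<in> ball y0 r" if "y \<in> ball y0 r" "t \<in> cbox 0 1" for y and t :: real
    using that mult_left_le_one_le[of "norm (y - y0)" t]
    by (auto simp: dist_norm norm_minus_commute)
  have D: "(K has_derivative ?D y) (at y)" if "y \<in> ball y0 r" for y
    using Cinf_on_differentiable[OF Suc.prems that] by (simp add: frechet_derivative_works)
  have B: "blinfun_apply (B y t) v = t ^ Suc j *\<^sub>R ?D (y0 + t *\<^sub>R (y - y0)) v"
    if "y \<in> ball y0 r" "t \<in> cbox 0 1" for y t v
    unfolding B_def
    using has_derivative_bounded_linear[OF D[OF seg[OF that]]]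
    by (subst bounded_linear_Blinfun_apply) (auto intro: bounded_linear_scaleR_const bounded_linear_const_scaleR)
  have cont: "continuous_on (ball y0 r \<times> cbox 0 1) (\<lambda>z. H (y0 + snd z *\<^sub>R (fst z - y0)))"
    if "Cinf_on (ball y0 r) H" for H :: "'a \<Rightarrow> 'b"
    by (rule continuous_on_compose2[OF Cinf_on_continuous[OF that]])
       (use seg in \<open>force intro: continuous_intros\<close>)+
  have der: "(?I has_derivative integral (cbox 0 1) (B y)) (at y)" if y: "y \<in> ball y0 r" for y
  proof -
    have "(?I has_derivative integral (cbox 0 1) (B y)) (at y within ball y0 r)"
    proof (rule leibniz_rule[OF _ _ _ y convex_ball])
      fix x t assume x: "x \<in> ball y0 r" and t: "t \<in> cbox (0::real) 1"
      have "((\<lambda>x. y0 + t *\<^sub>R (x - y0)) has_derivative (\<lambda>v. t *\<^sub>R v)) (at x)"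
        by (auto intro!: derivative_eq_intros)
      from has_derivative_compose[OF this D[OF seg[OF x t]]]
      have "((\<lambda>x. t ^ j *\<^sub>R K (y0 + t *\<^sub>R (x - y0))) has_derivative
          (\<lambda>v. t ^ j *\<^sub>R ?D (y0 + t *\<^sub>R (x - y0)) (t *\<^sub>R v))) (at x)"
        by (rule has_derivative_scaleR_right)
      moreover have "(\<lambda>v. t ^ j *\<^sub>R ?D (y0 + t *\<^sub>R (x - y0)) (t *\<^sub>R v)) = blinfun_apply (B x t)"
        using linear_scale[OF has_derivative_linear[OF D[OF seg[OF x t]]]]
        by (auto simp: B[OF x t] mult.commute)
      ultimately show "((\<lambda>x. t ^ j *\<^sub>R K (y0 + t *\<^sub>R (x - y0))) has_derivative blinfun_apply (B x t))
          (at x within ball y0 r)"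
        by (metis has_derivative_at_withinI)
    next
      fix x assume x: "x \<in> ball y0 r"
      have "continuous_on (cbox (0::real) 1) (\<lambda>t. K (y0 + t *\<^sub>R (x - y0)))"
        by (rule continuous_on_compose2[OF Cinf_on_continuous[OF Suc.prems]])
           (use seg[OF x] in \<open>force intro: continuous_intros\<close>)+
      then show "(\<lambda>t. t ^ j *\<^sub>R K (y0 + t *\<^sub>R (x - y0))) integrable_on cbox 0 1"
        by (intro integrable_continuous continuous_intros)
    next
      show "continuous_on (ball y0 r \<times> cbox 0 1) (\<lambda>(x, t). B x t)"
      proof (rule continuous_on_blinfun_componentwise)
        fix i :: 'a
        have "continuous_on (ball y0 r \<times> cbox 0 1)
            (\<lambda>z. snd z ^ Suc j *\<^sub>R ?D (y0 + snd z *\<^sub>R (fst z - y0)) i)"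
          by (intro continuous_intros cont[OF Cinf_on_derivative[OF Suc.prems, of i]])
        moreover have "blinfun_apply (case z of (x, t) \<Rightarrow> B x t) i
            = snd z ^ Suc j *\<^sub>R ?D (y0 + snd z *\<^sub>R (fst z - y0)) i"
          if "z \<in> ball y0 r \<times> cbox 0 1" for z
          using that by (cases z) (auto simp: B simp del: mem_ball cbox_interval)
        ultimately show "continuous_on (ball y0 r \<times> cbox 0 1)
            (\<lambda>z. blinfun_apply (case z of (x, t) \<Rightarrow> B x t) i)"
          by (simp cong: continuous_on_cong_simp)
      qed
    qed
    then show ?thesis using y at_within_open[OF y open_ball] by simp
  qed
  have Bint: "B y integrable_on cbox 0 1" if y: "y \<in> ball y0 r" for y
  proof (intro integrable_continuous continuous_on_blinfun_componentwise)
    fix i :: 'a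
    have "continuous_on (cbox (0::real) 1) (\<lambda>t. ?D (y0 + t *\<^sub>R (y - y0)) i)"
      by (rule continuous_on_compose2[OF Cinf_on_continuous[OF Cinf_on_derivative[OF Suc.prems, of i]]])
         (use seg[OF y] in \<open>force intro: continuous_intros\<close>)+
    then have "continuous_on (cbox (0::real) 1) (\<lambda>t. t ^ Suc j *\<^sub>R ?D (y0 + t *\<^sub>R (y - y0)) i)"
      by (intro continuous_intros)
    then show "continuous_on (cbox 0 1) (\<lambda>t. blinfun_apply (B y t) i)"
      by (rule continuous_on_eq) (simp only: B[OF y])
  qed
  have eq: "frechet_derivative ?I (at y) v = integral (cbox 0 1)
      (\<lambda>t. t ^ Suc j *\<^sub>R ?D (y0 + t *\<^sub>R (y - y0)) v)" if y: "y \<in> ball y0 r" for y v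
  proof -
    have "frechet_derivative ?I (at y) v = blinfun_apply (integral (cbox 0 1) (B y)) v"
      using frechet_derivative_at[OF der[OF y]] by simp
    also have "\<dots> = integral (cbox 0 1) (\<lambda>t. blinfun_apply (B y t) v)"
      by (rule blinfun_apply_integral[OF Bint[OF y]])
    also have "\<dots> = integral (cbox 0 1) (\<lambda>t. t ^ Suc j *\<^sub>R ?D (y0 + t *\<^sub>R (y - y0)) v)"
      by (rule Henstock_Kurzweil_Integration.integral_cong) (rule B[OF y])
    finally show ?thesis .
  qed
  have "Ck_on k (ball y0 r) (\<lambda>y. frechet_derivative ?I (at y) v)" for v
    by (rule Ck_on_cong[OF open_ball _ Suc.IH[OF Cinf_on_derivative[OF Suc.prems, of v], of "Suc j"]])
       (rule eq[symmetric])
  with der show ?case by (auto simp: differentiable_def simp del: mem_ball)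
qed

text \<open>Integrate d/dt F(y0 + t (y - y0)) over [0, 1] and expand the direction y - y0 over
  \<open>Basis\<close>: G b is the average of a partial derivative along the segment. The factors
  that vanish at y0 are what a derivation at y0 turns into first-order information.\<close>

lemma hadamard:
  fixes F :: "'a::euclidean_space \<Rightarrow> 'b::euclidean_space"
  assumes F: "Cinf_on (ball y0 r) F" and "r > 0"
  obtains G where "\<And>b. Cinf_on (ball y0 r) (G b)"
    "\<And>b. G b y0 = frechet_derivative F (at y0) b"
    "\<And>y. y \<in> ball y0 r \<Longrightarrow> F y = F y0 + (\<Sum>b\<in>Basis. ((y - y0) \<bullet> b) *\<^sub>R G b y)"
proof
  let ?D = "\<lambda>y. frechet_derivative F (at y)"
  define G where "G b y = integral (cbox 0 1) (\<lambda>t. t ^ 0 *\<^sub>R ?D (y0 + t *\<^sub>R (y - y0)) b)" for b y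
  show "Cinf_on (ball y0 r) (G b)" for b
    unfolding G_def Cinf_on_def
    by (intro allI Ck_on_param_integral Cinf_on_derivative F)
  show "G b y0 = frechet_derivative F (at y0) b" for b
    by (simp add: G_def)
  fix y assume y: "y \<in> ball y0 r"
  have seg: "y0 + t *\<^sub>R (y - y0) \<in> ball y0 r" if "t \<in> {0..1}" for t :: real
    using that y mult_left_le_one_le[of "norm (y - y0)" t]
    by (auto simp: dist_norm norm_minus_commute)
  have "((\<lambda>t. F (y0 + t *\<^sub>R (y - y0))) has_vector_derivative ?D (y0 + t *\<^sub>R (y - y0)) (y - y0))
      (at t within {0..1})" if t: "t \<in> {0..1}" for t
  proof -
    have D: "(F has_derivative ?D (y0 + t *\<^sub>R (y - y0))) (at (y0 + t *\<^sub>R (y - y0)))"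
      using Cinf_on_differentiable[OF F seg[OF t]] by (simp add: frechet_derivative_works)
    have "((\<lambda>t. y0 + t *\<^sub>R (y - y0)) has_derivative (\<lambda>h. h *\<^sub>R (y - y0))) (at t within {0..1})"
      by (auto intro!: derivative_eq_intros)
    from has_derivative_compose[OF this D] linear_scale[OF has_derivative_linear[OF D]]
    show ?thesis by (simp add: has_vector_derivative_def)
  qed
  then have "((\<lambda>t. ?D (y0 + t *\<^sub>R (y - y0)) (y - y0)) has_integral
      F (y0 + 1 *\<^sub>R (y - y0)) - F (y0 + 0 *\<^sub>R (y - y0))) {0..1}"
    by (intro fundamental_theorem_of_calculus) auto
  then have "F y - F y0 = integral (cbox 0 1) (\<lambda>t. ?D (y0 + t *\<^sub>R (y - y0)) (y - y0))"
    by (simp add: integral_unique)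
  also have "\<dots> = integral (cbox 0 1)
      (\<lambda>t. \<Sum>b\<in>Basis. ((y - y0) \<bullet> b) *\<^sub>R ?D (y0 + t *\<^sub>R (y - y0)) b)"
    by (intro Henstock_Kurzweil_Integration.integral_cong frechet_derivative_componentwise
        Cinf_on_differentiable[OF F]) (use seg in auto)
  also have "\<dots> = (\<Sum>b\<in>Basis. integral (cbox 0 1)
      (\<lambda>t. ((y - y0) \<bullet> b) *\<^sub>R ?D (y0 + t *\<^sub>R (y - y0)) b))"
  proof (intro Henstock_Kurzweil_Integration.integral_sum finite_Basis integrable_cmul integrable_continuous)
    fix b :: 'a
    show "continuous_on (cbox 0 1) (\<lambda>t. ?D (y0 + t *\<^sub>R (y - y0)) b)"
      by (rule continuous_on_compose2[OF Cinf_on_continuous[OF Cinf_on_derivative[OF F, of b]]])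
         (use seg in \<open>force intro: continuous_intros\<close>)+
  qed
  also have "\<dots> = (\<Sum>b\<in>Basis. ((y - y0) \<bullet> b) *\<^sub>R G b y)"
    by (simp add: G_def)
  finally show "F y = F y0 + (\<Sum>b\<in>Basis. ((y - y0) \<bullet> b) *\<^sub>R G b y)"
    by (simp add: algebra_simps)
qed

text \<open>For $p = 1$ this is the function $e^{-1/t}$; the polynomial makes the family closed under
  differentiation.\<close>

definition flat :: "real poly \<Rightarrow> real \<Rightarrow> real" where
  "flat p t = (if t \<le> 0 then 0 else poly p (inverse t) * exp (- inverse t))"

section \<open>Flat functions and bump functions on Euclidean space\<close>

lemma flat_tendsto_0: "(flat p \<longlongrightarrow> 0) (at 0)"
proof -
  \<comment> \<open>With u = 1/t the limit from the right becomes the decay of a polynomial times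
    exp (- u) at infinity, taken monomial by monomial.\<close>
  have "((\<lambda>u. \<Sum>i\<le>degree p. coeff p i * (u ^ i / exp u)) \<longlongrightarrow> 0) at_top"
    by (intro tendsto_null_sum tendsto_mult_right_zero tendsto_power_div_exp_0)
  moreover have "(\<Sum>i\<le>degree p. coeff p i * (u ^ i / exp u)) = poly p u * exp (- u)" for u
    by (simp add: poly_altdef sum_distrib_right exp_minus divide_inverse mult.assoc)
  ultimately have "((\<lambda>u. poly p u * exp (- u)) \<longlongrightarrow> 0) at_top"
    by simp
  from filterlim_compose[OF this filterlim_inverse_at_top_right]
  have "((\<lambda>t. poly p (inverse t) * exp (- inverse t)) \<longlongrightarrow> 0) (at_right 0)" .
  then have r: "(flat p \<longlongrightarrow> 0) (at_right 0)"
    by (rule Lim_transform_eventually)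
       (auto simp: flat_def eventually_at_filter)
  have "((\<lambda>_. 0::real) \<longlongrightarrow> 0) (at_left (0::real))"
    by simp
  then have "(flat p \<longlongrightarrow> 0) (at_left 0)"
    by (rule Lim_transform_eventually) (auto simp: flat_def eventually_at_filter)
  with r show ?thesis
    by (simp add: filterlim_at_split)
qed

text \<open>With u = 1/t and du/dt = - u^2, differentiating p(u) exp (- u) gives u^2 (p(u) - p'(u))
  exp (- u); the factor \<open>[:0, 0, 1:]\<close> is u^2.\<close>

lemma flat_has_derivative:
  "(flat p has_real_derivative flat ([:0, 0, 1:] * (p - pderiv p)) t) (at t)"
proof -
  consider "t < 0" | "t > 0" | "t = 0" by linarith
  then show ?thesis
  proof cases
    case 1
    have "((\<lambda>_. 0) has_real_derivative 0) (at t)" by simp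
    then show ?thesis
      using 1 by (simp add: flat_def)
        (rule has_field_derivative_transform_within_open[where S = "{..<0}"], auto simp: flat_def)
  next
    case 2
    have "((\<lambda>t. poly p (inverse t) * exp (- inverse t)) has_real_derivative
        flat ([:0, 0, 1:] * (p - pderiv p)) t) (at t)"
      using 2 by (auto intro!: derivative_eq_intros simp: flat_def power2_eq_square algebra_simps)
    then show ?thesis
      by (rule has_field_derivative_transform_within_open[where S = "{0<..}"]) (use 2 in \<open>auto simp: flat_def\<close>)
  next
    case 3
    \<comment> \<open>The difference quotient at 0 is again a flat function, for the polynomial u
      p(u), because division by h is multiplication by u.\<close>
    have "((\<lambda>h. (flat p (0 + h) - flat p 0) / h) \<longlongrightarrow> 0) (at 0)"
      by (rule Lim_transform_eventually[OF flat_tendsto_0[of "[:0, 1:] * p"]])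
         (auto simp: eventually_at_filter flat_def field_simps)
    then show ?thesis
      using 3 by (simp add: DERIV_def flat_def)
  qed
qed

lemma Cinf_on_flat: "Cinf_on U (flat p)"
  unfolding Cinf_on_def
proof
  fix k
  have "Ck_on k UNIV (flat p)"
  proof (induction k arbitrary: p)
    case 0
    show ?case
      using flat_has_derivative by (auto intro!: continuous_at_imp_continuous_on DERIV_isCont)
  next
    case (Suc k)
    have "frechet_derivative (flat p) (at t) v = flat ([:0, 0, 1:] * (p - pderiv p)) t *\<^sub>R v" for t v
      using frechet_derivative_at[OF flat_has_derivative[of p t, unfolded has_field_derivative_def]]
      by (metis real_scaleR_def)
    moreover have "Ck_on k UNIV (\<lambda>t. flat ([:0, 0, 1:] * (p - pderiv p)) t *\<^sub>R v)" for v :: real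
      by (rule Ck_on_linear_compose[OF bounded_linear_scaleR_left open_UNIV Suc.IH])
    moreover have "flat p differentiable (at t)" for t
      using flat_has_derivative unfolding has_field_derivative_def differentiable_def by blast
    ultimately show ?case by auto
  qed
  then show "Ck_on k U (flat p)"
    by (rule Ck_on_subset) simp
qed

lemma smooth_bump_euclidean:
  fixes y0 :: "'a::euclidean_space"
  assumes "r > 0"
  obtains \<beta> :: "'a \<Rightarrow> real" where "Cinf_on UNIV \<beta>" "\<And>y. dist y0 y < r / 2 \<Longrightarrow> \<beta> y = 1"
    "\<And>y. r \<le> dist y0 y \<Longrightarrow> \<beta> y = 0"
proof
  \<comment> \<open>The constants make s nonpositive at distance below r/2 and at least 1 at
    distance r or more. In \<beta>, s \<le> 0 leaves the outer argument at \<open>flat 1 1\<close>,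
    so the normalized value is 1; s \<ge> 1 makes \<open>flat 1 (s y)\<close> at least
    \<open>flat 1 1\<close>, so the outer argument is nonpositive and \<beta> vanishes.\<close>
  define s where "s y = (4 / r\<^sup>2) * ((y - y0) \<bullet> (y - y0)) + (- 1)" for y
  define \<beta> where "\<beta> y = inverse (flat 1 (flat 1 1)) * flat 1 (flat 1 1 + (- 1) * flat 1 (s y))" for y
  have "smooth_on UNIV (\<lambda>y. y + (- y0))"
    by (intro smooth_on_add smooth_on_const smooth_on_bounded_linear bounded_linear_ident)
  then have "smooth_on UNIV s"
    unfolding s_def
    by (intro smooth_on_add smooth_on_const smooth_on_bilinear[OF bounded_bilinear_mult]
        smooth_on_bilinear[OF bounded_bilinear_inner]) auto
  then have "smooth_on UNIV (\<lambda>y. flat 1 (s y))"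
    by (rule smooth_on_compose[OF Cinf_on_imp_smooth_on[OF open_UNIV Cinf_on_flat subset_refl]]) simp
  then have "smooth_on UNIV (\<lambda>y. flat 1 1 + (- 1) * flat 1 (s y))"
    by (intro smooth_on_add smooth_on_const smooth_on_bilinear[OF bounded_bilinear_mult])
  then have "smooth_on UNIV (\<lambda>y. flat 1 (flat 1 1 + (- 1) * flat 1 (s y)))"
    by (rule smooth_on_compose[OF Cinf_on_imp_smooth_on[OF open_UNIV Cinf_on_flat subset_refl]]) simp
  then have "smooth_on UNIV \<beta>"
    unfolding \<beta>_def by (intro smooth_on_const smooth_on_bilinear[OF bounded_bilinear_mult])
  then show "Cinf_on UNIV \<beta>"
    by (simp add: Cinf_on_eq_smooth_on)
  have s: "s y = 4 * (dist y0 y)\<^sup>2 / r\<^sup>2 - 1" for y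
    by (simp add: s_def dist_norm power2_norm_eq_inner inner_diff inner_commute)
  have pos: "flat 1 1 > 0" "flat 1 (flat 1 1) > 0"
    by (auto simp: flat_def)
  show "\<beta> y = 1" if "dist y0 y < r / 2" for y
  proof -
    have "(dist y0 y)\<^sup>2 \<le> (r / 2)\<^sup>2"
      using that by (intro power_mono) auto
    then have "s y \<le> 0"
      using assms by (simp add: s field_simps power2_eq_square)
    then show ?thesis using pos by (simp add: \<beta>_def flat_def)
  qed
  show "\<beta> y = 0" if "r \<le> dist y0 y" for y
  proof -
    have "r\<^sup>2 \<le> (dist y0 y)\<^sup>2"
      using that assms by (intro power_mono) auto
    then have "r\<^sup>2 \<le> 2 * (dist y0 y)\<^sup>2"
      using zero_le_power2[of "dist y0 y"] by linarith
    then have "1 \<le> s y"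
      using assms by (simp add: s field_simps)
    then have "inverse (s y) \<le> inverse 1"
      by (intro le_imp_inverse_le) auto
    then have "flat 1 1 \<le> flat 1 (s y)"
      using \<open>1 \<le> s y\<close> by (simp add: flat_def)
    then show ?thesis by (simp add: \<beta>_def flat_def)
  qed
qed

section \<open>Smooth matrix operations and the group SL\<close>

lemma smooth_on_vec:
  fixes f :: "'a::real_normed_vector \<Rightarrow> 'b::euclidean_space^'n"
  assumes "\<And>i. smooth_on S (\<lambda>x. f x $ i)"
  shows "smooth_on S f"
proof (rule smooth_on_euclidean_components)
  fix b :: "'b^'n" assume "b \<in> Basis"
  then obtain i c where "b = axis i c" by (auto simp: Basis_vec_def)
  then show "smooth_on S (\<lambda>x. f x \<bullet> b)"
    using smooth_on_linear_compose[OF bounded_linear_inner_left assms[of i], of c]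
    by (simp add: inner_axis)
qed

lemma smooth_on_prod:
  fixes f :: "'i \<Rightarrow> 'a::real_normed_vector \<Rightarrow> complex"
  assumes "\<And>i. i \<in> I \<Longrightarrow> smooth_on S (f i)"
  shows "smooth_on S (\<lambda>x. \<Prod>i\<in>I. f i x)"
  using assms
  by (induction I rule: infinite_finite_induct)
     (auto intro: smooth_on_const smooth_on_bilinear[OF bounded_bilinear_mult])

lemma smooth_on_det:
  fixes f :: "'a::real_normed_vector \<Rightarrow> complex^'n^'n"
  assumes "\<And>i j. smooth_on S (\<lambda>x. f x $ i $ j)"
  shows "smooth_on S (\<lambda>x. det (f x))"
  unfolding det_def
  by (intro smooth_on_sum smooth_on_bilinear[OF bounded_bilinear_mult] smooth_on_const
      smooth_on_prod assms)

lemma bounded_linear_matrix_entry: "bounded_linear (\<lambda>A :: complex^'n^'m. A $ i $ j)"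
  using bounded_linear_compose[OF bounded_linear_vec_nth bounded_linear_vec_nth] .

lemma matrix_scaleR_left: "(c *\<^sub>R A) ** B = c *\<^sub>R ((A :: complex^'n^'m) ** (B :: complex^'k^'n))"
  by (simp add: vec_eq_iff matrix_matrix_mult_def scaleR_sum_right)

lemma matrix_scaleR_right: "A ** (c *\<^sub>R B) = c *\<^sub>R ((A :: complex^'n^'m) ** (B :: complex^'k^'n))"
  by (simp add: vec_eq_iff matrix_matrix_mult_def scaleR_sum_right)

lemma matrix_add_rdistrib: "((A :: complex^'n^'m) + B) ** (C :: complex^'k^'n) = A ** C + B ** C"
  by (simp add: vec_eq_iff matrix_matrix_mult_def sum.distrib algebra_simps)

lemma matrix_vector_mult_axis: "((A :: complex^'n^'m) *v axis j 1) $ k = A $ k $ j"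
  by (simp add: matrix_vector_mult_def axis_def if_distrib cong: if_cong)

lemma bounded_bilinear_matrix_mult:
  "bounded_bilinear ((**) :: complex^'n^'m \<Rightarrow> complex^'k^'n \<Rightarrow> complex^'k^'m)"
  unfolding bilinear_conv_bounded_bilinear[symmetric] bilinear_def
  by (auto intro!: linearI simp: matrix_add_ldistrib matrix_add_rdistrib matrix_scaleR_left
      matrix_scaleR_right)

lemma bounded_linear_mat: "bounded_linear (mat :: complex \<Rightarrow> complex^'n^'n)"
  by (intro linear_conv_bounded_linear[THEN iffD1] linearI)
     (auto simp: mat_def vec_eq_iff)

text \<open>The adjugate by Cramer's rule: unlike the inverse, it is a polynomial in the entries.\<close>

definition adjugate :: "complex^'n^'n::finite \<Rightarrow> complex^'n^'n" where
  "adjugate A = (\<chi> k j. det (\<chi> i l. if l = k then axis j 1 $ i else A $ i $ l))"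

lemma smooth_on_adjugate: "smooth_on S (adjugate :: complex^'n^'n::finite \<Rightarrow> _)"
proof (intro smooth_on_vec)
  fix k j
  have "smooth_on S (\<lambda>A::complex^'n^'n. A $ i $ l)" for i l
    by (intro smooth_on_bounded_linear bounded_linear_matrix_entry)
  then have "smooth_on S (\<lambda>A::complex^'n^'n. if l = k then axis j 1 $ i else A $ i $ l)" for i l
    by (cases "l = k") (auto intro: smooth_on_const)
  then show "smooth_on S (\<lambda>A::complex^'n^'n. adjugate A $ k $ j)"
    unfolding adjugate_def by (simp add: smooth_on_det)
qed

text \<open>Column j of the inverse solves g x = \<open>axis j 1\<close>, and for determinant 1
  Cramer's rule gives column j of the adjugate as the solution.\<close>

lemma adjugate_SL:
  fixes g :: "complex^'n^'n::finite"
  assumes "g \<in> SL"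
  shows "g ** adjugate g = mat 1" "adjugate g ** g = mat 1" "adjugate g \<in> SL"
proof -
  from assms have d: "det g = 1" by (simp add: SL_def)
  then obtain h where h: "g ** h = mat 1" "h ** g = mat 1"
    by (metis invertible_def invertible_det_nz zero_neq_one)
  have "h $ k $ j = adjugate g $ k $ j" for k j
  proof -
    have "g *v (h *v axis j 1) = axis j 1"
      using h by (simp add: matrix_vector_mul_assoc)
    from cramer[of g "h *v axis j 1" "axis j 1"] this d
    have "h *v axis j 1 = (\<chi> k. det (\<chi> i l. if l = k then axis j 1 $ i else g $ i $ l))"
      by simp
    then show ?thesis
      using matrix_vector_mult_axis[of h j k] by (simp add: adjugate_def)
  qed
  then have "h = adjugate g" by (simp add: vec_eq_iff)
  with h show "g ** adjugate g = mat 1" "adjugate g ** g = mat 1" by auto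
  from h have "det g * det h = 1" by (metis det_I det_mul)
  with d \<open>h = adjugate g\<close> show "adjugate g \<in> SL" by (simp add: SL_def)
qed

lemma SL_mult: "g \<in> SL \<Longrightarrow> h \<in> SL \<Longrightarrow> g ** h \<in> SL"
  by (simp add: SL_def det_mul)

lemma SL_one: "mat 1 \<in> SL"
  by (simp add: SL_def)

section \<open>Smooth functions on manifolds\<close>

lemma smooth_map_euclid_iff:
  "smooth_map M euclid S F \<longleftrightarrow> continuous_on S F \<and>
    (\<forall>(U, \<phi>)\<in>charts M. smooth_on (\<phi> ` (S \<inter> U)) (\<lambda>y. F (inv_into U \<phi> y)))"
  by (simp add: smooth_map_def euclid_def comp_def)

lemma smooth_map_euclidD:
  assumes "smooth_map M euclid S F" "(U, \<phi>) \<in> charts M"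
  shows "smooth_on (\<phi> ` (S \<inter> U)) (\<lambda>y. F (inv_into U \<phi> y))"
  using assms unfolding smooth_map_euclid_iff by blast

lemma smooth_map_euclidI:
  assumes "continuous_on S F"
    "\<And>U \<phi>. (U, \<phi>) \<in> charts M \<Longrightarrow> smooth_on (\<phi> ` (S \<inter> U)) (\<lambda>y. F (inv_into U \<phi> y))"
  shows "smooth_map M euclid S F"
  using assms unfolding smooth_map_euclid_iff by blast

lemma smooth_map_euclid_continuous: "smooth_map M euclid S F \<Longrightarrow> continuous_on S F"
  unfolding smooth_map_def by blast

lemma smooth_map_euclid_subset:
  assumes "smooth_map M euclid S F" "T \<subseteq> S"
  shows "smooth_map M euclid T F"
proof (rule smooth_map_euclidI)
  show "continuous_on T F"
    using assms smooth_map_euclid_continuous continuous_on_subset by blast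
  fix U \<phi> assume "(U, \<phi>) \<in> charts M"
  from smooth_map_euclidD[OF assms(1) this] assms(2)
  show "smooth_on (\<phi> ` (T \<inter> U)) (\<lambda>y. F (inv_into U \<phi> y))"
    by (elim smooth_on_subset) auto
qed

lemma smooth_map_const: "smooth_map M euclid S (\<lambda>x. c)"
  by (intro smooth_map_euclidI smooth_on_const continuous_on_const)

lemma smooth_map_bilinear:
  assumes "bounded_bilinear pr" "smooth_map M euclid S f" "smooth_map M euclid S g"
  shows "smooth_map M euclid S (\<lambda>x. pr (f x) (g x))"
  by (intro smooth_map_euclidI bounded_bilinear.continuous_on[OF assms(1)]
        smooth_on_bilinear[OF assms(1)] smooth_map_euclidD[OF assms(2)] smooth_map_euclidD[OF assms(3)]
        smooth_map_euclid_continuous[OF assms(2)] smooth_map_euclid_continuous[OF assms(3)])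

lemma smooth_map_linear_compose:
  assumes "bounded_linear L" "smooth_map M euclid S f"
  shows "smooth_map M euclid S (\<lambda>x. L (f x))"
  by (intro smooth_map_euclidI bounded_linear.continuous_on[OF assms(1)]
        smooth_on_linear_compose[OF assms(1)] smooth_map_euclidD[OF assms(2)]
        smooth_map_euclid_continuous[OF assms(2)])

lemma smooth_map_add:
  assumes "smooth_map M euclid S f" "smooth_map M euclid S g"
  shows "smooth_map M euclid S (\<lambda>x. f x + g x)"
  using assms
  by (intro smooth_map_euclidI continuous_on_add smooth_on_add)
     (auto dest: smooth_map_euclidD smooth_map_euclid_continuous)

lemma smooth_map_Pair:
  assumes "smooth_map M euclid S f" "smooth_map M euclid S g"
  shows "smooth_map M euclid S (\<lambda>x. (f x, g x))"
  using assms
  by (intro smooth_map_euclidI continuous_on_Pair smooth_on_Pair)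
     (auto dest: smooth_map_euclidD smooth_map_euclid_continuous)

lemma smooth_map_sum:
  assumes "\<And>i. i \<in> I \<Longrightarrow> smooth_map M euclid S (f i)"
  shows "smooth_map M euclid S (\<lambda>x. \<Sum>i\<in>I. f i x)"
  using assms
  by (induction I rule: infinite_finite_induct) (auto intro: smooth_map_const smooth_map_add)

lemma smooth_map_matrix_mult:
  fixes f :: "'a::topological_space \<Rightarrow> complex^'n^'m" and g :: "'a \<Rightarrow> complex^'k^'n"
  shows "smooth_map M euclid S f \<Longrightarrow> smooth_map M euclid S g \<Longrightarrow> smooth_map M euclid S (\<lambda>x. f x ** g x)"
  by (rule smooth_map_bilinear[OF bounded_bilinear_matrix_mult])

text \<open>The part of \<open>smooth_manifold\<close> on which gluing and composing smooth maps
  rest. It passes directly to a product with a Euclidean space, so functions on base times matrices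
  can be treated in the same way as functions on a manifold.\<close>

definition topological_atlas :: "('m::topological_space, 'e::topological_space) manifold \<Rightarrow> bool" where
  "topological_atlas M \<longleftrightarrow> (\<Union>(U, \<phi>)\<in>charts M. U) = UNIV \<and>
    (\<forall>(U, \<phi>)\<in>charts M. open U \<and> homeomorphism U (\<phi> ` U) \<phi> (inv_into U \<phi>))"

lemma smooth_manifold_atlas: "smooth_manifold M \<Longrightarrow> topological_atlas M"
  unfolding smooth_manifold_def topological_atlas_def by blast

lemma atlas_obtain_chart:
  assumes "topological_atlas M"
  obtains U \<phi> where "(U, \<phi>) \<in> charts M" "x \<in> U"
  using assms unfolding topological_atlas_def by blast

lemma atlas_chartD:
  assumes "topological_atlas M" "(U, \<phi>) \<in> charts M"
  shows "open U" "inj_on \<phi> U" "continuous_on U \<phi>" "continuous_on (\<phi> ` U) (inv_into U \<phi>)"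
    "\<And>x. x \<in> U \<Longrightarrow> inv_into U \<phi> (\<phi> x) = x"
proof -
  have h: "open U" "homeomorphism U (\<phi> ` U) \<phi> (inv_into U \<phi>)"
    using assms unfolding topological_atlas_def by blast+
  then show "open U" "continuous_on U \<phi>" "continuous_on (\<phi> ` U) (inv_into U \<phi>)"
    "\<And>x. x \<in> U \<Longrightarrow> inv_into U \<phi> (\<phi> x) = x"
    unfolding homeomorphism_def by auto
  then show "inj_on \<phi> U" by (metis inj_on_inverseI)
qed

text \<open>Chart images lie in the subspace \<open>model\<close> and are open only relative to it,
  so an open set of the manifold corresponds to the trace of an ambient open set on the image. Such
  ambient sets are what \<open>smooth_on_local\<close> asks for.\<close>

lemma atlas_chart_open:
  assumes "topological_atlas M" "(U, \<phi>) \<in> charts M" "open V"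
  obtains O' where "open O'" "\<And>x. x \<in> U \<Longrightarrow> \<phi> x \<in> O' \<longleftrightarrow> x \<in> V"
proof -
  have "homeomorphism U (\<phi> ` U) \<phi> (inv_into U \<phi>)" "open U"
    using assms unfolding topological_atlas_def by blast+
  then have "openin (top_of_set (\<phi> ` U)) (\<phi> ` (U \<inter> V))"
    by (rule_tac homeomorphism_imp_open_map) (use assms(3) in auto)
  then obtain O' where "open O'" "\<phi> ` (U \<inter> V) = \<phi> ` U \<inter> O'"
    unfolding openin_open by blast
  with atlas_chartD(2)[OF assms(1,2)] that show ?thesis
    by (metis (no_types, lifting) Int_iff image_eqI inj_on_image_mem_iff inf_le1)
qed

text \<open>Continuity comes from the chart expressions: these are continuous by
  \<open>smooth_on_continuous\<close>, and composing them with the chart gives F back on an open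
  set.\<close>

lemma smooth_map_euclid_atlasI:
  fixes M :: "('m::t2_space, 'e::euclidean_space) manifold"
  assumes "topological_atlas M"
    "\<And>U \<phi>. (U, \<phi>) \<in> charts M \<Longrightarrow> smooth_on (\<phi> ` (S \<inter> U)) (\<lambda>y. F (inv_into U \<phi> y))"
  shows "smooth_map M euclid S F"
proof (rule smooth_map_euclidI)
  show "continuous_on S F"
  proof (rule continuous_on_local)
    fix x assume "x \<in> S"
    obtain U \<phi> where U: "(U, \<phi>) \<in> charts M" "x \<in> U"
      by (rule atlas_obtain_chart[OF assms(1)])
    note ch = atlas_chartD[OF assms(1) U(1)]
    have "continuous_on (S \<inter> U) (\<lambda>x. F (inv_into U \<phi> (\<phi> x)))"
      by (rule continuous_on_compose2[OF smooth_on_continuous[OF assms(2)[OF U(1)]]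
            continuous_on_subset[OF ch(3)]]) auto
    then have "continuous_on (S \<inter> U) F"
      by (rule continuous_on_eq) (use ch(5) in auto)
    with U(2) ch(1) show "\<exists>U. open U \<and> x \<in> U \<and> continuous_on (S \<inter> U) F" by blast
  qed
qed (rule assms(2))

lemma smooth_map_euclid_cong:
  assumes "topological_atlas M" "smooth_map M euclid S F" "\<And>x. x \<in> S \<Longrightarrow> F x = G x"
  shows "smooth_map M euclid S G"
proof (rule smooth_map_euclidI)
  show "continuous_on S G"
    using smooth_map_euclid_continuous[OF assms(2)] assms(3) by (rule continuous_on_eq)
  fix U \<phi> assume U: "(U, \<phi>) \<in> charts M"
  from smooth_map_euclidD[OF assms(2) this]
  show "smooth_on (\<phi> ` (S \<inter> U)) (\<lambda>y. G (inv_into U \<phi> y))"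
    by (rule smooth_on_cong) (use assms(3) atlas_chartD(5)[OF assms(1) U] in auto)
qed

lemma smooth_map_post:
  fixes F :: "'m::topological_space \<Rightarrow> 'a::euclidean_space" and g :: "'a \<Rightarrow> 'b::euclidean_space"
  assumes "smooth_map M euclid S F" "smooth_on T g" "F ` S \<subseteq> T" "topological_atlas M"
  shows "smooth_map M euclid S (\<lambda>x. g (F x))"
proof (rule smooth_map_euclidI)
  show "continuous_on S (\<lambda>x. g (F x))"
    by (rule continuous_on_compose2[OF smooth_on_continuous[OF assms(2)]
          smooth_map_euclid_continuous[OF assms(1)] assms(3)])
  fix U \<phi> assume U: "(U, \<phi>) \<in> charts M"
  show "smooth_on (\<phi> ` (S \<inter> U)) (\<lambda>y. g (F (inv_into U \<phi> y)))"
    by (rule smooth_on_compose[OF assms(2) smooth_map_euclidD[OF assms(1) U]])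
       (use assms(3) atlas_chartD(5)[OF assms(4) U] in auto)
qed

lemma smooth_map_local:
  fixes M :: "('m::t2_space, 'e::euclidean_space) manifold"
  assumes "topological_atlas M"
    "\<And>x. x \<in> S \<Longrightarrow> \<exists>V. open V \<and> x \<in> V \<and> smooth_map M euclid (S \<inter> V) F"
  shows "smooth_map M euclid S F"
proof (rule smooth_map_euclid_atlasI[OF assms(1)], rule smooth_on_local)
  fix U \<phi> y assume U: "(U, \<phi>) \<in> charts M" and "y \<in> \<phi> ` (S \<inter> U)"
  then obtain x where x: "x \<in> S" "x \<in> U" "y = \<phi> x" by blast
  from assms(2)[OF x(1)] obtain V where V: "open V" "x \<in> V" "smooth_map M euclid (S \<inter> V) F"
    by blast
  obtain O' where O': "open O'" "\<And>x. x \<in> U \<Longrightarrow> \<phi> x \<in> O' \<longleftrightarrow> x \<in> V"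
    using atlas_chart_open[OF assms(1) U V(1)] by blast
  have "smooth_on (\<phi> ` (S \<inter> U) \<inter> O') (\<lambda>y. F (inv_into U \<phi> y))"
    by (rule smooth_on_subset[OF smooth_map_euclidD[OF V(3) U]]) (use O'(2) in auto)
  with O' x V(2) show "\<exists>W. open W \<and> y \<in> W \<and>
      smooth_on (\<phi> ` (S \<inter> U) \<inter> W) (\<lambda>y. F (inv_into U \<phi> y))" by blast
qed

lemma smooth_map_compose:
  fixes M :: "('m::t2_space, 'e::euclidean_space) manifold"
    and N :: "('n::topological_space, 'f::euclidean_space) manifold"
  assumes "topological_atlas M" "topological_atlas N"
    "smooth_map M N S F" "smooth_map N euclid T f" "F ` S \<subseteq> T"
  shows "smooth_map M euclid S (\<lambda>x. f (F x))"
proof (rule smooth_map_euclid_atlasI[OF assms(1)], rule smooth_on_local)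
  fix U \<phi> y assume U: "(U, \<phi>) \<in> charts M" and "y \<in> \<phi> ` (S \<inter> U)"
  then obtain x where x: "x \<in> S" "x \<in> U" "y = \<phi> x" by blast
  note chU = atlas_chartD[OF assms(1) U]
  obtain V \<psi> where V: "(V, \<psi>) \<in> charts N" "F x \<in> V"
    by (rule atlas_obtain_chart[OF assms(2)])
  note chV = atlas_chartD[OF assms(2) V(1)]
  have "continuous_on S F" and sm: "smooth_on (\<phi> ` (S \<inter> U \<inter> F -` V)) (\<psi> \<circ> F \<circ> inv_into U \<phi>)"
    using assms(3) U V(1) unfolding smooth_map_def by blast+
  \<comment> \<open>The chart expression of F is smooth only where F lands in V. Continuity of F
    makes this part relatively open in S, so it contains the trace of a neighbourhood of x.\<close>
  then obtain W where W: "open W" "W \<inter> S = F -` V \<inter> S"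
    using chV(1) unfolding continuous_on_open_invariant by blast
  obtain O' where O': "open O'" "\<And>x. x \<in> U \<Longrightarrow> \<phi> x \<in> O' \<longleftrightarrow> x \<in> W"
    using atlas_chart_open[OF assms(1) U W(1)] by blast
  have sub: "\<phi> ` (S \<inter> U) \<inter> O' \<subseteq> \<phi> ` (S \<inter> U \<inter> F -` V)"
    using O'(2) W(2) by blast
  have "smooth_on (\<phi> ` (S \<inter> U) \<inter> O')
      (\<lambda>y. f (inv_into V \<psi> ((\<psi> \<circ> F \<circ> inv_into U \<phi>) y)))"
  proof (rule smooth_on_compose[OF smooth_map_euclidD[OF assms(4) V(1)] smooth_on_subset[OF sm sub]],
      rule image_subsetI)
    fix z assume "z \<in> \<phi> ` (S \<inter> U) \<inter> O'"
    with sub obtain w where w: "w \<in> S" "w \<in> U" "F w \<in> V" "z = \<phi> w" by blast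
    then show "(\<psi> \<circ> F \<circ> inv_into U \<phi>) z \<in> \<psi> ` (T \<inter> V)"
      using chU(5)[OF w(2)] assms(5) by (auto intro!: imageI)
  qed
  then have "smooth_on (\<phi> ` (S \<inter> U) \<inter> O') (\<lambda>y. f (F (inv_into U \<phi> y)))"
  proof (rule smooth_on_cong)
    fix z assume "z \<in> \<phi> ` (S \<inter> U) \<inter> O'"
    with sub obtain w where "w \<in> U" "F w \<in> V" "z = \<phi> w" by blast
    then show "f (inv_into V \<psi> ((\<psi> \<circ> F \<circ> inv_into U \<phi>) z)) = f (F (inv_into U \<phi> z))"
      using chU(5) chV(5) by simp
  qed
  moreover have "y \<in> O'" using O'(2)[OF x(2)] x W(2) V(2) by blast
  ultimately show "\<exists>W. open W \<and> y \<in> W \<and>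
      smooth_on (\<phi> ` (S \<inter> U) \<inter> W) (\<lambda>y. f (F (inv_into U \<phi> y)))" using O'(1) by blast
qed

section \<open>Products with a Euclidean space\<close>

lemma image_map_prod_ident: "map_prod f (\<lambda>x. x) ` (A \<times> B) = f ` A \<times> B"
  by force

lemma inv_into_map_prod:
  assumes "inj_on \<phi> U" "y \<in> \<phi> ` U"
  shows "inv_into (U \<times> UNIV) (map_prod \<phi> (\<lambda>x. x)) (y, t) = (inv_into U \<phi> y, t)"
proof -
  have "inj_on (map_prod \<phi> (\<lambda>x. x)) (U \<times> UNIV)"
    using assms(1) by (intro map_prod_inj_on) auto
  from inv_into_f_f[OF this, of "(inv_into U \<phi> y, t)"] assms(2)
  show ?thesis by (simp add: inv_into_into f_inv_into_f)
qed

lemma charts_product_euclid: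
  "charts (product_manifold M euclid) = {(U \<times> UNIV, map_prod \<phi> (\<lambda>x. x)) |U \<phi>. (U, \<phi>) \<in> charts M}"
  by (auto simp: product_manifold_def euclid_def)

lemma topological_atlas_product:
  fixes M :: "('m::topological_space, 'e::euclidean_space) manifold"
  assumes "topological_atlas M"
  shows "topological_atlas (product_manifold M (euclid :: ('a::euclidean_space, 'a) manifold))"
  unfolding topological_atlas_def charts_product_euclid
proof (intro conjI ballI)
  show "(\<Union>(U, \<phi>)\<in>{(U \<times> UNIV :: ('m \<times> 'a) set, map_prod \<phi> (\<lambda>x::'a. x)) |U \<phi>. (U, \<phi>) \<in> charts M}. U) = UNIV"
  proof (intro equalityI subset_UNIV subsetI)
    fix z :: "'m \<times> 'a"
    obtain U \<phi> where "(U, \<phi>) \<in> charts M" "fst z \<in> U"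
      by (rule atlas_obtain_chart[OF assms])
    then show "z \<in> (\<Union>(U, \<phi>)\<in>{(U \<times> UNIV :: ('m \<times> 'a) set, map_prod \<phi> (\<lambda>x::'a. x)) |U \<phi>.
        (U, \<phi>) \<in> charts M}. U)"
      by (intro UN_I[of "(U \<times> UNIV, map_prod \<phi> (\<lambda>x::'a. x))"]) (auto simp: mem_Times_iff)
  qed
  fix c assume "c \<in> {(U \<times> UNIV :: ('m \<times> 'a) set, map_prod \<phi> (\<lambda>x::'a. x)) |U \<phi>. (U, \<phi>) \<in> charts M}"
  then obtain U \<phi> where c: "c = (U \<times> UNIV, map_prod \<phi> (\<lambda>x::'a. x))" and U: "(U, \<phi>) \<in> charts M" by blast
  note ch = atlas_chartD[OF assms U]
  have im: "map_prod \<phi> (\<lambda>x::'a. x) ` (U \<times> (UNIV :: 'a set)) = \<phi> ` U \<times> UNIV"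
    by (rule image_map_prod_ident)
  have "homeomorphism (U \<times> (UNIV :: 'a set)) (\<phi> ` U \<times> UNIV) (map_prod \<phi> (\<lambda>x::'a. x))
      (inv_into (U \<times> UNIV) (map_prod \<phi> (\<lambda>x::'a. x)))"
  proof (rule homeomorphismI)
    show "continuous_on (U \<times> (UNIV :: 'a set)) (map_prod \<phi> (\<lambda>x::'a. x))"
      unfolding map_prod_def case_prod_beta
      by (intro continuous_on_Pair continuous_on_compose2[OF ch(3) continuous_on_fst] continuous_on_snd
          continuous_on_id) auto
    have "continuous_on (\<phi> ` U \<times> (UNIV :: 'a set)) (\<lambda>z. (inv_into U \<phi> (fst z), snd z))"
      by (intro continuous_on_Pair continuous_on_compose2[OF ch(4) continuous_on_fst] continuous_on_snd
          continuous_on_id) auto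
    then show "continuous_on (\<phi> ` U \<times> (UNIV :: 'a set)) (inv_into (U \<times> UNIV) (map_prod \<phi> (\<lambda>x::'a. x)))"
      by (rule continuous_on_eq) (auto simp: inv_into_map_prod[OF ch(2)])
  qed (auto simp: inv_into_map_prod[OF ch(2)] ch(5))
  with c ch(1) show "case c of (U, \<phi>) \<Rightarrow> open U \<and> homeomorphism U (\<phi> ` U) \<phi> (inv_into U \<phi>)"
    by (simp add: im open_Times)
qed

lemma smooth_map_product_euclidD:
  fixes M :: "('m::topological_space, 'e::euclidean_space) manifold"
    and f :: "'m \<times> 'a::euclidean_space \<Rightarrow> 'b::euclidean_space"
  assumes "topological_atlas M" "smooth_map (product_manifold M euclid) euclid (S \<times> T) f"
    "(U, \<phi>) \<in> charts M"
  shows "smooth_on (\<phi> ` (S \<inter> U) \<times> T) (\<lambda>(y, t). f (inv_into U \<phi> y, t))"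
proof -
  note ch = atlas_chartD[OF assms(1,3)]
  have "(U \<times> UNIV, map_prod \<phi> (\<lambda>x. x)) \<in> charts (product_manifold M (euclid :: ('a, 'a) manifold))"
    using assms(3) by (auto simp: charts_product_euclid)
  from smooth_map_euclidD[OF assms(2) this]
  have "smooth_on (\<phi> ` (S \<inter> U) \<times> T) (\<lambda>y. f (inv_into (U \<times> UNIV) (map_prod \<phi> (\<lambda>x. x)) y))"
    by (simp add: Times_Int_Times image_map_prod_ident)
  then show ?thesis
    by (rule smooth_on_cong) (auto simp: inv_into_map_prod[OF ch(2)] ch(5))
qed

section \<open>Bump functions and global extensions on manifolds\<close>

lemma smooth_map_chart:
  fixes M :: "('m::{t2_space,second_countable_topology}, 'e::euclidean_space) manifold"
  assumes "smooth_manifold M" "(U, \<phi>) \<in> charts M"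
  shows "smooth_map M euclid U \<phi>"
proof (rule smooth_map_euclid_atlasI[OF smooth_manifold_atlas[OF assms(1)]])
  fix V \<psi> assume V: "(V, \<psi>) \<in> charts M"
  with assms have "smooth_on (\<psi> ` (V \<inter> U)) (\<phi> \<circ> inv_into V \<psi>)"
    unfolding smooth_manifold_def by fast
  then show "smooth_on (\<psi> ` (U \<inter> V)) (\<lambda>y. \<phi> (inv_into V \<psi> y))"
    by (simp add: Int_commute comp_def)
qed

text \<open>A Euclidean bump is pulled back by a chart and extended by 0, which is smooth if the
  support is closed in M and not only in the chart. The set C is compact because
  \<open>model\<close> is a closed subspace, and it lies in the chart image; hence K is compact and
  therefore closed in the Hausdorff space M.\<close>

lemma manifold_bump:
  fixes M :: "('m::{t2_space,second_countable_topology}, 'e::euclidean_space) manifold"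
  assumes "smooth_manifold M" "open W" "x \<in> W"
  obtains \<kappa> :: "'m \<Rightarrow> real" and V K where "\<kappa> \<in> smooth_functions M" "open V" "x \<in> V" "V \<subseteq> K"
    "closed K" "K \<subseteq> W" "\<And>y. y \<in> V \<Longrightarrow> \<kappa> y = 1" "\<And>y. y \<notin> K \<Longrightarrow> \<kappa> y = 0"
proof -
  note atlas = smooth_manifold_atlas[OF assms(1)]
  obtain U \<phi> where U: "(U, \<phi>) \<in> charts M" "x \<in> U"
    by (rule atlas_obtain_chart[OF atlas])
  note ch = atlas_chartD[OF atlas U(1)]
  have model: "subspace (model M)" "openin (top_of_set (model M)) (\<phi> ` U)"
    using assms(1) U(1) unfolding smooth_manifold_def by blast+
  obtain O1 where O1: "open O1" "\<And>x. x \<in> U \<Longrightarrow> \<phi> x \<in> O1 \<longleftrightarrow> x \<in> W"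
    using atlas_chart_open[OF atlas U(1) assms(2)] by blast
  obtain O2 where O2: "open O2" "\<phi> ` U = model M \<inter> O2"
    using model(2) unfolding openin_open by blast
  have "\<phi> x \<in> O1 \<inter> O2"
    using O1(2)[OF U(2)] O2(2) U(2) assms(3) by blast
  with O1(1) O2(1) obtain r where r: "r > 0" "cball (\<phi> x) r \<subseteq> O1 \<inter> O2"
    by (meson open_Int open_contains_cball)
  obtain \<beta> :: "'e \<Rightarrow> real" where \<beta>: "Cinf_on UNIV \<beta>" "\<And>y. dist (\<phi> x) y < r / 2 \<Longrightarrow> \<beta> y = 1"
    "\<And>y. r \<le> dist (\<phi> x) y \<Longrightarrow> \<beta> y = 0"
    using smooth_bump_euclidean[OF r(1)] by blast
  define C where "C = cball (\<phi> x) r \<inter> model M"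
  define K where "K = inv_into U \<phi> ` C"
  have C: "C \<subseteq> \<phi> ` U" "compact C"
    using r(2) O2(2) model(1)
    by (auto simp: C_def intro: compact_Int_closed closed_subspace)
  have "compact K"
    unfolding K_def by (rule compact_continuous_image[OF continuous_on_subset[OF ch(4) C(1)] C(2)])
  then have clK: "closed K" by (rule compact_imp_closed)
  have KUW: "K \<subseteq> U" "K \<subseteq> W"
  proof -
    show "K \<subseteq> U" using C(1) ch(5) by (auto simp: K_def)
    show "K \<subseteq> W"
    proof
      fix k assume "k \<in> K"
      then obtain y where "y \<in> C" "k = inv_into U \<phi> y" by (auto simp: K_def)
      with C(1) obtain u where u: "u \<in> U" "y = \<phi> u" by blast
      with \<open>y \<in> C\<close> r(2) have "\<phi> u \<in> O1" by (auto simp: C_def)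
      with O1(2)[OF u(1)] u \<open>k = inv_into U \<phi> y\<close> show "k \<in> W" by (simp add: ch(5))
    qed
  qed
  define \<kappa> where "\<kappa> y = (if y \<in> U then \<beta> (\<phi> y) else 0)" for y
  have \<kappa>0: "\<kappa> y = 0" if "y \<notin> K" for y
  proof (cases "y \<in> U")
    case True
    have "\<phi> y \<notin> cball (\<phi> x) r"
    proof
      assume "\<phi> y \<in> cball (\<phi> x) r"
      with True O2(2) have "\<phi> y \<in> C" by (auto simp: C_def)
      with ch(5)[OF True] have "y \<in> K" by (force simp: K_def)
      with that show False by simp
    qed
    with True \<beta>(3) show ?thesis by (simp add: \<kappa>_def)
  qed (simp add: \<kappa>_def)
  obtain V0 where V0: "open V0" "V0 \<inter> U = \<phi> -` ball (\<phi> x) (r / 2) \<inter> U"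
    using ch(3)[unfolded continuous_on_open_invariant, rule_format, OF open_ball] by blast
  show ?thesis
  proof
    show "open (V0 \<inter> U)" using V0(1) ch(1) by blast
    show "x \<in> V0 \<inter> U" using V0(2) U(2) r(1) by auto
    show "\<kappa> y = 1" if "y \<in> V0 \<inter> U" for y
      using that V0(2) by (auto simp: \<kappa>_def intro!: \<beta>(2))
    then show "V0 \<inter> U \<subseteq> K" using \<kappa>0 by (metis subsetI zero_neq_one)
    show "\<kappa> \<in> smooth_functions M"
      unfolding smooth_functions_def mem_Collect_eq
    proof (rule smooth_map_local[OF atlas])
      fix y
      have "smooth_map M euclid U (\<lambda>y. \<beta> (\<phi> y))"
        by (rule smooth_map_post[OF smooth_map_chart[OF assms(1) U(1)]
              Cinf_on_imp_smooth_on[OF open_UNIV \<beta>(1) subset_refl] _ atlas]) simp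
      then have "smooth_map M euclid U \<kappa>"
        by (rule smooth_map_euclid_cong[OF atlas]) (simp add: \<kappa>_def)
      moreover have "smooth_map M euclid (- K) \<kappa>"
        by (rule smooth_map_euclid_cong[OF atlas smooth_map_const[of _ _ 0]]) (simp add: \<kappa>0)
      ultimately show "\<exists>V. open V \<and> y \<in> V \<and> smooth_map M euclid (UNIV \<inter> V) \<kappa>"
        using KUW(1) ch(1) clK by (intro exI[of _ "if y \<in> K then U else - K"]) auto
    qed
  qed (use clK KUW \<kappa>0 in auto)
qed

text \<open>W and the complement of K form an open cover; f is smooth on the first and zero on the
  second.\<close>

lemma smooth_functions_extend_by_zero:
  fixes M :: "('m::t2_space, 'e::euclidean_space) manifold"
    and f :: "'m \<Rightarrow> 'a::euclidean_space"
  assumes "topological_atlas M" "open W" "smooth_map M euclid W f" "closed K" "K \<subseteq> W"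
    "\<And>x. x \<notin> K \<Longrightarrow> f x = 0"
  shows "f \<in> smooth_functions M"
  unfolding smooth_functions_def mem_Collect_eq
proof (rule smooth_map_local[OF assms(1)])
  fix y
  have "smooth_map M euclid (- K) f"
    by (rule smooth_map_euclid_cong[OF assms(1) smooth_map_const[of _ _ 0]]) (simp add: assms(6))
  with assms(2-5) show "\<exists>V. open V \<and> y \<in> V \<and> smooth_map M euclid (UNIV \<inter> V) f"
    by (intro exI[of _ "if y \<in> K then W else - K"]) auto
qed

lemma smooth_functions_iff: "f \<in> smooth_functions M \<longleftrightarrow> smooth_map M euclid UNIV f"
  by (simp add: smooth_functions_def)

lemma smooth_functions_restrict: "f \<in> smooth_functions M \<Longrightarrow> smooth_map M euclid S f"
  unfolding smooth_functions_iff by (erule smooth_map_euclid_subset) simp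

text \<open>Tangent vectors accept global smooth functions only, so charts and trivializations,
  which are local, get replaced by global functions with the same germ at the point in
  question.\<close>

lemma smooth_map_germ_extension:
  fixes M :: "('m::{t2_space,second_countable_topology}, 'e::euclidean_space) manifold"
    and f :: "'m \<Rightarrow> 'a::euclidean_space"
  assumes "smooth_manifold M" "open W" "x \<in> W" "smooth_map M euclid W f"
  obtains g V where "g \<in> smooth_functions M" "open V" "x \<in> V" "V \<subseteq> W" "\<And>y. y \<in> V \<Longrightarrow> g y = f y"
proof -
  obtain \<kappa> :: "'m \<Rightarrow> real" and V K where \<kappa>: "\<kappa> \<in> smooth_functions M" "open V" "x \<in> V" "V \<subseteq> K"
    "closed K" "K \<subseteq> W" "\<And>y. y \<in> V \<Longrightarrow> \<kappa> y = 1" "\<And>y. y \<notin> K \<Longrightarrow> \<kappa> y = 0"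
    using manifold_bump[OF assms(1-3)] by blast
  have "(\<lambda>y. \<kappa> y *\<^sub>R f y) \<in> smooth_functions M"
    by (rule smooth_functions_extend_by_zero[OF smooth_manifold_atlas[OF assms(1)] assms(2)
          smooth_map_bilinear[OF bounded_bilinear_scaleR smooth_functions_restrict[OF \<kappa>(1)] assms(4)]
          \<kappa>(5,6)]) (simp add: \<kappa>(8))
  with \<kappa> show ?thesis by (intro that[of "\<lambda>y. \<kappa> y *\<^sub>R f y" V]) auto
qed

section \<open>Tangent vectors as derivations\<close>

lemma smooth_functions_const: "(\<lambda>x. c) \<in> smooth_functions M"
  by (simp add: smooth_functions_iff smooth_map_const)

lemma smooth_functions_bilinear:
  "bounded_bilinear pr \<Longrightarrow> f \<in> smooth_functions M \<Longrightarrow> g \<in> smooth_functions M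
    \<Longrightarrow> (\<lambda>x. pr (f x) (g x)) \<in> smooth_functions M"
  by (simp add: smooth_functions_iff smooth_map_bilinear)

lemma smooth_functions_linear:
  "bounded_linear L \<Longrightarrow> f \<in> smooth_functions M \<Longrightarrow> (\<lambda>x. L (f x)) \<in> smooth_functions M"
  by (simp add: smooth_functions_iff smooth_map_linear_compose)

lemma smooth_functions_add:
  "f \<in> smooth_functions M \<Longrightarrow> g \<in> smooth_functions M \<Longrightarrow> (\<lambda>x. f x + g x) \<in> smooth_functions M"
  by (simp add: smooth_functions_iff smooth_map_add)

lemma smooth_functions_sum:
  "(\<And>i. i \<in> I \<Longrightarrow> f i \<in> smooth_functions M) \<Longrightarrow> (\<lambda>x. \<Sum>i\<in>I. f i x) \<in> smooth_functions M"
  by (simp add: smooth_functions_iff smooth_map_sum)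

lemma smooth_functions_Pair:
  "f \<in> smooth_functions M \<Longrightarrow> g \<in> smooth_functions M \<Longrightarrow> (\<lambda>x. (f x, g x)) \<in> smooth_functions M"
  by (simp add: smooth_functions_iff smooth_map_Pair)

lemma smooth_functions_mult:
  fixes f g :: "'m::topological_space \<Rightarrow> real"
  shows "f \<in> smooth_functions M \<Longrightarrow> g \<in> smooth_functions M \<Longrightarrow> (\<lambda>x. f x * g x) \<in> smooth_functions M"
  by (rule smooth_functions_bilinear[OF bounded_bilinear_mult])

lemma smooth_functions_matrix_mult:
  fixes f :: "'a::topological_space \<Rightarrow> complex^'n^'m" and g :: "'a \<Rightarrow> complex^'k^'n"
  shows "f \<in> smooth_functions M \<Longrightarrow> g \<in> smooth_functions M \<Longrightarrow> (\<lambda>x. f x ** g x) \<in> smooth_functions M"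
  by (rule smooth_functions_bilinear[OF bounded_bilinear_matrix_mult])

lemma smooth_functions_inner:
  "f \<in> smooth_functions M \<Longrightarrow> (\<lambda>x. f x \<bullet> b) \<in> smooth_functions M"
  by (rule smooth_functions_linear[OF bounded_linear_inner_left])

lemma smooth_functions_continuous: "f \<in> smooth_functions M \<Longrightarrow> continuous_on UNIV f"
  unfolding smooth_functions_iff by (rule smooth_map_euclid_continuous)

lemma tangent_lincomb:
  assumes "v \<in> tangent_space M p" "f \<in> smooth_functions M" "g \<in> smooth_functions M"
  shows "v (\<lambda>x. a * f x + b * g x) = a * v f + b * v g"
  using assms unfolding tangent_space_def by blast

lemma tangent_mult:
  assumes "v \<in> tangent_space M p" "f \<in> smooth_functions M" "g \<in> smooth_functions M"
  shows "v (\<lambda>x. f x * g x) = f p * v g + g p * v f"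
  using assms unfolding tangent_space_def by blast

lemma tangent_nonsmooth: "v \<in> tangent_space M p \<Longrightarrow> f \<notin> smooth_functions M \<Longrightarrow> v f = 0"
  unfolding tangent_space_def by blast

lemma tangent_spaceI:
  assumes "\<And>f g a b. f \<in> smooth_functions M \<Longrightarrow> g \<in> smooth_functions M \<Longrightarrow>
      v (\<lambda>x. a * f x + b * g x) = a * v f + b * v g"
    "\<And>f g. f \<in> smooth_functions M \<Longrightarrow> g \<in> smooth_functions M \<Longrightarrow>
      v (\<lambda>x. f x * g x) = f p * v g + g p * v f"
    "\<And>f. f \<notin> smooth_functions M \<Longrightarrow> v f = 0"
  shows "v \<in> tangent_space M p"
  using assms unfolding tangent_space_def by blast

lemma tangent_const:
  assumes "v \<in> tangent_space M p"
  shows "v (\<lambda>x. c) = 0"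
proof -
  have "v (\<lambda>x. 1 * 1) = 1 * v (\<lambda>x. 1) + 1 * v (\<lambda>x. 1)"
    by (rule tangent_mult[OF assms smooth_functions_const smooth_functions_const])
  then have "v (\<lambda>x. 1) = 0" by simp
  with tangent_lincomb[OF assms smooth_functions_const[of 1] smooth_functions_const[of 1], of c 0]
  show ?thesis by simp
qed

lemma tangent_add:
  assumes "v \<in> tangent_space M p" "f \<in> smooth_functions M" "g \<in> smooth_functions M"
  shows "v (\<lambda>x. f x + g x) = v f + v g"
  using tangent_lincomb[OF assms, of 1 1] by simp

lemma tangent_sum:
  assumes "v \<in> tangent_space M p" "\<And>i. i \<in> I \<Longrightarrow> f i \<in> smooth_functions M"
  shows "v (\<lambda>x. \<Sum>i\<in>I. f i x) = (\<Sum>i\<in>I. v (f i))"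
  using assms(2)
proof (induction I rule: infinite_finite_induct)
  case (insert i I)
  then show ?case
    using tangent_add[OF assms(1) _ smooth_functions_sum, of "f i" I f] by simp
qed (simp_all add: tangent_const[OF assms(1)])

text \<open>A bump \<kappa> supported in V with \<kappa> p = 1 makes \<kappa> (f - g) vanish
  identically, while the product rule at p evaluates v on it as v f - v g.\<close>

lemma tangent_local:
  fixes M :: "('m::{t2_space,second_countable_topology}, 'e::euclidean_space) manifold"
  assumes "smooth_manifold M" "v \<in> tangent_space M p"
    "f \<in> smooth_functions M" "g \<in> smooth_functions M"
    "open V" "p \<in> V" "\<And>x. x \<in> V \<Longrightarrow> f x = g x"
  shows "v f = v g"
proof -
  obtain \<kappa> :: "'m \<Rightarrow> real" and V' K where \<kappa>: "\<kappa> \<in> smooth_functions M" "open V'" "p \<in> V'" "V' \<subseteq> K"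
    "closed K" "K \<subseteq> V" "\<And>y. y \<in> V' \<Longrightarrow> \<kappa> y = 1" "\<And>y. y \<notin> K \<Longrightarrow> \<kappa> y = 0"
    using manifold_bump[OF assms(1,5,6)] by blast
  let ?d = "\<lambda>x. 1 * f x + (- 1) * g x"
  have d: "?d \<in> smooth_functions M"
    by (intro smooth_functions_add smooth_functions_mult smooth_functions_const assms)
  have "v (\<lambda>x. \<kappa> x * ?d x) = \<kappa> p * v ?d + ?d p * v \<kappa>"
    by (rule tangent_mult[OF assms(2) \<kappa>(1) d])
  also have "\<dots> = v ?d" using \<kappa>(3,7) assms(6,7) by simp
  also have "\<dots> = v f - v g"
    using tangent_lincomb[OF assms(2-4), of 1 "-1"] by simp
  finally have "v (\<lambda>x. \<kappa> x * ?d x) = v f - v g" .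
  moreover have "\<kappa> x * ?d x = 0" for x
    using \<kappa>(6,8) assms(7) by (cases "x \<in> K") auto
  ultimately show ?thesis
    using tangent_const[OF assms(2), of 0] by (simp only:)
qed

text \<open>Componentwise extension of a tangent vector from real functions to Euclidean-valued
  ones, in particular complex and matrix functions. For complex values \<open>Basis\<close> is {1,
  i}, which gives back \<open>vf_apply_complex\<close>.\<close>

definition tderiv :: "(('m \<Rightarrow> real) \<Rightarrow> real) \<Rightarrow> ('m \<Rightarrow> 'a::euclidean_space) \<Rightarrow> 'a" where
  "tderiv v f = (\<Sum>b\<in>Basis. v (\<lambda>x. f x \<bullet> b) *\<^sub>R b)"

lemma tderiv_real [simp]: "tderiv v f = v f" for f :: "'m \<Rightarrow> real"
  by (simp add: tderiv_def)

lemma tderiv_inner: "b \<in> Basis \<Longrightarrow> tderiv v f \<bullet> b = v (\<lambda>x. f x \<bullet> b)"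
  by (simp add: tderiv_def inner_sum_left inner_Basis if_distrib cong: if_cong)

lemma vf_apply_complex_eq: "vf_apply_complex X f x = tderiv (X x) f"
  by (simp add: vf_apply_complex_def tderiv_def Basis_complex_def complex_eq_iff
      inner_complex_def)

text \<open>Near p, Hadamard's lemma writes f as F(Y p) plus the sum of the (Y_b - Y_b(p)) G_b(Y). A
  derivation at p kills the constant, and as the first factor of each product vanishes at p, only
  v(Y_b) G_b(Y p) survives. Agreement of f with F o Y is demanded at points of M only, so Y may take
  values in a submanifold and F be an arbitrary extension.\<close>

lemma tangent_chain:
  fixes M :: "('m::{t2_space,second_countable_topology}, 'e::euclidean_space) manifold"
    and Y :: "'m \<Rightarrow> 'z::euclidean_space" and F :: "'z \<Rightarrow> real"
  assumes M: "smooth_manifold M" and v: "v \<in> tangent_space M p"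
    and Y: "Y \<in> smooth_functions M" and f: "f \<in> smooth_functions M"
    and O': "open O'" "Y p \<in> O'" "Cinf_on O' F"
    and V: "open V" "p \<in> V" "\<And>x. x \<in> V \<Longrightarrow> Y x \<in> O' \<Longrightarrow> f x = F (Y x)"
  shows "v f = frechet_derivative F (at (Y p)) (tderiv v Y)"
proof -
  note atlas = smooth_manifold_atlas[OF M]
  obtain r where r: "r > 0" "ball (Y p) r \<subseteq> O'"
    using O'(1,2) openE by blast
  obtain G where G: "\<And>b. Cinf_on (ball (Y p) r) (G b)"
    "\<And>b. G b (Y p) = frechet_derivative F (at (Y p)) b"
    "\<And>y. y \<in> ball (Y p) r \<Longrightarrow> F y = F (Y p) + (\<Sum>b\<in>Basis. ((y - Y p) \<bullet> b) *\<^sub>R G b y)"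
    using hadamard[OF Cinf_on_subset[OF O'(3) r(2)] r(1)] by blast
  define W where "W = V \<inter> Y -` ball (Y p) r"
  have W: "open W" "p \<in> W"
    using V(1,2) r(1) smooth_functions_continuous[OF Y] by (auto simp: W_def intro!: open_vimage)
  \<comment> \<open>The coefficients G_b o Y exist only near p; global functions with the same germ
    stand in for them.\<close>
  have "\<exists>g U. g \<in> smooth_functions M \<and> open U \<and> p \<in> U \<and> (\<forall>y\<in>U. g y = G b (Y y))" for b
  proof -
    have "smooth_map M euclid W (\<lambda>x. G b (Y x))"
      by (rule smooth_map_post[OF smooth_functions_restrict[OF Y]
            Cinf_on_imp_smooth_on[OF open_ball G(1) subset_refl] _ atlas]) (auto simp: W_def)
    then show ?thesis
      by (rule smooth_map_germ_extension[OF M W]) blast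
  qed
  then obtain g U where gU: "\<And>b. g b \<in> smooth_functions M" "\<And>b. open (U b)" "\<And>b. p \<in> U b"
    "\<And>b y. y \<in> U b \<Longrightarrow> g b y = G b (Y y)"
    by metis
  let ?y = "\<lambda>b x. 1 * (Y x \<bullet> b) + (- (Y p \<bullet> b)) * 1"
  have y: "?y b \<in> smooth_functions M" for b
    by (intro smooth_functions_add smooth_functions_mult smooth_functions_const smooth_functions_inner Y)
  have vy: "v (?y b) = v (\<lambda>x. Y x \<bullet> b)" for b
    using tangent_lincomb[OF v smooth_functions_inner[OF Y, of b] smooth_functions_const[of 1],
        of 1 "- (Y p \<bullet> b)"] tangent_const[OF v] by simp
  have yg: "(\<lambda>x. ?y b x * g b x) \<in> smooth_functions M" for b
    by (intro smooth_functions_mult[OF y gU(1)])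
  have h: "(\<lambda>x. F (Y p) + (\<Sum>b\<in>Basis. ?y b x * g b x)) \<in> smooth_functions M"
    by (intro smooth_functions_add smooth_functions_const smooth_functions_sum yg)
  have "v f = v (\<lambda>x. F (Y p) + (\<Sum>b\<in>Basis. ?y b x * g b x))"
  proof (rule tangent_local[OF M v f h])
    show "open (W \<inter> (\<Inter>b\<in>Basis. U b))" using W(1) gU(2) by (intro open_Int open_INT) auto
    show "p \<in> W \<inter> (\<Inter>b\<in>Basis. U b)" using W(2) gU(3) by auto
    fix x assume x: "x \<in> W \<inter> (\<Inter>b\<in>Basis. U b)"
    then have "f x = F (Y x)" "Y x \<in> ball (Y p) r"
      using V(3) r(2) by (auto simp: W_def)
    with G(3) have "f x = F (Y p) + (\<Sum>b\<in>Basis. ((Y x - Y p) \<bullet> b) *\<^sub>R G b (Y x))"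
      by simp
    then show "f x = F (Y p) + (\<Sum>b\<in>Basis. ?y b x * g b x)"
      using x gU(4) by (simp add: inner_diff_left)
  qed
  also have "\<dots> = (\<Sum>b\<in>Basis. v (\<lambda>x. ?y b x * g b x))"
  proof -
    have "v (\<lambda>x. F (Y p) + (\<Sum>b\<in>Basis. ?y b x * g b x))
        = v (\<lambda>x. F (Y p)) + v (\<lambda>x. \<Sum>b\<in>Basis. ?y b x * g b x)"
      by (rule tangent_add[OF v smooth_functions_const smooth_functions_sum[OF yg]])
    then show ?thesis
      by (simp only: tangent_const[OF v] tangent_sum[OF v yg] add_0)
  qed
  also have "\<dots> = (\<Sum>b\<in>Basis. v (\<lambda>x. Y x \<bullet> b) * frechet_derivative F (at (Y p)) b)"
  proof (rule sum.cong[OF refl])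
    fix b :: 'z
    have "v (\<lambda>x. ?y b x * g b x) = ?y b p * v (g b) + g b p * v (?y b)"
      by (rule tangent_mult[OF v y gU(1)])
    then show "v (\<lambda>x. ?y b x * g b x) = v (\<lambda>x. Y x \<bullet> b) * frechet_derivative F (at (Y p)) b"
      using gU(4)[OF gU(3)] G(2) vy by simp
  qed
  also have "\<dots> = frechet_derivative F (at (Y p)) (tderiv v Y)"
  proof -
    have "linear (frechet_derivative F (at (Y p)))"
      using Cinf_on_differentiable[OF O'(3,2)] by (rule linear_frechet_derivative)
    then show ?thesis by (simp add: tderiv_def linear_sum linear_scale)
  qed
  finally show ?thesis .
qed

lemma tderiv_chain:
  fixes M :: "('m::{t2_space,second_countable_topology}, 'e::euclidean_space) manifold"
    and Y :: "'m \<Rightarrow> 'z::euclidean_space" and F :: "'z \<Rightarrow> 'a::euclidean_space"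
  assumes "smooth_manifold M" "v \<in> tangent_space M p"
    "Y \<in> smooth_functions M" "f \<in> smooth_functions M"
    "open O'" "Y p \<in> O'" "Cinf_on O' F"
    "open V" "p \<in> V" "\<And>x. x \<in> V \<Longrightarrow> Y x \<in> O' \<Longrightarrow> f x = F (Y x)"
  shows "tderiv v f = frechet_derivative F (at (Y p)) (tderiv v Y)"
proof (rule euclidean_eqI)
  fix b :: 'a assume b: "b \<in> Basis"
  have F: "Cinf_on O' (\<lambda>y. F y \<bullet> b)"
    using assms(7) unfolding Cinf_on_def
    by (auto intro: Ck_on_linear_compose[OF bounded_linear_inner_left assms(5)])
  have "v (\<lambda>x. f x \<bullet> b) = frechet_derivative (\<lambda>y. F y \<bullet> b) (at (Y p)) (tderiv v Y)"
    by (rule tangent_chain[OF assms(1-3) smooth_functions_inner[OF assms(4)] assms(5,6) F assms(8,9)])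
       (use assms(10) in simp)
  also have "\<dots> = frechet_derivative F (at (Y p)) (tderiv v Y) \<bullet> b"
  proof -
    have "((\<lambda>y. F y \<bullet> b) has_derivative (\<lambda>w. frechet_derivative F (at (Y p)) w \<bullet> b)) (at (Y p))"
      using Cinf_on_differentiable[OF assms(7,6)]
      by (intro has_derivative_inner_left) (simp add: frechet_derivative_works)
    from frechet_derivative_at[OF this] show ?thesis by metis
  qed
  finally show "tderiv v f \<bullet> b = frechet_derivative F (at (Y p)) (tderiv v Y) \<bullet> b"
    by (simp add: tderiv_inner[OF b])
qed

context
  fixes M :: "('m::{t2_space,second_countable_topology}, 'e::euclidean_space) manifold" and v p
  assumes M: "smooth_manifold M" and v: "v \<in> tangent_space M p"
begin

lemma tderiv_local:
  assumes "f \<in> smooth_functions M" "g \<in> smooth_functions M"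
    "open V" "p \<in> V" "\<And>x. x \<in> V \<Longrightarrow> f x = g x"
  shows "tderiv v f = tderiv v g"
  unfolding tderiv_def
  using tangent_local[OF M v smooth_functions_inner[OF assms(1)] smooth_functions_inner[OF assms(2)]
      assms(3,4)] assms(5) by simp

lemma tderiv_const: "tderiv v (\<lambda>x. c) = 0"
  by (simp add: tderiv_def tangent_const[OF v])

lemma tderiv_add:
  assumes "f \<in> smooth_functions M" "g \<in> smooth_functions M"
  shows "tderiv v (\<lambda>x. f x + g x) = tderiv v f + tderiv v g"
  unfolding tderiv_def
  by (simp add: inner_add_left tangent_add[OF v] smooth_functions_inner assms scaleR_add_left
      sum.distrib)

lemma tderiv_linear:
  assumes "bounded_linear L" "f \<in> smooth_functions M"
  shows "tderiv v (\<lambda>x. L (f x)) = L (tderiv v f)"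
  using tderiv_chain[OF M v assms(2) smooth_functions_linear[OF assms] open_UNIV _
      Cinf_on_bounded_linear[OF assms(1)] open_UNIV, OF UNIV_I UNIV_I refl]
    frechet_derivative_at[OF bounded_linear_imp_has_derivative[OF assms(1)]] by metis

lemma tderiv_Pair:
  assumes "f \<in> smooth_functions M" "g \<in> smooth_functions M"
  shows "tderiv v (\<lambda>x. (f x, g x)) = (tderiv v f, tderiv v g)"
  using tderiv_linear[OF bounded_linear_fst smooth_functions_Pair[OF assms]]
    tderiv_linear[OF bounded_linear_snd smooth_functions_Pair[OF assms]]
  by (simp add: prod_eq_iff)

text \<open>The product rule is the chain rule for the map z |-> \<open>pr (fst z) (snd z)\<close>
  along the pair (f, g).\<close>

lemma tderiv_bilinear:
  fixes pr :: "'a::euclidean_space \<Rightarrow> 'b::euclidean_space \<Rightarrow> 'c::euclidean_space"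
  assumes "bounded_bilinear pr" "f \<in> smooth_functions M" "g \<in> smooth_functions M"
  shows "tderiv v (\<lambda>x. pr (f x) (g x)) = pr (tderiv v f) (g p) + pr (f p) (tderiv v g)"
proof -
  let ?F = "\<lambda>z. pr (fst z) (snd z)"
  have F: "Cinf_on UNIV ?F"
    by (intro Cinf_on_bilinear[OF assms(1) open_UNIV] Cinf_on_bounded_linear bounded_linear_fst
        bounded_linear_snd)
  have D: "(?F has_derivative (\<lambda>w. pr (f p) (snd w) + pr (fst w) (g p))) (at (f p, g p))"
    using bounded_bilinear.FDERIV[OF assms(1) bounded_linear_imp_has_derivative[OF bounded_linear_fst]
        bounded_linear_imp_has_derivative[OF bounded_linear_snd], of "(f p, g p)" UNIV] by simp
  have "tderiv v (\<lambda>x. pr (f x) (g x))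
      = frechet_derivative ?F (at (f p, g p)) (tderiv v (\<lambda>x. (f x, g x)))"
    by (rule tderiv_chain[OF M v smooth_functions_Pair[OF assms(2,3)] smooth_functions_bilinear[OF assms]
          open_UNIV UNIV_I F open_UNIV UNIV_I]) simp
  also have "\<dots> = pr (f p) (tderiv v g) + pr (tderiv v f) (g p)"
    unfolding tderiv_Pair[OF assms(2,3)] frechet_derivative_at[OF D, symmetric] by simp
  finally show ?thesis by (simp add: add.commute)
qed

lemmas tderiv_matrix_mult = tderiv_bilinear[OF bounded_bilinear_matrix_mult]

end

lemma vector_fieldsD:
  assumes "X \<in> vector_fields M"
  shows "X p \<in> tangent_space M p" "f \<in> smooth_functions M \<Longrightarrow> (\<lambda>p. X p f) \<in> smooth_functions M"
  using assms unfolding vector_fields_def by blast+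

lemma vector_field_tderiv_smooth:
  assumes "X \<in> vector_fields M" "f \<in> smooth_functions M"
  shows "(\<lambda>p. tderiv (X p) f) \<in> smooth_functions M"
  unfolding tderiv_def
  by (intro smooth_functions_sum smooth_functions_linear[OF bounded_linear_scaleR_left]
      vector_fieldsD(2)[OF assms(1)] smooth_functions_inner[OF assms(2)])

section \<open>Traceless matrices\<close>

text \<open>The scalar is an argument because \<open>*\<^sub>R\<close> scales matrices by reals
  only. A complex matrix is then a plain sum of such units, and complex scaling is multiplication by
  \<open>mat c\<close>.\<close>

definition unit_matrix :: "'n \<Rightarrow> 'n \<Rightarrow> complex \<Rightarrow> complex^'n^'n::finite" where
  "unit_matrix i j c = (\<chi> a b. if a = i \<and> b = j then c else 0)"

lemma unit_matrix_mult_left: "(unit_matrix i j c ** A) $ a $ b = (if a = i then c * A $ j $ b else 0)"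
  by (simp add: unit_matrix_def matrix_matrix_mult_def if_distrib[of "\<lambda>x. x * _"] cong: if_cong conj_cong)

lemma unit_matrix_mult_right: "(A ** unit_matrix i j c) $ a $ b = (if b = j then A $ a $ i * c else 0)"
  by (simp add: unit_matrix_def matrix_matrix_mult_def if_distrib[of "\<lambda>x. _ * x"] cong: if_cong conj_cong)

lemma unit_matrix_mult:
  "unit_matrix i j c ** unit_matrix k l d = (if j = k then unit_matrix i l (c * d) else 0)"
  by (simp add: vec_eq_iff unit_matrix_mult_left) (simp add: unit_matrix_def)

lemma mat_mult_left: "(mat c ** A) $ a $ b = c * (A $ a $ b)" for A :: "complex^'k^'n"
  by (simp add: mat_def matrix_matrix_mult_def if_distrib[of "\<lambda>x. x * _"] cong: if_cong)

lemma mat_mult_right: "(A ** mat c) $ a $ b = (A $ a $ b) * c" for A :: "complex^'n^'k"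
  by (simp add: mat_def matrix_matrix_mult_def if_distrib[of "\<lambda>x. _ * x"] cong: if_cong)

lemma mat_commute: "mat c ** A = A ** mat c" for A :: "complex^'n^'n"
  by (simp add: vec_eq_iff mat_mult_left mat_mult_right)

lemma mat_of_real: "mat (complex_of_real c) ** A = c *\<^sub>R A" for A :: "complex^'k^'n"
  by (simp add: vec_eq_iff mat_mult_left scaleR_conv_of_real[where 'a = complex])

lemma mat_unit_matrix: "mat c ** unit_matrix i j d = unit_matrix i j (c * d)"
  by (simp add: vec_eq_iff mat_mult_left) (simp add: unit_matrix_def)

lemma mat_eq_iff: "(mat c :: complex^'n^'n) = mat d \<longleftrightarrow> c = d"
  by (auto simp: mat_def vec_eq_iff)

lemma matrix_unit_decomposition: "A = (\<Sum>i\<in>UNIV. \<Sum>j\<in>UNIV. unit_matrix i j (A $ i $ j))"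
proof -
  have "(\<Sum>i\<in>UNIV. \<Sum>j\<in>UNIV. unit_matrix i j (A $ i $ j) $ a $ b) = A $ a $ b" for a b
  proof -
    have "(\<Sum>j\<in>UNIV. unit_matrix i j (A $ i $ j) $ a $ b) = (if i = a then A $ a $ b else 0)" for i
      by (auto simp: unit_matrix_def if_distrib cong: if_cong conj_cong)
    then show ?thesis by simp
  qed
  then show ?thesis by (simp add: vec_eq_iff)
qed

lemma sum_unit_matrix_diagonal: "(\<Sum>i\<in>UNIV. unit_matrix i i 1) = mat 1"
  by (auto simp: vec_eq_iff unit_matrix_def mat_def intro!: sum.neutral)

text \<open>Compare the entries of both products when A is a matrix unit. The index
  \<open>undefined\<close> is a fixed reference position on the diagonal.\<close>

lemma commuting_all_imp_scalar:
  fixes N :: "complex^'n^'n::finite"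
  assumes "\<And>A. N ** A = A ** N"
  obtains c where "N = mat c"
proof -
  have *: "(if b = j then N $ a $ i else 0) = (if a = i then N $ j $ b else 0)" for a b i j
    using arg_cong[OF assms[of "unit_matrix i j 1"], of "\<lambda>A. A $ a $ b"]
    by (simp only: unit_matrix_mult_left unit_matrix_mult_right mult_1_left mult_1_right)
  have "N $ a $ a = N $ undefined $ undefined" for a
    using *[of undefined undefined a a] by (simp only: refl if_True)
  moreover have "N $ a $ b = 0" if "a \<noteq> b" for a b
    using *[of b b a b] that by (simp only: refl if_True if_False)
  ultimately have "N = mat (N $ undefined $ undefined)"
    unfolding vec_eq_iff mat_def vec_lambda_beta by metis
  then show ?thesis by (rule that)
qed

lemma trace_mult_commute: "trace (A ** B) = trace (B ** A)" for A B :: "complex^'n^'n::finite"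
  unfolding trace_def matrix_matrix_mult_def
  by (simp add: sum.swap[of "\<lambda>i k. A $ i $ k * B $ k $ i"] mult.commute)

lemma bounded_linear_trace: "bounded_linear (trace :: complex^'n^'n::finite \<Rightarrow> complex)"
  unfolding trace_def by (intro bounded_linear_sum bounded_linear_matrix_entry)

text \<open>Here \<open>\<epsilon>\<close> is a system of matrix units and \<open>\<delta>\<close> its image under a derivation;
  averaging over all units makes the generator traceless.\<close>

lemma derivation_of_matrix_units_inner:
  fixes \<epsilon> \<delta> :: "'n \<Rightarrow> 'n \<Rightarrow> complex^'n^'n::finite"
  assumes mult: "\<And>i j k l. \<epsilon> i j ** \<epsilon> k l = (if j = k then \<epsilon> i l else 0)"
    and one: "(\<Sum>i\<in>UNIV. \<epsilon> i i) = mat 1"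
    and der: "\<And>i j k l. \<delta> i j ** \<epsilon> k l + \<epsilon> i j ** \<delta> k l = (if j = k then \<delta> i l else 0)"
    and K: "K = (1 / CARD('n)) *\<^sub>R (\<Sum>i\<in>UNIV. \<Sum>j\<in>UNIV. \<delta> i j ** \<epsilon> j i)"
  shows "K ** \<epsilon> k l - \<epsilon> k l ** K = \<delta> k l" "trace K = 0"
proof -
  interpret mm: bounded_bilinear "(**) :: complex^'n^'n \<Rightarrow> complex^'n^'n \<Rightarrow> complex^'n^'n"
    by (rule bounded_bilinear_matrix_mult)
  define S where "S = (\<Sum>i\<in>UNIV. \<Sum>j\<in>UNIV. \<delta> i j ** \<epsilon> j i)"
  \<comment> \<open>The unit relations reduce \<open>S ** \<epsilon> k l\<close> to the sum over j
    of \<open>\<delta> k j ** \<epsilon> j l\<close>. Moving \<open>\<epsilon> k l\<close> past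
    \<open>\<delta> i j\<close> by the Leibniz rule gives for the other product the same sum minus
    \<open>\<delta> k l\<close>, once for each j because the \<open>\<epsilon> i i\<close> sum to
    the identity. This surplus \<open>CARD('n)\<close> is what the normalization of K
    cancels.\<close>
  have comm: "S ** \<epsilon> k l - \<epsilon> k l ** S = real CARD('n) *\<^sub>R \<delta> k l" for k l
  proof -
    have "S ** \<epsilon> k l = (\<Sum>i\<in>UNIV. \<Sum>j\<in>UNIV. if i = k then \<delta> i j ** \<epsilon> j l else 0)"
      unfolding S_def mm.sum_left
      by (intro sum.cong refl) (auto simp: matrix_mul_assoc[symmetric] mult mm.zero_right)
    also have "\<dots> = (\<Sum>j\<in>UNIV. \<delta> k j ** \<epsilon> j l)"
      by (subst sum.swap) simp
    finally have 1: "S ** \<epsilon> k l = (\<Sum>j\<in>UNIV. \<delta> k j ** \<epsilon> j l)" .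
    have "\<epsilon> k l ** (\<delta> i j ** \<epsilon> j i) = (if l = i then \<delta> k j ** \<epsilon> j i else 0) - \<delta> k l ** \<epsilon> i i" for i j
    proof -
      have "\<epsilon> k l ** \<delta> i j = (if l = i then \<delta> k j else 0) - \<delta> k l ** \<epsilon> i j"
        unfolding eq_diff_eq using der[of k l i j] by (subst add.commute)
      then have "\<epsilon> k l ** (\<delta> i j ** \<epsilon> j i)
          = ((if l = i then \<delta> k j else 0) - \<delta> k l ** \<epsilon> i j) ** \<epsilon> j i"
        by (simp add: matrix_mul_assoc)
      then show ?thesis
        by (simp add: mm.diff_left matrix_mul_assoc[symmetric] mult mm.zero_left)
    qed
    then have "\<epsilon> k l ** S = (\<Sum>i\<in>UNIV. \<Sum>j\<in>UNIV. (if l = i then \<delta> k j ** \<epsilon> j i else 0) - \<delta> k l ** \<epsilon> i i)"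
      unfolding S_def mm.sum_right by simp
    also have "\<dots> = (\<Sum>i\<in>UNIV. \<Sum>j\<in>UNIV. if l = i then \<delta> k j ** \<epsilon> j i else 0)
        - (\<Sum>i\<in>UNIV. \<Sum>j\<in>(UNIV :: 'n set). \<delta> k l ** \<epsilon> i i)"
      by (simp add: sum_subtractf)
    also have "(\<Sum>i\<in>UNIV. \<Sum>j\<in>UNIV. if l = i then \<delta> k j ** \<epsilon> j i else 0) = (\<Sum>j\<in>UNIV. \<delta> k j ** \<epsilon> j l)"
      by (subst sum.swap) simp
    also have "(\<Sum>i\<in>UNIV. \<Sum>j\<in>(UNIV :: 'n set). \<delta> k l ** \<epsilon> i i)
        = (\<Sum>i\<in>UNIV. real CARD('n) *\<^sub>R (\<delta> k l ** \<epsilon> i i))"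
      by (simp only: sum_constant_scaleR)
    also have "\<dots> = real CARD('n) *\<^sub>R (\<delta> k l ** (\<Sum>i\<in>UNIV. \<epsilon> i i))"
      by (simp add: scaleR_sum_right mm.sum_right)
    finally show ?thesis using 1 one by simp
  qed
  have n: "real CARD('n) \<noteq> 0" by simp
  have KS: "K = (1 / CARD('n)) *\<^sub>R S" by (simp add: K S_def)
  then show K\<epsilon>: "K ** \<epsilon> k l - \<epsilon> k l ** K = \<delta> k l" for k l
    using comm[of k l] n
    by (simp add: mm.scaleR_left mm.scaleR_right scaleR_diff_right[symmetric])
  interpret tr: bounded_linear "trace :: complex^'n^'n \<Rightarrow> complex"
    by (rule bounded_linear_trace)
  \<comment> \<open>By the commutator formula just proved and the cyclicity of the trace, the
    summands of \<open>trace S\<close> are antisymmetric in i and j, so the double sum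
    vanishes.\<close>
  have "trace (\<delta> i j ** \<epsilon> j i) = trace (K ** \<epsilon> i i) - trace (K ** \<epsilon> j j)" for i j
  proof -
    have "\<delta> i j ** \<epsilon> j i = K ** \<epsilon> i i - \<epsilon> i j ** (K ** \<epsilon> j i)"
      by (simp add: K\<epsilon>[of i j, symmetric] mm.diff_left matrix_mul_assoc[symmetric] mult)
    moreover have "trace (\<epsilon> i j ** (K ** \<epsilon> j i)) = trace (K ** \<epsilon> j j)"
      by (subst trace_mult_commute) (simp add: matrix_mul_assoc[symmetric] mult)
    ultimately show ?thesis by (simp add: tr.diff)
  qed
  then have "trace S = (\<Sum>i\<in>UNIV. \<Sum>j\<in>UNIV. trace (K ** \<epsilon> i i) - trace (K ** \<epsilon> j j))"
    by (simp add: S_def tr.sum)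
  also have "\<dots> = 0"
    by (simp add: sum_subtractf sum_distrib_left)
  finally show "trace K = 0"
    by (simp add: KS tr.scaleR)
qed

definition affine_SL_directions :: "(complex^'n^'n::finite) set" where
  "affine_SL_directions = {N. \<forall>t::real. mat 1 + t *\<^sub>R N \<in> SL}"

lemma unit_matrix_affine:
  fixes i j :: "'n::finite"
  assumes "i \<noteq> j"
  shows "unit_matrix i j c \<in> affine_SL_directions"
  unfolding affine_SL_directions_def mem_Collect_eq SL_def
proof
  fix t :: real
  have "mat 1 + t *\<^sub>R unit_matrix i j c
      = (\<chi> k. if k = i then row i (mat 1) + (t *\<^sub>R c) *s row j (mat 1) else row k (mat 1))"
    by (auto simp: vec_eq_iff unit_matrix_def mat_def row_def)
  then show "det (mat 1 + t *\<^sub>R unit_matrix i j c) = 1"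
    using det_row_operation[OF assms, of "mat 1 :: complex^'n^'n" "t *\<^sub>R c"] by simp
qed

lemma affine_SL_directions_conj:
  assumes "N \<in> affine_SL_directions" "g \<in> SL" "g ** h = mat 1"
  shows "g ** N ** h \<in> affine_SL_directions"
  unfolding affine_SL_directions_def mem_Collect_eq
proof
  fix t :: real
  from assms have "det g = 1" "det h = 1"
    using det_mul[of g h] by (auto simp: SL_def)
  moreover have "mat 1 + t *\<^sub>R (g ** N ** h) = g ** (mat 1 + t *\<^sub>R N) ** h"
    using assms(3)
    by (simp add: matrix_add_ldistrib matrix_add_rdistrib matrix_scaleR_left matrix_scaleR_right)
  moreover have "det (mat 1 + t *\<^sub>R N) = 1"
    using assms(1) by (simp add: affine_SL_directions_def SL_def)
  ultimately show "mat 1 + t *\<^sub>R (g ** N ** h) \<in> SL"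
    by (simp add: SL_def det_mul)
qed

text \<open>A nonzero diagonal matrix is not itself such a direction, so conjugation has to produce
  it: with g = 1 + E_ij, conjugating c E_ji gives c (E_ji + E_ii - E_jj - E_ij), and the
  off-diagonal terms are already available.\<close>

lemma unit_matrix_diagonal_diff_in_span:
  fixes i j :: "'n::finite"
  shows   "unit_matrix i i c - unit_matrix j j c \<in> span affine_SL_directions"
proof (cases "i = j")
  case False
  define g h :: "complex^'n^'n" where "g = mat 1 + unit_matrix i j 1" and "h = mat 1 + unit_matrix i j (- 1)"
  have g: "g \<in> SL"
    using unit_matrix_affine[OF False, of 1] by (auto simp: affine_SL_directions_def g_def dest: spec[of _ 1])
  have add0: "unit_matrix i j 1 + unit_matrix i j (- 1) = 0"
    by (simp add: vec_eq_iff unit_matrix_def)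
  have gh: "g ** h = mat 1"
    using False add0
    by (simp add: g_def h_def matrix_add_ldistrib matrix_add_rdistrib unit_matrix_mult add.assoc add.commute)
  have neg: "unit_matrix a b (- c) = - unit_matrix a b c" for a b
    by (simp add: vec_eq_iff unit_matrix_def)
  have "g ** unit_matrix j i c ** h
      = unit_matrix j i c + unit_matrix i i c - unit_matrix j j c - unit_matrix i j c"
    by (simp add: g_def h_def matrix_add_ldistrib matrix_add_rdistrib unit_matrix_mult neg)
  then have "unit_matrix i i c - unit_matrix j j c
      = g ** unit_matrix j i c ** h - unit_matrix j i c + unit_matrix i j c"
    by simp
  moreover have "g ** unit_matrix j i c ** h \<in> span affine_SL_directions"
    "unit_matrix j i c \<in> span affine_SL_directions" "unit_matrix i j c \<in> span affine_SL_directions"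
    using affine_SL_directions_conj[OF unit_matrix_affine[OF False[symmetric]] g gh]
      unit_matrix_affine[OF False] unit_matrix_affine[OF False[symmetric]]
    by (auto intro!: span_base)
  ultimately show ?thesis by (simp add: span_add span_diff)
qed (simp add: span_zero)

text \<open>Subtract, for each i, the entry K_ii placed at one fixed diagonal position. In total
  this subtracts the trace, hence nothing, and each corrected row is a diagonal difference plus
  off-diagonal units.\<close>

lemma traceless_in_span:
  fixes K :: "complex^'n^'n::finite"
  assumes "trace K = 0"
  shows "K \<in> span affine_SL_directions"
proof -
  let ?u = "undefined :: 'n"
  have zero: "unit_matrix i j 0 = 0" for i j :: 'n
    by (simp add: vec_eq_iff unit_matrix_def)
  have "(\<Sum>i\<in>UNIV. unit_matrix ?u ?u (K $ i $ i)) = unit_matrix ?u ?u (trace K)"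
    by (auto simp: vec_eq_iff unit_matrix_def trace_def intro!: sum.neutral)
  then have "(\<Sum>i\<in>UNIV. unit_matrix ?u ?u (K $ i $ i)) = 0"
    using assms zero by simp
  moreover have "K = (\<Sum>i\<in>UNIV. \<Sum>j\<in>UNIV. unit_matrix i j (K $ i $ j))"
    by (rule matrix_unit_decomposition)
  ultimately have "K = (\<Sum>i\<in>UNIV. (\<Sum>j\<in>UNIV. unit_matrix i j (K $ i $ j)) - unit_matrix ?u ?u (K $ i $ i))"
    by (simp add: sum_subtractf)
  also have "\<dots> \<in> span affine_SL_directions"
  proof (rule span_sum)
    fix i :: 'n
    have "(\<Sum>j\<in>UNIV. unit_matrix i j (K $ i $ j))
        = unit_matrix i i (K $ i $ i) + (\<Sum>j\<in>UNIV - {i}. unit_matrix i j (K $ i $ j))"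
      by (simp add: sum.remove)
    then have "(\<Sum>j\<in>UNIV. unit_matrix i j (K $ i $ j)) - unit_matrix ?u ?u (K $ i $ i)
        = (unit_matrix i i (K $ i $ i) - unit_matrix ?u ?u (K $ i $ i))
          + (\<Sum>j\<in>UNIV - {i}. unit_matrix i j (K $ i $ j))"
      by simp
    moreover have "(\<Sum>j\<in>UNIV - {i}. unit_matrix i j (K $ i $ j)) \<in> span affine_SL_directions"
      by (intro span_sum span_base unit_matrix_affine) auto
    ultimately show "(\<Sum>j\<in>UNIV. unit_matrix i j (K $ i $ j)) - unit_matrix ?u ?u (K $ i $ i)
        \<in> span affine_SL_directions"
      by (simp only: span_add[OF unit_matrix_diagonal_diff_in_span])
  qed
  finally show ?thesis .
qed

text \<open>The coefficients are linear functionals on all matrices, so they stay smooth when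
  applied to a smooth matrix function; this makes the vertical part in
  \<open>derivation_local_vector\<close> smooth.\<close>

lemma traceless_decomposition:
  obtains B :: "(complex^'n^'n::finite) set" and g :: "complex^'n^'n \<Rightarrow> complex^'n^'n \<Rightarrow> real"
  where "finite B" "B \<subseteq> affine_SL_directions" "\<And>N. bounded_linear (g N)"
    "\<And>K. trace K = 0 \<Longrightarrow> K = (\<Sum>N\<in>B. g N K *\<^sub>R N)"
proof -
  obtain B :: "(complex^'n^'n) set" where B: "B \<subseteq> affine_SL_directions" "independent B"
    "affine_SL_directions \<subseteq> span B"
    using maximal_independent_subset[of affine_SL_directions] by metis
  then have fin: "finite B" using independent_bound by blast
  have "\<exists>h :: complex^'n^'n \<Rightarrow> real. linear h \<and> (\<forall>x\<in>B. h x = (if x = N then 1 else 0))" for N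
    using linear_independent_extend[OF B(2), of "\<lambda>x. if x = N then 1 else 0"] by blast
  then obtain g :: "complex^'n^'n \<Rightarrow> complex^'n^'n \<Rightarrow> real" where
    g: "\<And>N. linear (g N)" "\<And>N x. x \<in> B \<Longrightarrow> g N x = (if x = N then 1 else 0)" by metis
  have lin: "linear (\<lambda>K. \<Sum>N\<in>B. g N K *\<^sub>R N)"
    using g(1)
    by (intro linearI) (simp_all add: linear_add linear_scale scaleR_add_left sum.distrib scaleR_sum_right)
  show ?thesis
  proof (rule that[OF fin B(1)])
    show "bounded_linear (g N)" for N
      using g(1) by (simp add: linear_conv_bounded_linear)
    fix K :: "complex^'n^'n" assume "trace K = 0"
    then have "K \<in> span B"
      using traceless_in_span[of K] B(3) span_minimal[OF _ subspace_span] by blast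
    moreover have "x = (\<Sum>N\<in>B. g N x *\<^sub>R N)" if "x \<in> B" for x
      using that fin by (simp add: g(2) if_distrib[of "\<lambda>c. c *\<^sub>R _"] cong: if_cong)
    ultimately show "K = (\<Sum>N\<in>B. g N K *\<^sub>R N)"
      using linear_eq_on_span[OF linear_ident lin, of B] by blast
  qed
qed

lemma Cinf_on_det: "Cinf_on UNIV (det :: complex^'n^'n::finite \<Rightarrow> complex)"
  unfolding Cinf_on_eq_smooth_on[OF open_UNIV]
  by (intro smooth_on_det smooth_on_bounded_linear bounded_linear_matrix_entry)

text \<open>Along A + t c A the determinant is (1 + t c)^n det A, which can be differentiated
  directly. This is the one direction left over once a derivative is known to be a scalar multiple
  of A.\<close>

lemma det_derivative_scalar:
  fixes A :: "complex^'n^'n::finite"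
  shows "frechet_derivative det (at A) (mat c ** A) = of_nat CARD('n) * c * det A"
proof -
  let ?y = "\<lambda>t::real. A + t *\<^sub>R (mat c ** A)"
  have D: "(det has_derivative frechet_derivative det (at A)) (at A)"
    using Cinf_on_differentiable[OF Cinf_on_det, of A] by (simp add: frechet_derivative_works)
  have "(?y has_derivative (\<lambda>t. t *\<^sub>R (mat c ** A))) (at 0)"
    by (auto intro!: derivative_eq_intros)
  from has_derivative_compose[OF this, of det "frechet_derivative det (at A)"] D
  have 1: "((\<lambda>t. det (?y t)) has_vector_derivative frechet_derivative det (at A) (mat c ** A)) (at 0)"
    by (simp add: has_vector_derivative_def linear_scale[OF has_derivative_linear[OF D]])
  have "?y t = mat (1 + t *\<^sub>R c) ** A" for t
    by (simp add: vec_eq_iff mat_mult_left algebra_simps)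
  moreover have "det (mat d :: complex^'n^'n) = d ^ CARD('n)" for d
    by (simp add: det_diagonal mat_def)
  ultimately have "(\<lambda>t. det (?y t)) = (\<lambda>t. (1 + t *\<^sub>R c) ^ CARD('n) * det A)"
    by (simp add: det_mul)
  moreover have "((\<lambda>t. (1 + t *\<^sub>R c) ^ CARD('n) * det A) has_vector_derivative
      of_nat CARD('n) * c * det A) (at 0)"
    unfolding has_vector_derivative_def
    by (auto intro!: derivative_eq_intros simp: scaleR_conv_of_real algebra_simps)
  ultimately show ?thesis
    using 1 vector_derivative_unique_at by metis
qed

section \<open>Trivializations and equivariant functions\<close>

lemma smooth_map_subset:
  assumes "smooth_map M N S F" "T \<subseteq> S"
  shows "smooth_map M N T F"
  unfolding smooth_map_def
proof (intro conjI ballI, goal_cases)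
  case 1
  show ?case using assms unfolding smooth_map_def by (blast intro: continuous_on_subset)
next
  case (2 c)
  obtain U \<phi> where c: "c = (U, \<phi>)" by (cases c)
  have "smooth_on (\<phi> ` (T \<inter> U \<inter> F -` V)) (\<psi> \<circ> F \<circ> inv_into U \<phi>)"
    if "(V, \<psi>) \<in> charts N" for V \<psi>
  proof (rule smooth_on_subset)
    show "smooth_on (\<phi> ` (S \<inter> U \<inter> F -` V)) (\<psi> \<circ> F \<circ> inv_into U \<phi>)"
      using assms(1) 2 c that unfolding smooth_map_def by fast
  qed (use assms(2) in blast)
  then show ?case by (auto simp: c)
qed

lemma smooth_map_snd:
  fixes M :: "('m::t2_space, 'e::euclidean_space) manifold"
  assumes "topological_atlas M"
  shows "smooth_map (product_manifold M (euclid :: ('a::euclidean_space, 'a) manifold)) euclid UNIV snd"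
proof (rule smooth_map_euclid_atlasI[OF topological_atlas_product[OF assms]])
  fix U' and \<phi>' :: "'m \<times> 'a \<Rightarrow> 'e \<times> 'a"
  assume "(U', \<phi>') \<in> charts (product_manifold M euclid)"
  then obtain U \<phi> where U: "(U, \<phi>) \<in> charts M" "U' = U \<times> UNIV" "\<phi>' = map_prod \<phi> (\<lambda>x. x)"
    by (auto simp: charts_product_euclid)
  show "smooth_on (\<phi>' ` (UNIV \<inter> U')) (\<lambda>y. snd (inv_into U' \<phi>' y))"
    by (rule smooth_on_cong[OF smooth_on_bounded_linear[OF bounded_linear_snd]])
       (auto simp: U inv_into_map_prod[OF atlas_chartD(2)[OF assms U(1)]])
qed

text \<open>Locally h is the restriction of a smooth G on an open set. Since
  \<open>S \<times> UNIV\<close> contains whole t-lines, the t-derivatives of h and G agree at (y,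
  0) for y in S, whatever the extension, and G provides the smoothness in y.\<close>

lemma parametrized_curve_derivative:
  fixes h :: "'e::euclidean_space \<times> real \<Rightarrow> 'b::euclidean_space"
  assumes "smooth_on (S \<times> UNIV) h"
  shows "y \<in> S \<Longrightarrow> (\<lambda>t. h (y, t)) differentiable (at 0)"
    and "smooth_on S (\<lambda>y. vector_derivative (\<lambda>t. h (y, t)) (at 0))"
proof -
  have loc: "\<exists>U g. open U \<and> y0 \<in> U \<and> Cinf_on U g \<and> (\<forall>y\<in>S \<inter> U.
      ((\<lambda>t. h (y, t)) has_vector_derivative g y) (at 0))" if "y0 \<in> S" for y0
  proof -
    from assms that obtain O' G where O': "open O'" "(y0, 0) \<in> O'" "Cinf_on O' G"
      "\<forall>z\<in>(S \<times> UNIV) \<inter> O'. G z = h z"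
      unfolding smooth_on_iff_Cinf_on by blast
    define U where "U = (\<lambda>y. (y, 0::real)) -` O'"
    have U: "open U" "y0 \<in> U"
      using O'(1,2) unfolding U_def by (auto intro!: open_vimage continuous_intros)
    have "smooth_on U (\<lambda>y. frechet_derivative G (at (y, 0)) (0, 1))"
      by (rule smooth_on_compose[OF Cinf_on_imp_smooth_on[OF O'(1) Cinf_on_derivative[OF O'(3)] subset_refl]
            smooth_on_Pair[OF smooth_on_bounded_linear[OF bounded_linear_ident] smooth_on_const]])
         (auto simp: U_def)
    then have "Cinf_on U (\<lambda>y. frechet_derivative G (at (y, 0)) (0, 1))"
      using Cinf_on_eq_smooth_on[OF U(1)] by blast
    moreover have "((\<lambda>t. h (y, t)) has_vector_derivative frechet_derivative G (at (y, 0)) (0, 1)) (at 0)"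
      if y: "y \<in> S \<inter> U" for y
    proof -
      have yO: "(y, 0) \<in> O'" using y by (auto simp: U_def)
      have D: "(G has_derivative frechet_derivative G (at (y, 0))) (at (y, 0))"
        using Cinf_on_differentiable[OF O'(3) yO] by (simp add: frechet_derivative_works)
      have "((\<lambda>t. (y, t)) has_derivative (\<lambda>t. (0, t))) (at (0::real))"
        by (auto intro!: derivative_eq_intros)
      from has_derivative_compose[OF this D]
      have "((\<lambda>t. G (y, t)) has_derivative (\<lambda>t. frechet_derivative G (at (y, 0)) (t *\<^sub>R (0, 1)))) (at 0)"
        by simp
      then have "((\<lambda>t. G (y, t)) has_derivative (\<lambda>t. t *\<^sub>R frechet_derivative G (at (y, 0)) (0, 1))) (at 0)"
        by (simp only: linear_scale[OF has_derivative_linear[OF D]])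
      then have "((\<lambda>t. G (y, t)) has_vector_derivative frechet_derivative G (at (y, 0)) (0, 1)) (at 0)"
        by (simp only: has_vector_derivative_def)
      then show ?thesis
        by (rule has_vector_derivative_transform_within_open[where S = "(\<lambda>t. (y, t)) -` O'"])
           (use O' yO y in \<open>auto intro!: open_vimage continuous_intros\<close>)
    qed
    ultimately show ?thesis using U by blast
  qed
  show "(\<lambda>t. h (y, t)) differentiable (at 0)" if "y \<in> S"
    using loc[OF that] that by (auto simp: has_vector_derivative_def differentiable_def)
  show "smooth_on S (\<lambda>y. vector_derivative (\<lambda>t. h (y, t)) (at 0))"
    unfolding smooth_on_iff_Cinf_on
  proof
    fix y0 assume "y0 \<in> S"
    from loc[OF this] obtain U g where "open U" "y0 \<in> U" "Cinf_on U g"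
      "\<forall>y\<in>S \<inter> U. ((\<lambda>t. h (y, t)) has_vector_derivative g y) (at 0)" by blast
    then show "\<exists>U g. open U \<and> y0 \<in> U \<and> Cinf_on U g \<and>
        (\<forall>y\<in>S \<inter> U. g y = vector_derivative (\<lambda>t. h (y, t)) (at 0))"
      by (intro exI[of _ U] exI[of _ g]) (auto simp: vector_derivative_at[symmetric])
  qed
qed

section \<open>Local trivializations, sections and the group action\<close>

locale SL_bundle =
  fixes M :: "('m::{t2_space,second_countable_topology}, 'e::euclidean_space) manifold"
    and P :: "('p::{t2_space,second_countable_topology}, 'f::euclidean_space, 'm, 'n::finite)
                principal_bundle"
  assumes smooth_base: "smooth_manifold M" and principal: "principal_SL_bundle M P"
begin

abbreviation "total_space \<equiv> bundle_space P"
abbreviation "proj \<equiv> bundle_proj P"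
abbreviation "act \<equiv> bundle_act P"

lemma smooth_total: "smooth_manifold total_space"
  and proj_smooth_map: "smooth_map total_space M UNIV proj"
  and act_smooth_map: "smooth_map (product_manifold total_space euclid) total_space (UNIV \<times> SL) (\<lambda>(p, g). act p g)"
  and act_one: "act p (mat 1) = p"
  and proj_act: "g \<in> SL \<Longrightarrow> proj (act p g) = proj p"
  using principal unfolding principal_SL_bundle_def by blast+

lemmas base_atlas = smooth_manifold_atlas[OF smooth_base]
lemmas total_atlas = smooth_manifold_atlas[OF smooth_total]

lemma proj_continuous: "continuous_on UNIV proj"
  using proj_smooth_map unfolding smooth_map_def by blast

lemma open_proj_vimage: "open U \<Longrightarrow> open (proj -` U)"
  by (rule open_vimage[OF _ proj_continuous])

lemma smooth_map_pullback_proj: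
  assumes "smooth_map M euclid U f"
  shows "smooth_map total_space euclid (proj -` U) (\<lambda>p. f (proj p))"
  by (rule smooth_map_compose[OF total_atlas base_atlas smooth_map_subset[OF proj_smooth_map] assms]) auto

lemma smooth_functions_pullback_proj:
  "f \<in> smooth_functions M \<Longrightarrow> (\<lambda>p. f (proj p)) \<in> smooth_functions total_space"
  using smooth_map_pullback_proj[of UNIV f] by (simp add: smooth_functions_iff)

text \<open>Here \<open>s\<close> is the inverse of the trivialization (\<open>proj\<close>,
  \<open>\<sigma>\<close>) in curried form, so \<open>s x\<close> parametrizes the fibre over
  \<open>x\<close> by SL. The values of \<open>\<sigma>\<close> and \<open>s\<close> away from
  \<open>U\<close> are arbitrary, which is why cutoffs accompany them later.\<close>

definition local_triv :: "'m set \<Rightarrow> ('p \<Rightarrow> complex^'n^'n) \<Rightarrow> ('m \<Rightarrow> complex^'n^'n \<Rightarrow> 'p) \<Rightarrow> bool" where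
  "local_triv U \<sigma> s \<longleftrightarrow> open U \<and>
    (\<forall>p. proj p \<in> U \<longrightarrow> \<sigma> p \<in> SL \<and> s (proj p) (\<sigma> p) = p \<and> (\<forall>g\<in>SL. \<sigma> (act p g) = \<sigma> p ** g)) \<and>
    (\<forall>x\<in>U. \<forall>g\<in>SL. proj (s x g) = x \<and> \<sigma> (s x g) = g) \<and>
    smooth_map total_space euclid (proj -` U) \<sigma> \<and>
    smooth_map (product_manifold M euclid) total_space (U \<times> SL) (\<lambda>(x, g). s x g)"

lemma local_triv_exists: "\<exists>U \<sigma> s. x \<in> U \<and> local_triv U \<sigma> s"
proof -
  have "\<exists>U \<tau>. open U \<and> x \<in> U \<and>
        (let W = proj -` U; \<Psi> = (\<lambda>p. (proj p, \<tau> p)) in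
          bij_betw \<Psi> W (U \<times> SL) \<and>
          smooth_map total_space (product_manifold M euclid) W \<Psi> \<and>
          smooth_map (product_manifold M euclid) total_space (U \<times> SL) (inv_into W \<Psi>) \<and>
          (\<forall>p\<in>W. \<forall>g\<in>SL. \<tau> (act p g) = \<tau> p ** g))"
    using principal unfolding principal_SL_bundle_def by blast
  then obtain U \<tau> where U: "open U" "x \<in> U" and \<tau>:
    "bij_betw (\<lambda>p. (proj p, \<tau> p)) (proj -` U) (U \<times> SL)"
    "smooth_map total_space (product_manifold M euclid) (proj -` U) (\<lambda>p. (proj p, \<tau> p))"
    "smooth_map (product_manifold M euclid) total_space (U \<times> SL) (inv_into (proj -` U) (\<lambda>p. (proj p, \<tau> p)))"
    "\<And>p g. p \<in> proj -` U \<Longrightarrow> g \<in> SL \<Longrightarrow> \<tau> (act p g) = \<tau> p ** g"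
    unfolding Let_def by blast
  define s where "s y g = inv_into (proj -` U) (\<lambda>p. (proj p, \<tau> p)) (y, g)" for y g
  have "smooth_map total_space euclid (proj -` U) (\<lambda>p. snd (proj p, \<tau> p))"
    by (rule smooth_map_compose[OF total_atlas topological_atlas_product[OF base_atlas] \<tau>(2)
          smooth_map_snd[OF base_atlas]]) simp
  moreover have "(\<lambda>(x, g). s x g) = inv_into (proj -` U) (\<lambda>p. (proj p, \<tau> p))"
    by (auto simp: s_def)
  moreover have "s (proj p) (\<tau> p) = p" if "proj p \<in> U" for p
    using bij_betw_inv_into_left[OF \<tau>(1), of p] that by (simp add: s_def)
  moreover have "proj (s y g) = y \<and> \<tau> (s y g) = g" if "y \<in> U" "g \<in> SL" for y g
    using bij_betw_inv_into_right[OF \<tau>(1), of "(y, g)"] that by (simp add: s_def)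
  moreover have "\<tau> p \<in> SL" if "proj p \<in> U" for p
    using bij_betwE[OF \<tau>(1)] that by auto
  ultimately have "local_triv U \<tau> s"
    using U \<tau>(3,4) by (auto simp: local_triv_def)
  with U show ?thesis by blast
qed

lemma local_trivD:
  assumes "local_triv U \<sigma> s"
  shows "open U" "proj p \<in> U \<Longrightarrow> \<sigma> p \<in> SL" "proj p \<in> U \<Longrightarrow> s (proj p) (\<sigma> p) = p"
    "proj p \<in> U \<Longrightarrow> g \<in> SL \<Longrightarrow> \<sigma> (act p g) = \<sigma> p ** g"
    "x \<in> U \<Longrightarrow> g \<in> SL \<Longrightarrow> proj (s x g) = x" "x \<in> U \<Longrightarrow> g \<in> SL \<Longrightarrow> \<sigma> (s x g) = g"
    "smooth_map total_space euclid (proj -` U) \<sigma>"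
    "smooth_map (product_manifold M euclid) total_space (U \<times> SL) (\<lambda>(x, g). s x g)"
  using assms unfolding local_triv_def by blast+

lemma local_triv_restrict:
  assumes "local_triv U \<sigma> s" "open V"
  shows "local_triv (U \<inter> V) \<sigma> s"
  using assms smooth_map_euclid_subset[OF local_trivD(7)[OF assms(1)], of "proj -` (U \<inter> V)"]
    smooth_map_subset[OF local_trivD(8)[OF assms(1)], of "(U \<inter> V) \<times> SL"]
  by (auto simp: local_triv_def)

lemma smooth_on_section_chart:
  assumes "local_triv U \<sigma> s" "smooth_map total_space euclid (proj -` U) f" "(V, \<phi>) \<in> charts M"
  shows "smooth_on (\<phi> ` (U \<inter> V) \<times> SL) (\<lambda>(y, g). f (s (inv_into V \<phi> y) g))"
proof -
  have "smooth_map (product_manifold M euclid) euclid (U \<times> SL) (\<lambda>z. f (case z of (x, g) \<Rightarrow> s x g))"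
    by (rule smooth_map_compose[OF topological_atlas_product[OF base_atlas] total_atlas
          local_trivD(8)[OF assms(1)] assms(2)]) (auto simp: local_trivD(5)[OF assms(1)])
  from smooth_map_product_euclidD[OF base_atlas this assms(3)] show ?thesis by simp
qed

lemma smooth_map_slice:
  assumes "local_triv U \<sigma> s" "smooth_map total_space euclid (proj -` U) f" "g \<in> SL"
  shows "smooth_map M euclid U (\<lambda>x. f (s x g))"
proof (rule smooth_map_euclid_atlasI[OF base_atlas])
  fix V \<phi> assume V: "(V, \<phi>) \<in> charts M"
  have "smooth_on (\<phi> ` (U \<inter> V)) (\<lambda>y. case (y, g) of (y, g) \<Rightarrow> f (s (inv_into V \<phi> y) g))"
    by (rule smooth_on_compose[OF smooth_on_section_chart[OF assms(1,2) V]
          smooth_on_Pair[OF smooth_on_bounded_linear[OF bounded_linear_ident] smooth_on_const]])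
       (use assms(3) in auto)
  then show "smooth_on (\<phi> ` (U \<inter> V)) (\<lambda>y. f (s (inv_into V \<phi> y) g))" by simp
qed

lemma proj_surj: "\<exists>p. proj p = x"
  using local_triv_exists[of x] local_trivD(5) SL_one by blast

text \<open>Locally F is f composed with the section x |-> s x 1.\<close>

lemma smooth_map_descend:
  assumes "open U" "smooth_map total_space euclid (proj -` U) f" "\<And>p. proj p \<in> U \<Longrightarrow> F (proj p) = f p"
  shows "smooth_map M euclid U F"
proof (rule smooth_map_local[OF base_atlas])
  fix x assume "x \<in> U"
  obtain V \<sigma> s where V: "x \<in> V" "local_triv V \<sigma> s" using local_triv_exists by blast
  note tr = local_triv_restrict[OF V(2) assms(1)]
  have "smooth_map M euclid (V \<inter> U) (\<lambda>x. f (s x (mat 1)))"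
    by (rule smooth_map_slice[OF tr smooth_map_euclid_subset[OF assms(2)] SL_one]) auto
  then have "smooth_map M euclid (V \<inter> U) F"
  proof (rule smooth_map_euclid_cong[OF base_atlas])
    fix y assume y: "y \<in> V \<inter> U"
    with local_trivD(5)[OF tr y SL_one] assms(3)[of "s y (mat 1)"]
    show "f (s y (mat 1)) = F y" by simp
  qed
  with V(1) local_trivD(1)[OF V(2)] show "\<exists>V. open V \<and> x \<in> V \<and> smooth_map M euclid (U \<inter> V) F"
    by (intro exI[of _ V]) (simp add: Int_commute)
qed

text \<open>In a trivialization the translating element is \<sigma>(p)^-1 \<sigma>(p'), because
  \<sigma> is equivariant and separates the points of a fibre.\<close>

lemma fiber_transitive:
  assumes "proj p = proj p'"
  obtains g where "g \<in> SL" "p' = act p g"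
proof -
  obtain U \<sigma> s where U: "proj p \<in> U" "local_triv U \<sigma> s" using local_triv_exists by blast
  note tr = local_trivD[OF U(2)]
  have sl: "\<sigma> p \<in> SL" "\<sigma> p' \<in> SL" using tr(2) U(1) assms by auto
  define g where "g = adjugate (\<sigma> p) ** \<sigma> p'"
  have g: "g \<in> SL" unfolding g_def by (intro SL_mult adjugate_SL sl)
  have "\<sigma> (act p g) = \<sigma> p'"
    using tr(4)[OF U(1) g] by (simp add: g_def matrix_mul_assoc adjugate_SL(1)[OF sl(1)])
  then have "act p g = s (proj p') (\<sigma> p')"
    using tr(3)[of "act p g"] proj_act[OF g, of p] U(1) by (simp add: assms[symmetric])
  then have "act p g = p'"
    using tr(3)[of p'] U(1) by (simp add: assms)
  with g that show ?thesis by blast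
qed

lemma smooth_on_act_chart:
  assumes "f \<in> smooth_functions total_space" "(V, \<phi>) \<in> charts total_space"
  shows "smooth_on (\<phi> ` V \<times> SL) (\<lambda>(y, g). f (act (inv_into V \<phi> y) g))"
proof -
  have "smooth_map (product_manifold total_space euclid) euclid (UNIV \<times> SL)
      (\<lambda>z. f (case z of (p, g) \<Rightarrow> act p g))"
    by (rule smooth_map_compose[OF topological_atlas_product[OF total_atlas] total_atlas act_smooth_map
          assms(1)[unfolded smooth_functions_iff]]) simp
  from smooth_map_product_euclidD[OF total_atlas this assms(2)] show ?thesis by simp
qed

lemma smooth_functions_act:
  assumes "f \<in> smooth_functions total_space" "g \<in> SL"
  shows "(\<lambda>p. f (act p g)) \<in> smooth_functions total_space"
  unfolding smooth_functions_iff
proof (rule smooth_map_euclid_atlasI[OF total_atlas])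
  fix V \<phi> assume V: "(V, \<phi>) \<in> charts total_space"
  have "smooth_on (\<phi> ` V) (\<lambda>y. case (y, g) of (y, g) \<Rightarrow> f (act (inv_into V \<phi> y) g))"
    by (rule smooth_on_compose[OF smooth_on_act_chart[OF assms(1) V]
          smooth_on_Pair[OF smooth_on_bounded_linear[OF bounded_linear_ident] smooth_on_const]])
       (use assms(2) in auto)
  then show "smooth_on (\<phi> ` (UNIV \<inter> V)) (\<lambda>y. f (act (inv_into V \<phi> y) g))" by simp
qed

text \<open>The condition is T(p g) = g^-1 T(p) g, multiplied by g to avoid the inverse. These
  functions are the sections of End(E), seen as the bundle associated to P by conjugation of
  matrices.\<close>

definition equivariant :: "('p \<Rightarrow> complex^'n^'n) set" where
  "equivariant = {T \<in> smooth_functions total_space. \<forall>p. \<forall>g\<in>SL. g ** T (act p g) = T p ** g}"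

lemma equivariantD:
  assumes "T \<in> equivariant"
  shows "T \<in> smooth_functions total_space" "g \<in> SL \<Longrightarrow> g ** T (act p g) = T p ** g"
  using assms unfolding equivariant_def by blast+

lemma equivariant_add:
  "S \<in> equivariant \<Longrightarrow> T \<in> equivariant \<Longrightarrow> (\<lambda>p. S p + T p) \<in> equivariant"
  by (simp add: equivariant_def smooth_functions_add matrix_add_ldistrib matrix_add_rdistrib)

lemma equivariant_mult:
  assumes "S \<in> equivariant" "T \<in> equivariant"
  shows "(\<lambda>p. S p ** T p) \<in> equivariant"
  unfolding equivariant_def
proof (intro CollectI conjI allI ballI)
  show "(\<lambda>p. S p ** T p) \<in> smooth_functions total_space"
    using assms by (intro smooth_functions_matrix_mult equivariantD)
  fix p g assume g: "g \<in> (SL :: (complex^'n^'n) set)"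
  have "g ** (S (act p g) ** T (act p g)) = (g ** S (act p g)) ** T (act p g)"
    by (simp add: matrix_mul_assoc)
  also have "\<dots> = S p ** (g ** T (act p g))"
    by (simp add: equivariantD(2)[OF assms(1) g] matrix_mul_assoc)
  also have "\<dots> = S p ** T p ** g"
    by (simp add: equivariantD(2)[OF assms(2) g] matrix_mul_assoc)
  finally show "g ** (S (act p g) ** T (act p g)) = S p ** T p ** g" .
qed

lemma equivariant_mat:
  assumes "f \<in> smooth_functions M"
  shows "(\<lambda>p. mat (f (proj p))) \<in> equivariant"
  using smooth_functions_linear[OF bounded_linear_mat smooth_functions_pullback_proj[OF assms]]
  by (simp add: equivariant_def proj_act mat_commute)

lemma equivariant_zero: "(\<lambda>p. 0) \<in> equivariant"
  using equivariant_mat[OF smooth_functions_const[of 0]] by (simp add: mat_def vec_eq_iff zero_vec_def)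

lemma equivariant_sum:
  "(\<And>i. i \<in> I \<Longrightarrow> T i \<in> equivariant) \<Longrightarrow> (\<lambda>p. \<Sum>i\<in>I. T i p) \<in> equivariant"
  by (induction I rule: infinite_finite_induct) (auto intro: equivariant_zero equivariant_add)

lemma adjugate_mult:
  fixes g h :: "complex^'n^'n"
  assumes "g \<in> SL" "h \<in> SL"
  shows "g ** adjugate (h ** g) = adjugate h"
proof -
  have "adjugate h ** ((h ** g) ** adjugate (h ** g)) = (adjugate h ** h) ** g ** adjugate (h ** g)"
    by (simp add: matrix_mul_assoc)
  then show ?thesis
    using adjugate_SL[OF assms(2)] adjugate_SL[OF SL_mult[OF assms(2,1)]] by simp
qed

text \<open>Since a vanishes off K, the arbitrary values of \<sigma> outside U are multiplied by 0,
  and a matrix given in one trivialization becomes a global section of End(E). This turns local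
  matrix computations into equivariant functions on all of P.\<close>

lemma equivariant_extension:
  assumes triv: "local_triv U \<sigma> s" and a: "smooth_map M euclid U a"
    and K: "closed K" "K \<subseteq> U" "\<And>x. x \<notin> K \<Longrightarrow> a x = 0"
  shows "(\<lambda>p. adjugate (\<sigma> p) ** a (proj p) ** \<sigma> p) \<in> equivariant"
  unfolding equivariant_def
proof (intro CollectI conjI allI ballI)
  note tr = local_trivD[OF triv]
  have "smooth_map total_space euclid (proj -` U) (\<lambda>p. adjugate (\<sigma> p) ** a (proj p) ** \<sigma> p)"
    by (intro smooth_map_matrix_mult smooth_map_pullback_proj[OF a] tr(7)
        smooth_map_post[OF tr(7) smooth_on_adjugate subset_UNIV total_atlas])
  then show "(\<lambda>p. adjugate (\<sigma> p) ** a (proj p) ** \<sigma> p) \<in> smooth_functions total_space"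
  proof (rule smooth_functions_extend_by_zero[OF total_atlas open_proj_vimage[OF tr(1)]])
    show "closed (proj -` K)"
      using K(1) proj_continuous by (rule closed_vimage)
    fix p assume "p \<notin> proj -` K"
    then have "a (proj p) = 0" using K(3) by auto
    then show "adjugate (\<sigma> p) ** a (proj p) ** \<sigma> p = 0"
      by (simp add: bounded_bilinear.zero_left[OF bounded_bilinear_matrix_mult]
          bounded_bilinear.zero_right[OF bounded_bilinear_matrix_mult])
  qed (use K(2) in auto)
  fix p g assume g: "g \<in> (SL :: (complex^'n^'n) set)"
  show "g ** (adjugate (\<sigma> (act p g)) ** a (proj (act p g)) ** \<sigma> (act p g))
      = adjugate (\<sigma> p) ** a (proj p) ** \<sigma> p ** g"
  proof (cases "proj p \<in> U")
    case True
    then show ?thesis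
      using tr(4)[OF True g] adjugate_mult[OF g tr(2)[OF True]]
      by (simp add: proj_act[OF g] matrix_mul_assoc)
  next
    case False
    then have "a (proj p) = 0" using K(2,3) by auto
    then show ?thesis
      by (simp add: proj_act[OF g] bounded_bilinear.zero_left[OF bounded_bilinear_matrix_mult]
          bounded_bilinear.zero_right[OF bounded_bilinear_matrix_mult])
  qed
qed

text \<open>The derivative along the curve \<open>p (1 + t N)\<close>, which for \<open>N\<close> in \<open>affine_SL_directions\<close>
  is the fundamental vector field of \<open>N\<close>.\<close>

definition vertical :: "complex^'n^'n \<Rightarrow> 'p vfield" where
  "vertical N p f = (if f \<in> smooth_functions total_space
     then vector_derivative (\<lambda>t. f (act p (mat 1 + t *\<^sub>R N))) (at 0) else 0)"

context
  fixes N :: "complex^'n^'n"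
  assumes N: "N \<in> affine_SL_directions"
begin

lemma affine_curve_SL: "mat 1 + t *\<^sub>R N \<in> SL"
  using N by (simp add: affine_SL_directions_def)

lemma smooth_on_curve_chart:
  assumes "f \<in> smooth_functions total_space" "(V, \<phi>) \<in> charts total_space"
  shows "smooth_on (\<phi> ` V \<times> UNIV) (\<lambda>(y, t). f (act (inv_into V \<phi> y) (mat 1 + t *\<^sub>R N)))"
proof -
  have "smooth_on (\<phi> ` V \<times> UNIV) (\<lambda>z. (fst z, mat 1 + snd z *\<^sub>R N))"
    by (intro smooth_on_Pair smooth_on_add smooth_on_const smooth_on_bounded_linear
        bounded_linear_fst bounded_linear_compose[OF bounded_linear_scaleR_left bounded_linear_snd])
  then have "smooth_on (\<phi> ` V \<times> UNIV)
      (\<lambda>z. case (fst z, mat 1 + snd z *\<^sub>R N) of (y, g) \<Rightarrow> f (act (inv_into V \<phi> y) g))"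
    by (rule smooth_on_compose[OF smooth_on_act_chart[OF assms]]) (auto simp: affine_curve_SL)
  then show ?thesis by (simp add: case_prod_beta')
qed

lemma curve_has_derivative:
  assumes "f \<in> smooth_functions total_space"
  shows "((\<lambda>t. f (act p (mat 1 + t *\<^sub>R N))) has_vector_derivative
    vector_derivative (\<lambda>t. f (act p (mat 1 + t *\<^sub>R N))) (at 0)) (at 0)"
proof -
  obtain V \<phi> where V: "(V, \<phi>) \<in> charts total_space" "p \<in> V"
    by (rule atlas_obtain_chart[OF total_atlas])
  from parametrized_curve_derivative(1)[OF smooth_on_curve_chart[OF assms V(1)], of "\<phi> p"] V(2)
  show ?thesis
    by (simp add: atlas_chartD(5)[OF total_atlas V] vector_derivative_works)
qed

lemma curve_derivative_smooth:
  assumes "f \<in> smooth_functions total_space"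
  shows "(\<lambda>p. vector_derivative (\<lambda>t. f (act p (mat 1 + t *\<^sub>R N))) (at 0)) \<in> smooth_functions total_space"
  unfolding smooth_functions_iff
proof (rule smooth_map_euclid_atlasI[OF total_atlas])
  fix V \<phi> assume V: "(V, \<phi>) \<in> charts total_space"
  from parametrized_curve_derivative(2)[OF smooth_on_curve_chart[OF assms V]]
  show "smooth_on (\<phi> ` (UNIV \<inter> V))
      (\<lambda>y. vector_derivative (\<lambda>t. f (act (inv_into V \<phi> y) (mat 1 + t *\<^sub>R N))) (at 0))" by simp
qed

lemma vertical_tangent: "vertical N p \<in> tangent_space total_space p"
proof (rule tangent_spaceI)
  fix f g :: "'p \<Rightarrow> real" and a b
  assume f: "f \<in> smooth_functions total_space" and g: "g \<in> smooth_functions total_space"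
  note D = curve_has_derivative[OF f, of p] curve_has_derivative[OF g, of p]
  have "(\<lambda>x. a * f x + b * g x) \<in> smooth_functions total_space"
    by (intro smooth_functions_add smooth_functions_mult smooth_functions_const f g)
  moreover have "((\<lambda>t. a * f (act p (mat 1 + t *\<^sub>R N)) + b * g (act p (mat 1 + t *\<^sub>R N)))
      has_vector_derivative (a * vertical N p f + b * vertical N p g)) (at 0)"
    using D f g by (auto intro!: derivative_eq_intros simp: vertical_def)
  ultimately show "vertical N p (\<lambda>x. a * f x + b * g x) = a * vertical N p f + b * vertical N p g"
    by (simp add: vertical_def vector_derivative_at)
  have "(\<lambda>x. f x * g x) \<in> smooth_functions total_space"
    by (intro smooth_functions_mult f g)
  moreover have "((\<lambda>t. f (act p (mat 1 + t *\<^sub>R N)) * g (act p (mat 1 + t *\<^sub>R N)))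
      has_vector_derivative (f p * vertical N p g + g p * vertical N p f)) (at 0)"
    using has_vector_derivative_mult[OF D] f g by (simp add: vertical_def act_one mult.commute)
  ultimately show "vertical N p (\<lambda>x. f x * g x) = f p * vertical N p g + g p * vertical N p f"
    by (simp add: vertical_def vector_derivative_at)
qed (simp add: vertical_def)

lemma tderiv_vertical:
  assumes "f \<in> smooth_functions total_space"
  shows "((\<lambda>t. f (act p (mat 1 + t *\<^sub>R N))) has_vector_derivative tderiv (vertical N p) f) (at 0)"
proof -
  note D = curve_has_derivative[OF assms, of p]
  have "vertical N p (\<lambda>x. f x \<bullet> b) = vector_derivative (\<lambda>t. f (act p (mat 1 + t *\<^sub>R N))) (at 0) \<bullet> b" for b
    using bounded_linear.has_vector_derivative[OF bounded_linear_inner_left D, of b]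
      smooth_functions_inner[OF assms]
    by (simp add: vertical_def vector_derivative_at)
  then have "tderiv (vertical N p) f = vector_derivative (\<lambda>t. f (act p (mat 1 + t *\<^sub>R N))) (at 0)"
    by (simp add: tderiv_def euclidean_representation)
  with D show ?thesis by simp
qed

text \<open>Differentiate c(t) T(p c(t)) = T(p) c(t) at t = 0 along c(t) = 1 + t N: besides the
  derivative sought, the left side contributes N T(p), the right side T(p) N.\<close>

lemma vertical_equivariant:
  assumes "T \<in> equivariant"
  shows "tderiv (vertical N p) T = T p ** N - N ** T p"
proof -
  let ?c = "\<lambda>t::real. mat 1 + t *\<^sub>R N"
  note D = tderiv_vertical[OF equivariantD(1)[OF assms], of p]
  have c: "(?c has_vector_derivative N) (at 0)"
    by (auto intro!: derivative_eq_intros)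
  have "((\<lambda>t. ?c t ** T (act p (?c t))) has_vector_derivative
      ?c 0 ** tderiv (vertical N p) T + N ** T (act p (?c 0))) (at 0)"
    by (rule bounded_bilinear.has_vector_derivative[OF bounded_bilinear_matrix_mult c D])
  moreover have "((\<lambda>t. T p ** ?c t) has_vector_derivative T p ** N) (at 0)"
    by (rule bounded_linear.has_vector_derivative[OF
          bounded_bilinear.bounded_linear_right[OF bounded_bilinear_matrix_mult] c])
  moreover have "?c t ** T (act p (?c t)) = T p ** ?c t" for t
    by (rule equivariantD(2)[OF assms affine_curve_SL])
  ultimately show ?thesis
    using vector_derivative_unique_at by (fastforce simp: act_one algebra_simps)
qed

end

end

section \<open>Linear combinations of tangent vectors\<close>

lemma tangent_space_combination:
  assumes "v \<in> tangent_space M p" "w \<in> tangent_space M p"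
  shows "(\<lambda>f. v f + c * w f) \<in> tangent_space M p"
proof (rule tangent_spaceI)
  fix f g :: "'a \<Rightarrow> real" and a b
  assume fg: "f \<in> smooth_functions M" "g \<in> smooth_functions M"
  show "v (\<lambda>x. a * f x + b * g x) + c * w (\<lambda>x. a * f x + b * g x)
      = a * (v f + c * w f) + b * (v g + c * w g)"
    using tangent_lincomb[OF assms(1) fg, of a b] tangent_lincomb[OF assms(2) fg, of a b]
    by (simp add: algebra_simps)
  show "v (\<lambda>x. f x * g x) + c * w (\<lambda>x. f x * g x)
      = f p * (v g + c * w g) + g p * (v f + c * w f)"
    using tangent_mult[OF assms(1) fg] tangent_mult[OF assms(2) fg]
    by (simp add: algebra_simps)
qed (use assms in \<open>simp add: tangent_nonsmooth\<close>)

lemma tangent_space_sum: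
  assumes "v \<in> tangent_space M p" "\<And>i. i \<in> I \<Longrightarrow> w i \<in> tangent_space M p"
  shows "(\<lambda>f. v f + (\<Sum>i\<in>I. c i * w i f)) \<in> tangent_space M p"
  using assms(2)
proof (induction I rule: infinite_finite_induct)
  case (insert i I)
  then show ?case
    using tangent_space_combination[of "\<lambda>f. v f + (\<Sum>i\<in>I. c i * w i f)" M p "w i" "c i"]
    by (simp add: algebra_simps)
qed (use assms(1) in simp_all)

lemma tderiv_combination: "tderiv (\<lambda>f. v f + c * w f) T = tderiv v T + c *\<^sub>R tderiv w T"
  by (simp add: tderiv_def scaleR_add_left sum.distrib scaleR_sum_right)

lemma tderiv_vector_sum:
  "tderiv (\<lambda>f. v f + (\<Sum>i\<in>I. c i * w i f)) T = tderiv v T + (\<Sum>i\<in>I. c i *\<^sub>R tderiv (w i) T)"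
  by (simp add: tderiv_def scaleR_add_left sum.distrib scaleR_sum_right scaleR_sum_left sum.swap[of _ I])

section \<open>Tangent vectors are detected by equivariant functions\<close>

context SL_bundle
begin

text \<open>A chart of the base together with the matrix \<sigma> serves as coordinates on P with
  values in a Euclidean space. F is an ambient extension of f in them, defined also off SL, to which
  \<open>tangent_chain\<close> can be applied.\<close>

lemma local_coordinates:
  assumes triv: "local_triv U \<sigma> s" and f: "smooth_map total_space euclid (proj -` U) f"
    and V: "(V, \<phi>) \<in> charts M" and p: "proj p \<in> U" "proj p \<in> V"
  obtains O' F where "open O'" "(\<phi> (proj p), \<sigma> p) \<in> O'" "Cinf_on O' F"
    "\<And>y g. y \<in> U \<Longrightarrow> y \<in> V \<Longrightarrow> g \<in> SL \<Longrightarrow> (\<phi> y, g) \<in> O' \<Longrightarrow> F (\<phi> y, g) = f (s y g)"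
proof -
  have "(\<phi> (proj p), \<sigma> p) \<in> \<phi> ` (U \<inter> V) \<times> SL"
    using p local_trivD(2)[OF triv] by auto
  with smooth_on_section_chart[OF triv f V] obtain O' F where
    O': "open O'" "(\<phi> (proj p), \<sigma> p) \<in> O'" "Cinf_on O' F"
    "\<forall>z\<in>(\<phi> ` (U \<inter> V) \<times> SL) \<inter> O'. F z = (case z of (y, g) \<Rightarrow> f (s (inv_into V \<phi> y) g))"
    unfolding smooth_on_iff_Cinf_on by blast
  show ?thesis
  proof (rule that[OF O'(1-3)])
    fix y g assume "y \<in> U" "y \<in> V" "g \<in> (SL :: (complex^'n^'n) set)" "(\<phi> y, g) \<in> O'"
    then show "F (\<phi> y, g) = f (s y g)"
      using O'(4)[rule_format, of "(\<phi> y, g)"] by (simp add: atlas_chartD(5)[OF base_atlas V])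
  qed
qed

lemma equivariant_detects_tangent:
  assumes v: "v \<in> tangent_space total_space p" and zero: "\<And>T. T \<in> equivariant \<Longrightarrow> tderiv v T = 0"
    and f: "f \<in> smooth_functions total_space"
  shows "v f = 0"
proof -
  obtain U \<sigma> s where U: "proj p \<in> U" and triv: "local_triv U \<sigma> s"
    using local_triv_exists by blast
  note tr = local_trivD[OF triv]
  obtain V \<phi> where V: "(V, \<phi>) \<in> charts M" "proj p \<in> V"
    by (rule atlas_obtain_chart[OF base_atlas])
  obtain \<sigma>' V1 where \<sigma>': "\<sigma>' \<in> smooth_functions total_space" "open V1" "p \<in> V1" "V1 \<subseteq> proj -` U"
    "\<And>q. q \<in> V1 \<Longrightarrow> \<sigma>' q = \<sigma> q"
    using smooth_map_germ_extension[OF smooth_total open_proj_vimage[OF tr(1)] _ tr(7), of p] U by auto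
  obtain \<phi>' V2 where \<phi>': "\<phi>' \<in> smooth_functions M" "open V2" "proj p \<in> V2" "V2 \<subseteq> V"
    "\<And>q. q \<in> V2 \<Longrightarrow> \<phi>' q = \<phi> q"
    using smooth_map_germ_extension[OF smooth_base atlas_chartD(1)[OF base_atlas V(1)] V(2)
        smooth_map_chart[OF smooth_base V(1)]] by auto
  obtain \<kappa> :: "'m \<Rightarrow> real" and V3 K where \<kappa>: "\<kappa> \<in> smooth_functions M" "open V3" "proj p \<in> V3" "V3 \<subseteq> K"
    "closed K" "K \<subseteq> U" "\<And>y. y \<in> V3 \<Longrightarrow> \<kappa> y = 1" "\<And>y. y \<notin> K \<Longrightarrow> \<kappa> y = 0"
    using manifold_bump[OF smooth_base tr(1) U] by blast
  have \<sigma>p: "\<sigma> p \<in> SL" "\<sigma>' p = \<sigma> p" using tr(2)[OF U] \<sigma>'(3,5) by auto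
  define w where "w = tderiv v \<sigma>'"
  define h where "h = w ** adjugate (\<sigma> p)"
  \<comment> \<open>Near p, \<open>\<sigma>' ** T\<close> equals \<open>A ** \<sigma>'\<close>. As v
    annihilates T, differentiating gives w T(p) = A w, which says that h = w \<sigma>(p)^-1 commutes
    with A.\<close>
  have "h ** A = A ** h" for A
  proof -
    define T where "T q = adjugate (\<sigma> q) ** (\<kappa> (proj q) *\<^sub>R A) ** \<sigma> q" for q
    have T: "T \<in> equivariant"
      unfolding T_def
    proof (rule equivariant_extension[OF triv _ \<kappa>(5,6)])
      show "smooth_map M euclid U (\<lambda>x. \<kappa> x *\<^sub>R A)"
        by (rule smooth_functions_restrict[OF smooth_functions_linear[OF bounded_linear_scaleR_left \<kappa>(1)]])
    qed (simp add: \<kappa>(8))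
    have "tderiv v (\<lambda>q. \<sigma>' q ** T q) = tderiv v (\<lambda>q. A ** \<sigma>' q)"
    proof (rule tderiv_local[OF smooth_total v])
      show "open (V1 \<inter> proj -` V3)" "p \<in> V1 \<inter> proj -` V3"
        using \<sigma>'(2,3) \<kappa>(3) open_proj_vimage[OF \<kappa>(2)] by auto
      fix q assume q: "q \<in> V1 \<inter> proj -` V3"
      then have "\<sigma> q \<in> SL" using tr(2) \<sigma>'(4) by auto
      with q \<sigma>'(5) \<kappa>(7) show "\<sigma>' q ** T q = A ** \<sigma>' q"
        by (simp add: T_def matrix_mul_assoc adjugate_SL)
    qed (use \<sigma>'(1) equivariantD(1)[OF T] in
        \<open>auto intro: smooth_functions_matrix_mult smooth_functions_const\<close>)
    moreover have "tderiv v (\<lambda>q. \<sigma>' q ** T q) = w ** T p"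
      by (simp add: tderiv_matrix_mult[OF smooth_total v \<sigma>'(1) equivariantD(1)[OF T]] zero[OF T] w_def
          bounded_bilinear.zero_right[OF bounded_bilinear_matrix_mult])
    moreover have "tderiv v (\<lambda>q. A ** \<sigma>' q) = A ** w"
      unfolding w_def
      by (rule tderiv_linear[OF smooth_total v
            bounded_bilinear.bounded_linear_right[OF bounded_bilinear_matrix_mult] \<sigma>'(1)])
    ultimately have "w ** T p = A ** w" by simp
    moreover have "T p = adjugate (\<sigma> p) ** A ** \<sigma> p"
      using \<kappa>(3,7) by (simp add: T_def)
    ultimately have "w ** (adjugate (\<sigma> p) ** A ** \<sigma> p) ** adjugate (\<sigma> p) = A ** w ** adjugate (\<sigma> p)"
      by simp
    moreover have "w ** (adjugate (\<sigma> p) ** A ** \<sigma> p) ** adjugate (\<sigma> p)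
        = h ** A ** (\<sigma> p ** adjugate (\<sigma> p))"
      by (simp add: h_def matrix_mul_assoc)
    ultimately show ?thesis
      by (simp add: adjugate_SL(1)[OF \<sigma>p(1)]) (simp add: h_def matrix_mul_assoc)
  qed
  then obtain c where c: "h = mat c" by (rule commuting_all_imp_scalar)
  have "w = h ** \<sigma> p"
    by (simp add: h_def matrix_mul_assoc[symmetric] adjugate_SL(2)[OF \<sigma>p(1)])
  with c have w: "w = mat c ** \<sigma>' p" by (simp add: \<sigma>p)
  \<comment> \<open>Both sides are the derivative of det o \<sigma>': near p this is the constant 1,
    and the chain rule evaluates it as n c, because w = c \<sigma>'(p).\<close>
  have "tderiv v (\<lambda>q. 1 :: complex) = frechet_derivative det (at (\<sigma>' p)) (tderiv v \<sigma>')"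
  proof (rule tderiv_chain[OF smooth_total v \<sigma>'(1) smooth_functions_const open_UNIV UNIV_I Cinf_on_det \<sigma>'(2,3)])
    fix q assume "q \<in> V1"
    then have "\<sigma>' q \<in> SL" using tr(2) \<sigma>'(4,5) by auto
    then show "1 = det (\<sigma>' q)" by (simp add: SL_def)
  qed
  then have "of_nat CARD('n) * c * det (\<sigma>' p) = 0"
    using w by (simp add: tderiv_const[OF smooth_total v] w_def[symmetric] det_derivative_scalar)
  then have "c = 0" using \<sigma>p by (auto simp: SL_def)
  then have w0: "w = 0"
    using w by (simp add: vec_eq_iff mat_mult_left)
  \<comment> \<open>The base directions are seen by the central equivariant functions, that is, by
    the scalar matrices with entry k o proj.\<close>
  have v_proj: "v (\<lambda>q. k (proj q)) = 0" if k: "k \<in> smooth_functions M" for k :: "'m \<Rightarrow> real"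
  proof -
    have lin: "bounded_linear (\<lambda>r::real. mat (complex_of_real r) :: complex^'n^'n)"
      by (rule bounded_linear_compose[OF bounded_linear_mat bounded_linear_of_real])
    have "mat (complex_of_real (v (\<lambda>q. k (proj q)))) = tderiv v (\<lambda>q. mat (complex_of_real (k (proj q))) :: complex^'n^'n)"
      using tderiv_linear[OF smooth_total v lin smooth_functions_pullback_proj[OF k]] by simp
    also have "\<dots> = 0"
      by (rule zero[OF equivariant_mat[OF smooth_functions_linear[OF bounded_linear_of_real k]]])
    finally have "mat (complex_of_real (v (\<lambda>q. k (proj q)))) = (mat 0 :: complex^'n^'n)"
      by (simp add: mat_def vec_eq_iff)
    then show ?thesis by (simp only: mat_eq_iff of_real_eq_0_iff)
  qed
  have \<phi>'0: "tderiv v (\<lambda>q. \<phi>' (proj q)) = 0"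
    unfolding tderiv_def
    by (rule sum.neutral) (simp add: v_proj[OF smooth_functions_inner[OF \<phi>'(1)]])
  obtain O' F where O': "open O'" "(\<phi> (proj p), \<sigma> p) \<in> O'" "Cinf_on O' F"
    "\<And>y g. y \<in> U \<Longrightarrow> y \<in> V \<Longrightarrow> g \<in> SL \<Longrightarrow> (\<phi> y, g) \<in> O' \<Longrightarrow> F (\<phi> y, g) = f (s y g)"
    using local_coordinates[OF triv smooth_functions_restrict[OF f] V(1) U V(2)] by blast
  let ?Y = "\<lambda>q. (\<phi>' (proj q), \<sigma>' q)"
  have Y: "?Y \<in> smooth_functions total_space"
    by (intro smooth_functions_Pair smooth_functions_pullback_proj \<phi>'(1) \<sigma>'(1))
  have YO: "?Y p \<in> O'" using O'(2) \<phi>'(3,5) \<sigma>p by simp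
  \<comment> \<open>Both components of the coordinate map have derivative zero along v, so the chain
    rule leaves nothing of v f.\<close>
  have "v f = frechet_derivative F (at (?Y p)) (tderiv v ?Y)"
  proof (rule tangent_chain[OF smooth_total v Y f O'(1) YO O'(3)])
    show "open (V1 \<inter> proj -` V2)" "p \<in> V1 \<inter> proj -` V2"
      using \<sigma>'(2,3) \<phi>'(3) open_proj_vimage[OF \<phi>'(2)] by auto
    fix q assume q: "q \<in> V1 \<inter> proj -` V2" "?Y q \<in> O'"
    then have "proj q \<in> U" "proj q \<in> V" using \<sigma>'(4) \<phi>'(4) by auto
    with q O'(4)[of "proj q" "\<sigma> q"] tr(2,3)[of q] \<sigma>'(5) \<phi>'(5)
    show "f q = F (?Y q)" by simp
  qed
  also have "tderiv v ?Y = 0"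
    using tderiv_Pair[OF smooth_total v smooth_functions_pullback_proj[OF \<phi>'(1)] \<sigma>'(1)] \<phi>'0 w0
    by (simp add: w_def zero_prod_def)
  finally show ?thesis
    using linear_0[OF linear_frechet_derivative[OF Cinf_on_differentiable[OF O'(3) YO]]] by simp
qed

lemma tangent_eqI:
  assumes "v \<in> tangent_space total_space p" "w \<in> tangent_space total_space p"
    "\<And>T. T \<in> equivariant \<Longrightarrow> tderiv v T = tderiv w T"
  shows "v = w"
proof
  fix f
  show "v f = w f"
  proof (cases "f \<in> smooth_functions total_space")
    case True
    have "v f + (- 1) * w f = 0"
      by (rule equivariant_detects_tangent[OF tangent_space_combination[OF assms(1,2)] _ True])
         (simp only: tderiv_combination assms(3), simp)
    then show ?thesis by simp
  next
    case False
    then show ?thesis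
      using tangent_nonsmooth[OF assms(1)] tangent_nonsmooth[OF assms(2)] by simp
  qed
qed

section \<open>Horizontal lifts in a trivialization\<close>

lemma section_act:
  assumes "local_triv U \<sigma> s" "x \<in> U" "g \<in> SL" "h \<in> SL"
  shows "act (s x g) h = s x (g ** h)"
  using local_trivD(3)[OF assms(1), of "act (s x g) h"] local_trivD(4)[OF assms(1), of "s x g" h]
    local_trivD(5,6)[OF assms(1-3)] proj_act[OF assms(4)] assms by simp

lemma equivariant_section:
  assumes "local_triv U \<sigma> s" "x \<in> U" "g \<in> SL" "T \<in> equivariant"
  shows "T (s x g) = adjugate g ** T (s x (mat 1)) ** g"
proof -
  have "g ** T (s x g) = T (s x (mat 1)) ** g"
    using equivariantD(2)[OF assms(4,3), of "s x (mat 1)"] section_act[OF assms(1,2) SL_one assms(3)]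
    by simp
  then have "adjugate g ** (g ** T (s x g)) = adjugate g ** (T (s x (mat 1)) ** g)" by simp
  then show ?thesis
    by (simp add: matrix_mul_assoc adjugate_SL(2)[OF assms(3)])
qed

text \<open>The lift to \<open>p\<close> of a vector field of the base that is constant in the trivialization;
  \<open>\<kappa>\<close> is a cutoff.\<close>

definition horizontal ::
  "('m \<Rightarrow> real) \<Rightarrow> ('p \<Rightarrow> complex^'n^'n) \<Rightarrow> ('m \<Rightarrow> complex^'n^'n \<Rightarrow> 'p) \<Rightarrow> 'm vfield \<Rightarrow> 'p vfield" where
  "horizontal \<kappa> \<sigma> s X p f = (if f \<in> smooth_functions total_space
     then X (proj p) (\<lambda>x. \<kappa> x * f (s x (\<sigma> p))) else 0)"

text \<open>The factor \<kappa> removes the arbitrary values of s outside U, so the slice becomes a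
  global function on the base, to which a vector field can be applied.\<close>

lemma smooth_functions_cutoff_slice:
  assumes "local_triv U \<sigma> s" "\<kappa> \<in> smooth_functions M" "closed K" "K \<subseteq> U" "\<And>x. x \<notin> K \<Longrightarrow> \<kappa> x = 0"
    "f \<in> smooth_functions total_space" "g \<in> SL"
  shows "(\<lambda>x. \<kappa> x *\<^sub>R f (s x g)) \<in> smooth_functions M"
  by (rule smooth_functions_extend_by_zero[OF base_atlas local_trivD(1)[OF assms(1)]
        smooth_map_bilinear[OF bounded_bilinear_scaleR smooth_functions_restrict[OF assms(2)]
          smooth_map_slice[OF assms(1) smooth_functions_restrict[OF assms(6)] assms(7)]] assms(3,4)])
     (simp add: assms(5))

context
  fixes U \<sigma> s and \<kappa> :: "'m \<Rightarrow> real" and K V0 and X :: "'m vfield"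
  assumes triv: "local_triv U \<sigma> s" and \<kappa>: "\<kappa> \<in> smooth_functions M"
    and K: "closed K" "K \<subseteq> U" "\<And>x. x \<notin> K \<Longrightarrow> \<kappa> x = 0"
    and V0: "open V0" "V0 \<subseteq> K" "\<And>x. x \<in> V0 \<Longrightarrow> \<kappa> x = 1"
    and X: "X \<in> vector_fields M"
begin

private lemma sub: "x \<in> V0 \<Longrightarrow> x \<in> U" using K(2) V0(2) by auto

private lemma cut:
  assumes "f \<in> smooth_functions total_space" "g \<in> SL"
  shows "(\<lambda>x. \<kappa> x * f (s x g)) \<in> smooth_functions M"
  using smooth_functions_cutoff_slice[OF triv \<kappa> K assms] by simp

lemma horizontal_tangent:
  assumes p: "proj p \<in> V0"
  shows "horizontal \<kappa> \<sigma> s X p \<in> tangent_space total_space p"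
proof (rule tangent_spaceI)
  note Xp = vector_fieldsD(1)[OF X, of "proj p"]
  have \<sigma>p: "\<sigma> p \<in> SL" "s (proj p) (\<sigma> p) = p" using local_trivD(2,3)[OF triv] sub p by auto
  fix f g :: "'p \<Rightarrow> real" and a b
  assume f: "f \<in> smooth_functions total_space" and g: "g \<in> smooth_functions total_space"
  note cf = cut[OF f \<sigma>p(1)] and cg = cut[OF g \<sigma>p(1)]
  have "(\<lambda>x. a * f x + b * g x) \<in> smooth_functions total_space"
    by (intro smooth_functions_add smooth_functions_mult smooth_functions_const f g)
  moreover have "(\<lambda>x. \<kappa> x * (a * f (s x (\<sigma> p)) + b * g (s x (\<sigma> p))))
      = (\<lambda>x. a * (\<kappa> x * f (s x (\<sigma> p))) + b * (\<kappa> x * g (s x (\<sigma> p))))"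
    by (simp add: algebra_simps)
  ultimately show "horizontal \<kappa> \<sigma> s X p (\<lambda>x. a * f x + b * g x)
      = a * horizontal \<kappa> \<sigma> s X p f + b * horizontal \<kappa> \<sigma> s X p g"
    using tangent_lincomb[OF Xp cf cg] f g by (simp add: horizontal_def)
  have fg: "(\<lambda>x. f x * g x) \<in> smooth_functions total_space"
    by (intro smooth_functions_mult f g)
  \<comment> \<open>One cutoff factor against two: the functions agree on V0, where \<kappa> is 1,
    and tangent vectors see only germs.\<close>
  have "X (proj p) (\<lambda>x. \<kappa> x * (f (s x (\<sigma> p)) * g (s x (\<sigma> p))))
      = X (proj p) (\<lambda>x. (\<kappa> x * f (s x (\<sigma> p))) * (\<kappa> x * g (s x (\<sigma> p))))"
    by (rule tangent_local[OF smooth_base Xp cut[OF fg \<sigma>p(1)] smooth_functions_mult[OF cf cg] V0(1) p])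
       (simp add: V0(3))
  with tangent_mult[OF Xp cf cg] f g fg
  show "horizontal \<kappa> \<sigma> s X p (\<lambda>x. f x * g x)
      = f p * horizontal \<kappa> \<sigma> s X p g + g p * horizontal \<kappa> \<sigma> s X p f"
    by (simp add: horizontal_def \<sigma>p(2) V0(3)[OF p])
qed (simp add: horizontal_def)

lemma tderiv_horizontal:
  assumes "f \<in> smooth_functions total_space"
  shows "tderiv (horizontal \<kappa> \<sigma> s X p) f = tderiv (X (proj p)) (\<lambda>x. \<kappa> x *\<^sub>R f (s x (\<sigma> p)))"
  by (simp add: tderiv_def horizontal_def smooth_functions_inner[OF assms])

text \<open>The function to which X is applied itself depends on p through \<sigma>(p), so that X
  preserves smooth functions does not settle the matter. In coordinates the value is the sum over b
  of X(\<phi>_b) times the partial derivative of F in the base direction b at (\<phi>, \<sigma>),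
  and both factors are smooth in p.\<close>

lemma horizontal_smooth:
  assumes f: "f \<in> smooth_functions total_space"
  shows "smooth_map total_space euclid (proj -` V0) (\<lambda>p. horizontal \<kappa> \<sigma> s X p f)"
proof (rule smooth_map_local[OF total_atlas])
  note tr = local_trivD[OF triv]
  fix p1 assume "p1 \<in> proj -` V0"
  then have p1: "proj p1 \<in> V0" "proj p1 \<in> U" using sub by auto
  obtain V \<phi> where V: "(V, \<phi>) \<in> charts M" "proj p1 \<in> V"
    by (rule atlas_obtain_chart[OF base_atlas])
  obtain \<phi>' V2 where \<phi>': "\<phi>' \<in> smooth_functions M" "open V2" "proj p1 \<in> V2" "V2 \<subseteq> V"
    "\<And>q. q \<in> V2 \<Longrightarrow> \<phi>' q = \<phi> q"
    using smooth_map_germ_extension[OF smooth_base atlas_chartD(1)[OF base_atlas V(1)] V(2)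
        smooth_map_chart[OF smooth_base V(1)]] by auto
  obtain O' F where O': "open O'" "(\<phi> (proj p1), \<sigma> p1) \<in> O'" "Cinf_on O' F"
    "\<And>y g. y \<in> U \<Longrightarrow> y \<in> V \<Longrightarrow> g \<in> SL \<Longrightarrow> (\<phi> y, g) \<in> O' \<Longrightarrow> F (\<phi> y, g) = f (s y g)"
    using local_coordinates[OF triv smooth_functions_restrict[OF f] V(1) p1(2) V(2)] by blast
  let ?Y = "\<lambda>q. (\<phi>' (proj q), \<sigma> q)"
  define W where "W = proj -` (V0 \<inter> V2) \<inter> ?Y -` O'"
  have Y: "smooth_map total_space euclid (proj -` (V0 \<inter> V2)) ?Y"
    by (intro smooth_map_Pair smooth_functions_restrict[OF smooth_functions_pullback_proj[OF \<phi>'(1)]]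
        smooth_map_euclid_subset[OF tr(7)]) (use sub in auto)
  have W: "open W" "p1 \<in> W"
    unfolding W_def
    using continuous_open_preimage[OF smooth_map_euclid_continuous[OF Y] open_proj_vimage O'(1)]
      V0(1) \<phi>'(2,3,5) p1(1) O'(2) by auto
  let ?D = "\<lambda>p b. frechet_derivative F (at (?Y p)) (b, 0)"
  have eq: "(\<Sum>b\<in>Basis. (tderiv (X (proj p)) \<phi>' \<bullet> b) *\<^sub>R ?D p b) = horizontal \<kappa> \<sigma> s X p f"
    if "p \<in> W" for p
  proof -
    from that have p: "proj p \<in> V0" "proj p \<in> V2" "?Y p \<in> O'" by (auto simp: W_def)
    have \<sigma>p: "\<sigma> p \<in> SL" using tr(2) sub p(1) by auto
    define O1 where "O1 = (\<lambda>y. (y, \<sigma> p)) -` O'"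
    have O1: "open O1" "\<phi>' (proj p) \<in> O1"
      unfolding O1_def using O'(1) p(3) by (auto intro!: open_vimage continuous_intros)
    have F1: "Cinf_on O1 (\<lambda>y. F (y, \<sigma> p))"
      unfolding Cinf_on_eq_smooth_on[OF O1(1)]
      by (rule smooth_on_compose[OF Cinf_on_imp_smooth_on[OF O'(1,3) subset_refl]
            smooth_on_Pair[OF smooth_on_bounded_linear[OF bounded_linear_ident] smooth_on_const]])
         (auto simp: O1_def)
    have D: "(F has_derivative frechet_derivative F (at (?Y p))) (at (?Y p))"
      using Cinf_on_differentiable[OF O'(3) p(3)] by (simp add: frechet_derivative_works)
    have "((\<lambda>y. (y, \<sigma> p)) has_derivative (\<lambda>w. (w, 0))) (at (\<phi>' (proj p)))"
      by (auto intro!: derivative_eq_intros)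
    from has_derivative_compose[OF this D]
    have D1: "((\<lambda>y. F (y, \<sigma> p)) has_derivative (\<lambda>w. ?D p w)) (at (\<phi>' (proj p)))" .
    have "X (proj p) (\<lambda>x. \<kappa> x * f (s x (\<sigma> p)))
        = frechet_derivative (\<lambda>y. F (y, \<sigma> p)) (at (\<phi>' (proj p))) (tderiv (X (proj p)) \<phi>')"
    proof (rule tangent_chain[OF smooth_base vector_fieldsD(1)[OF X] \<phi>'(1) cut[OF f \<sigma>p] O1 F1])
      show "open (V0 \<inter> V2)" "proj p \<in> V0 \<inter> V2" using V0(1) \<phi>'(2) p by auto
      fix x assume x: "x \<in> V0 \<inter> V2" "\<phi>' x \<in> O1"
      then show "\<kappa> x * f (s x (\<sigma> p)) = F (\<phi>' x, \<sigma> p)"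
        using O'(4)[of x "\<sigma> p"] sub[of x] \<phi>'(4) \<phi>'(5)[of x] V0(3)[of x] \<sigma>p by (auto simp: O1_def)
    qed
    also have "\<dots> = (\<Sum>b\<in>Basis. (tderiv (X (proj p)) \<phi>' \<bullet> b) *\<^sub>R ?D p b)"
      using frechet_derivative_componentwise[OF Cinf_on_differentiable[OF F1 O1(2)]]
      unfolding frechet_derivative_at[OF D1, symmetric] .
    finally show ?thesis using f by (simp add: horizontal_def)
  qed
  have "smooth_map total_space euclid W (\<lambda>p. \<Sum>b\<in>Basis. (tderiv (X (proj p)) \<phi>' \<bullet> b) *\<^sub>R ?D p b)"
  proof (intro smooth_map_sum smooth_map_bilinear[OF bounded_bilinear_scaleR])
    fix b :: 'e
    show "smooth_map total_space euclid W (\<lambda>p. tderiv (X (proj p)) \<phi>' \<bullet> b)"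
      by (rule smooth_functions_restrict[OF smooth_functions_pullback_proj[OF
              smooth_functions_inner[OF vector_field_tderiv_smooth[OF X \<phi>'(1)]]]])
    show "smooth_map total_space euclid W (\<lambda>p. ?D p b)"
      by (rule smooth_map_post[OF smooth_map_euclid_subset[OF Y]
            Cinf_on_imp_smooth_on[OF O'(1) Cinf_on_derivative[OF O'(3)] subset_refl] _ total_atlas])
         (auto simp: W_def)
  qed
  then have "smooth_map total_space euclid W (\<lambda>p. horizontal \<kappa> \<sigma> s X p f)"
    by (rule smooth_map_euclid_cong[OF total_atlas]) (rule eq)
  then have "smooth_map total_space euclid (proj -` V0 \<inter> W) (\<lambda>p. horizontal \<kappa> \<sigma> s X p f)"
    by (rule smooth_map_euclid_subset) simp
  with W show "\<exists>W. open W \<and> p1 \<in> W \<and>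
      smooth_map total_space euclid (proj -` V0 \<inter> W) (\<lambda>p. horizontal \<kappa> \<sigma> s X p f)" by blast
qed

end

end

section \<open>Derivations of the equivariant functions\<close>

lemma right_invariant_fieldsD:
  assumes "X \<in> right_invariant_fields P"
  shows "X \<in> vector_fields (bundle_space P)"
    "g \<in> SL \<Longrightarrow> f \<in> smooth_functions (bundle_space P) \<Longrightarrow> X (bundle_act P p g) f = X p (\<lambda>q. f (bundle_act P q g))"
proof -
  show "X \<in> vector_fields (bundle_space P)" using assms by (simp add: right_invariant_fields_def)
  assume "g \<in> SL" "f \<in> smooth_functions (bundle_space P)"
  with assms have "differential (bundle_space P) (\<lambda>q. bundle_act P q g) (X p) = X (bundle_act P p g)"
    by (simp add: right_invariant_fields_def)
  from fun_cong[OF this, of f] \<open>f \<in> smooth_functions (bundle_space P)\<close>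
  show "X (bundle_act P p g) f = X p (\<lambda>q. f (bundle_act P q g))"
    by (simp add: differential_def comp_def)
qed

context SL_bundle
begin

lemma act_push_tangent:
  assumes "v \<in> tangent_space total_space p" "g \<in> SL"
  shows "differential total_space (\<lambda>q. act q g) v \<in> tangent_space total_space (act p g)"
proof (rule tangent_spaceI)
  fix f h :: "'p \<Rightarrow> real" and a b
  assume f: "f \<in> smooth_functions total_space" "h \<in> smooth_functions total_space"
  note fg = smooth_functions_act[OF f(1) assms(2)] smooth_functions_act[OF f(2) assms(2)]
  show "differential total_space (\<lambda>q. act q g) v (\<lambda>x. a * f x + b * h x)
      = a * differential total_space (\<lambda>q. act q g) v f + b * differential total_space (\<lambda>q. act q g) v h"
    using tangent_lincomb[OF assms(1) fg] f
    by (simp add: differential_def comp_def smooth_functions_add smooth_functions_mult smooth_functions_const)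
  show "differential total_space (\<lambda>q. act q g) v (\<lambda>x. f x * h x)
      = f (act p g) * differential total_space (\<lambda>q. act q g) v h
        + h (act p g) * differential total_space (\<lambda>q. act q g) v f"
    using tangent_mult[OF assms(1) fg] f
    by (simp add: differential_def comp_def smooth_functions_mult)
qed (simp add: differential_def)

lemma tderiv_act_push:
  assumes "T \<in> smooth_functions total_space"
  shows "tderiv (differential total_space (\<lambda>q. act q g) v) T = tderiv v (\<lambda>q. T (act q g))"
  by (simp add: tderiv_def differential_def comp_def smooth_functions_inner[OF assms])

lemma equivariant_act:
  assumes "T \<in> equivariant" "g \<in> SL"
  shows "T (act p g) = adjugate g ** T p ** g"
proof -
  have "adjugate g ** (g ** T (act p g)) = adjugate g ** (T p ** g)"
    using equivariantD(2)[OF assms(1,2)] by simp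
  then show ?thesis
    by (simp add: matrix_mul_assoc adjugate_SL(2)[OF assms(2)])
qed

lemma tderiv_equivariant_act:
  assumes "v \<in> tangent_space total_space p" "T \<in> equivariant" "g \<in> SL"
  shows "tderiv v (\<lambda>q. T (act q g)) = adjugate g ** tderiv v T ** g"
proof -
  have "bounded_linear (\<lambda>A :: complex^'n^'n. adjugate g ** A ** g)"
    by (rule bounded_linear_compose[OF bounded_bilinear.bounded_linear_left[OF bounded_bilinear_matrix_mult]
          bounded_bilinear.bounded_linear_right[OF bounded_bilinear_matrix_mult]])
  from tderiv_linear[OF smooth_total assms(1) this equivariantD(1)[OF assms(2)]]
  show ?thesis by (simp add: equivariant_act[OF assms(2,3)])
qed

section \<open>From a derivation of the equivariant functions to an invariant field\<close>

context
  fixes d :: "('p \<Rightarrow> complex^'n^'n) \<Rightarrow> 'p \<Rightarrow> complex^'n^'n" and X :: "'m vfield"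
  assumes X: "X \<in> vector_fields M"
    and d_equivariant: "\<And>T. T \<in> equivariant \<Longrightarrow> d T \<in> equivariant"
    and d_add: "\<And>S T p. S \<in> equivariant \<Longrightarrow> T \<in> equivariant \<Longrightarrow> d (\<lambda>p. S p + T p) p = d S p + d T p"
    and d_mult: "\<And>S T p. S \<in> equivariant \<Longrightarrow> T \<in> equivariant \<Longrightarrow>
      d (\<lambda>p. S p ** T p) p = d S p ** T p + S p ** d T p"
    and d_mat: "\<And>f p. f \<in> smooth_functions M \<Longrightarrow>
      d (\<lambda>p. mat (f (proj p))) p = mat (tderiv (X (proj p)) f)"
begin

private lemma d_zero: "d (\<lambda>p. 0) p = 0"
  using d_add[OF equivariant_zero equivariant_zero, of p] by simp

private lemma d_sum:
  "(\<And>i. i \<in> I \<Longrightarrow> T i \<in> equivariant) \<Longrightarrow> d (\<lambda>p. \<Sum>i\<in>I. T i p) p = (\<Sum>i\<in>I. d (T i) p)"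
  by (induction I rule: infinite_finite_induct) (simp_all add: d_zero d_add equivariant_sum)

private lemma d_scale:
  assumes "f \<in> smooth_functions M" "T \<in> equivariant"
  shows "d (\<lambda>p. mat (f (proj p)) ** T p) p
    = mat (tderiv (X (proj p)) f) ** T p + mat (f (proj p)) ** d T p"
  using d_mult[OF equivariant_mat[OF assms(1)] assms(2)] d_mat[OF assms(1)] by simp

private lemma of_real_smooth: "\<kappa> \<in> smooth_functions M \<Longrightarrow> (\<lambda>x. complex_of_real (\<kappa> x)) \<in> smooth_functions M"
  by (rule smooth_functions_linear[OF bounded_linear_of_real])

private lemma tderiv_locally_one:
  assumes "\<kappa> \<in> smooth_functions M" "open V" "x \<in> V" "\<And>y. y \<in> V \<Longrightarrow> \<kappa> y = (1::real)"
  shows "tderiv (X x) (\<lambda>x. complex_of_real (\<kappa> x)) = 0"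
proof -
  have "tderiv (X x) (\<lambda>x. complex_of_real (\<kappa> x)) = tderiv (X x) (\<lambda>x. 1)"
    by (rule tderiv_local[OF smooth_base vector_fieldsD(1)[OF X] of_real_smooth[OF assms(1)]
          smooth_functions_const assms(2,3)]) (simp add: assms(4))
  then show ?thesis by (simp add: tderiv_const[OF smooth_base vector_fieldsD(1)[OF X]])
qed

text \<open>G comes from the images of the cut-off matrix units \<open>e i j\<close>, by
  \<open>derivation_of_matrix_units_inner\<close> at each point over V0. Near p, a general T is a
  combination of these units with coefficients from the base; the Leibniz rule splits d T into X on
  the coefficients and the commutator with G on the units.\<close>

lemma derivation_local_form:
  obtains U \<sigma> s \<kappa> K V0 G where "local_triv U \<sigma> s" "\<kappa> \<in> smooth_functions M" "closed K" "K \<subseteq> U"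
    "\<And>x. x \<notin> K \<Longrightarrow> \<kappa> x = (0::real)" "open V0" "V0 \<subseteq> K" "\<And>x. x \<in> V0 \<Longrightarrow> \<kappa> x = 1" "x0 \<in> V0"
    "G \<in> equivariant" "\<And>p. proj p \<in> V0 \<Longrightarrow> trace (G p) = 0"
    "\<And>p T. proj p \<in> V0 \<Longrightarrow> T \<in> equivariant \<Longrightarrow>
      d T p = tderiv (X (proj p)) (\<lambda>x. \<kappa> x *\<^sub>R T (s x (\<sigma> p))) + G p ** T p - T p ** G p"
proof -
  interpret mm: bounded_bilinear "(**) :: complex^'n^'n \<Rightarrow> complex^'n^'n \<Rightarrow> complex^'n^'n"
    by (rule bounded_bilinear_matrix_mult)
  obtain U \<sigma> s where U: "x0 \<in> U" and triv: "local_triv U \<sigma> s"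
    using local_triv_exists by blast
  note tr = local_trivD[OF triv]
  obtain \<kappa> :: "'m \<Rightarrow> real" and V0 K where \<kappa>: "\<kappa> \<in> smooth_functions M" "open V0" "x0 \<in> V0" "V0 \<subseteq> K"
    "closed K" "K \<subseteq> U" "\<And>y. y \<in> V0 \<Longrightarrow> \<kappa> y = 1" "\<And>y. y \<notin> K \<Longrightarrow> \<kappa> y = 0"
    using manifold_bump[OF smooth_base tr(1) U] by blast
  have subU: "x \<in> U" if "x \<in> V0" for x using that \<kappa>(4,6) by auto
  define e where "e i j p = adjugate (\<sigma> p) ** (\<kappa> (proj p) *\<^sub>R unit_matrix i j 1) ** \<sigma> p" for i j p
  have e: "e i j \<in> equivariant" for i j
    unfolding e_def
  proof (rule equivariant_extension[OF triv _ \<kappa>(5,6)])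
    show "smooth_map M euclid U (\<lambda>x. \<kappa> x *\<^sub>R unit_matrix i j 1)"
      by (rule smooth_functions_restrict[OF smooth_functions_linear[OF bounded_linear_scaleR_left \<kappa>(1)]])
  qed (simp add: \<kappa>(8))
  define G where "G p = (1 / CARD('n)) *\<^sub>R (\<Sum>i\<in>UNIV. \<Sum>j\<in>UNIV. d (e i j) p ** e j i p)" for p
  have G: "G \<in> equivariant"
    unfolding G_def mat_of_real[symmetric]
    by (intro equivariant_mult equivariant_mat[of "\<lambda>_. complex_of_real (1 / CARD('n))"]
        smooth_functions_const equivariant_sum d_equivariant e)
  have conj: "(adjugate (\<sigma> p) ** A ** \<sigma> p) ** (adjugate (\<sigma> p) ** A' ** \<sigma> p)
      = adjugate (\<sigma> p) ** (A ** A') ** \<sigma> p" if "proj p \<in> U" for p A A'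
  proof -
    have "(adjugate (\<sigma> p) ** A ** \<sigma> p) ** (adjugate (\<sigma> p) ** A' ** \<sigma> p)
        = adjugate (\<sigma> p) ** A ** (\<sigma> p ** adjugate (\<sigma> p)) ** A' ** \<sigma> p"
      by (simp only: matrix_mul_assoc)
    then show ?thesis
      by (simp add: adjugate_SL(1)[OF tr(2)[OF that]] matrix_mul_assoc)
  qed
  \<comment> \<open>As d acts on global functions, the relation is wanted at every p. A product of
    two cut-off units has one cutoff factor too many, which is kept as a scalar.\<close>
  have ee: "e i j p ** e k l p = (if j = k then mat (complex_of_real (\<kappa> (proj p))) ** e i l p else 0)"
    for i j k l p
  proof (cases "proj p \<in> U")
    case True
    then show ?thesis
      unfolding e_def mat_of_real
      by (simp add: conj mm.scaleR_left mm.scaleR_right unit_matrix_mult mm.zero_left mm.zero_right)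
  next
    case False
    then have "\<kappa> (proj p) = 0" using \<kappa>(6,8) by auto
    then have "e i j p = 0" for i j
      by (simp add: e_def mm.zero_left mm.zero_right)
    then show ?thesis by (simp add: mm.zero_left mm.zero_right)
  qed
  have inner: "G p ** e k l p - e k l p ** G p = d (e k l) p" "trace (G p) = 0"
    if p: "proj p \<in> V0" for p k l
  proof -
    have \<kappa>p: "\<kappa> (proj p) = 1" using \<kappa>(7) p by simp
    have mult: "e i j p ** e k l p = (if j = k then e i l p else 0)" for i j k l
      by (simp add: ee \<kappa>p)
    have "(\<Sum>i\<in>UNIV. e i i p) = adjugate (\<sigma> p) ** (\<Sum>i\<in>UNIV. unit_matrix i i 1) ** \<sigma> p"
      by (simp add: e_def \<kappa>p mm.sum_left mm.sum_right)
    then have one: "(\<Sum>i\<in>UNIV. e i i p) = mat 1"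
      by (simp add: sum_unit_matrix_diagonal adjugate_SL(2)[OF tr(2)[OF subU[OF p]]])
    have der: "d (e i j) p ** e k l p + e i j p ** d (e k l) p = (if j = k then d (e i l) p else 0)"
      for i j k l
    proof -
      have "d (e i j) p ** e k l p + e i j p ** d (e k l) p = d (\<lambda>p. e i j p ** e k l p) p"
        by (rule d_mult[OF e e, symmetric])
      \<comment> \<open>Over V0 the surplus cutoff factor is locally 1, so X annihilates it and the
        derivative of the product is that of the unit alone.\<close>
      also have "\<dots> = (if j = k then d (e i l) p else 0)"
        using d_scale[OF of_real_smooth[OF \<kappa>(1)] e, of i l p] tderiv_locally_one[OF \<kappa>(1,2) p \<kappa>(7)]
        by (simp add: ee d_zero \<kappa>p mm.zero_left)
      finally show ?thesis .
    qed
    from derivation_of_matrix_units_inner[OF mult one der G_def]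
    show "G p ** e k l p - e k l p ** G p = d (e k l) p" "trace (G p) = 0" .
  qed
  have form: "d T p = tderiv (X (proj p)) (\<lambda>x. \<kappa> x *\<^sub>R T (s x (\<sigma> p))) + G p ** T p - T p ** G p"
    if p: "proj p \<in> V0" and T: "T \<in> equivariant" for p T
  proof -
    define x where "x = proj p"
    have Xx: "X x \<in> tangent_space M x" by (rule vector_fieldsD(1)[OF X])
    have \<sigma>p: "\<sigma> p \<in> SL" using tr(2) subU p by auto
    \<comment> \<open>A second cutoff, supported where \<kappa> is 1, makes \<kappa>2 T equal at
      every point of P to a combination of the cut-off units, so d may be applied to this
      identity.\<close>
    obtain \<kappa>2 :: "'m \<Rightarrow> real" and V2 K2 where \<kappa>2: "\<kappa>2 \<in> smooth_functions M" "open V2" "x \<in> V2" "V2 \<subseteq> K2"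
      "closed K2" "K2 \<subseteq> V0" "\<And>y. y \<in> V2 \<Longrightarrow> \<kappa>2 y = 1" "\<And>y. y \<notin> K2 \<Longrightarrow> \<kappa>2 y = 0"
      using manifold_bump[OF smooth_base \<kappa>(2), of x] p by (auto simp: x_def)
    \<comment> \<open>The matrix of the cut-off T along the section z |-> s z 1; conjugation by
      \<sigma> recovers it on the rest of each fibre.\<close>
    define A where "A z = \<kappa>2 z *\<^sub>R T (s z (mat 1))" for z
    have A: "A \<in> smooth_functions M"
      unfolding A_def
      by (rule smooth_functions_cutoff_slice[OF triv \<kappa>2(1,5) _ \<kappa>2(8) equivariantD(1)[OF T] SL_one])
         (use \<kappa>2(6) subU in auto)
    have Aij: "(\<lambda>z. A z $ i $ j) \<in> smooth_functions M" for i j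
      by (rule smooth_functions_linear[OF bounded_linear_matrix_entry A])
    have expand: "mat (complex_of_real (\<kappa>2 (proj q))) ** T q
        = (\<Sum>i\<in>UNIV. \<Sum>j\<in>UNIV. mat (A (proj q) $ i $ j) ** e i j q)" for q
    proof (cases "proj q \<in> V0")
      case True
      have "mat (A (proj q) $ i $ j) ** e i j q
          = adjugate (\<sigma> q) ** unit_matrix i j (A (proj q) $ i $ j) ** \<sigma> q" for i j
        using \<kappa>(7)[OF True]
        by (simp add: e_def matrix_mul_assoc mat_commute[of _ "adjugate (\<sigma> q)"])
           (simp add: matrix_mul_assoc[symmetric] mat_unit_matrix[of "A (proj q) $ i $ j" i j 1, simplified, symmetric])
      then have "(\<Sum>i\<in>UNIV. \<Sum>j\<in>UNIV. mat (A (proj q) $ i $ j) ** e i j q)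
          = adjugate (\<sigma> q) ** A (proj q) ** \<sigma> q"
        by (subst (3) matrix_unit_decomposition) (simp add: mm.sum_left mm.sum_right)
      also have "\<dots> = \<kappa>2 (proj q) *\<^sub>R T q"
        using equivariant_section[OF triv subU[OF True] tr(2)[OF subU[OF True]] T]
          tr(3)[OF subU[OF True]]
        by (simp add: A_def mm.scaleR_left mm.scaleR_right)
      finally show ?thesis by (simp add: mat_of_real)
    next
      case False
      then have "\<kappa>2 (proj q) = 0" using \<kappa>2(6,8) by auto
      then show ?thesis by (simp add: A_def mm.zero_left)
    qed
    have \<kappa>2x: "\<kappa>2 x = 1" using \<kappa>2(3,7) by simp
    have "d (\<lambda>q. mat (complex_of_real (\<kappa>2 (proj q))) ** T q) p = d T p"
      using d_scale[OF of_real_smooth[OF \<kappa>2(1)] T, of p] tderiv_locally_one[OF \<kappa>2(1-3,7)] \<kappa>2x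
      by (simp add: x_def[symmetric] mm.zero_left)
    moreover have "d (\<lambda>q. mat (complex_of_real (\<kappa>2 (proj q))) ** T q) p
        = (\<Sum>i\<in>UNIV. \<Sum>j\<in>UNIV. d (\<lambda>q. mat (A (proj q) $ i $ j) ** e i j q) p)"
      by (simp add: expand d_sum equivariant_sum equivariant_mult[OF equivariant_mat[OF Aij] e])
    ultimately have "d T p = (\<Sum>i\<in>UNIV. \<Sum>j\<in>UNIV. mat (tderiv (X x) (\<lambda>z. A z $ i $ j)) ** e i j p
        + mat (A x $ i $ j) ** d (e i j) p)"
      by (simp add: d_scale[OF Aij e] x_def)
    also have "\<dots> = (\<Sum>i\<in>UNIV. \<Sum>j\<in>UNIV. mat (tderiv (X x) (\<lambda>z. A z $ i $ j)) ** e i j p)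
        + (\<Sum>i\<in>UNIV. \<Sum>j\<in>UNIV. mat (A x $ i $ j) ** d (e i j) p)"
      by (simp add: sum.distrib)
    also have "(\<Sum>i\<in>UNIV. \<Sum>j\<in>UNIV. mat (A x $ i $ j) ** d (e i j) p)
        = (\<Sum>i\<in>UNIV. \<Sum>j\<in>UNIV. G p ** (mat (A x $ i $ j) ** e i j p) - (mat (A x $ i $ j) ** e i j p) ** G p)"
    proof (intro sum.cong refl)
      fix i j :: 'n
      have "mat (A x $ i $ j) ** (G p ** e i j p) = G p ** (mat (A x $ i $ j) ** e i j p)"
        by (simp add: matrix_mul_assoc mat_commute[of _ "G p"])
      then show "mat (A x $ i $ j) ** d (e i j) p
          = G p ** (mat (A x $ i $ j) ** e i j p) - (mat (A x $ i $ j) ** e i j p) ** G p"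
        unfolding inner(1)[OF p, of i j, symmetric] mm.diff_right by (simp add: matrix_mul_assoc)
    qed
    also have "\<dots> = G p ** (\<Sum>i\<in>UNIV. \<Sum>j\<in>UNIV. mat (A x $ i $ j) ** e i j p)
        - (\<Sum>i\<in>UNIV. \<Sum>j\<in>UNIV. mat (A x $ i $ j) ** e i j p) ** G p"
      by (simp add: sum_subtractf mm.sum_left mm.sum_right)
    also have "(\<Sum>i\<in>UNIV. \<Sum>j\<in>UNIV. mat (A x $ i $ j) ** e i j p) = T p"
      using expand[of p] \<kappa>2x by (simp add: x_def)
    also have "(\<Sum>i\<in>UNIV. \<Sum>j\<in>UNIV. mat (tderiv (X x) (\<lambda>z. A z $ i $ j)) ** e i j p)
        = adjugate (\<sigma> p) ** tderiv (X x) A ** \<sigma> p"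
    proof -
      have "mat (tderiv (X x) (\<lambda>z. A z $ i $ j)) ** e i j p
          = adjugate (\<sigma> p) ** unit_matrix i j (tderiv (X x) A $ i $ j) ** \<sigma> p" for i j
        using \<kappa>(7)[OF p] tderiv_linear[OF smooth_base Xx bounded_linear_matrix_entry A, of i j]
        by (simp add: e_def matrix_mul_assoc mat_commute[of _ "adjugate (\<sigma> p)"])
           (simp add: matrix_mul_assoc[symmetric] mat_unit_matrix[of "tderiv (X x) A $ i $ j" i j 1, simplified, symmetric])
      then show ?thesis
        by (subst (3) matrix_unit_decomposition) (simp add: mm.sum_left mm.sum_right)
    qed
    also have "adjugate (\<sigma> p) ** tderiv (X x) A ** \<sigma> p
        = tderiv (X x) (\<lambda>z. adjugate (\<sigma> p) ** A z ** \<sigma> p)"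
      by (rule tderiv_linear[OF smooth_base Xx _ A, symmetric])
         (rule bounded_linear_compose[OF mm.bounded_linear_left mm.bounded_linear_right])
    also have "\<dots> = tderiv (X x) (\<lambda>z. \<kappa> z *\<^sub>R T (s z (\<sigma> p)))"
    proof (rule tderiv_local[OF smooth_base Xx])
      show "(\<lambda>z. adjugate (\<sigma> p) ** A z ** \<sigma> p) \<in> smooth_functions M"
        by (intro smooth_functions_matrix_mult smooth_functions_const A)
      show "(\<lambda>z. \<kappa> z *\<^sub>R T (s z (\<sigma> p))) \<in> smooth_functions M"
        by (rule smooth_functions_cutoff_slice[OF triv \<kappa>(1,5,6,8) equivariantD(1)[OF T] \<sigma>p])
      fix z assume z: "z \<in> V2"
      then have "z \<in> V0" using \<kappa>2(4,6) by auto
      with equivariant_section[OF triv subU[OF this] \<sigma>p T] \<kappa>(7) \<kappa>2(7)[OF z]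
      show "adjugate (\<sigma> p) ** A z ** \<sigma> p = \<kappa> z *\<^sub>R T (s z (\<sigma> p))"
        by (simp add: A_def)
    qed (use \<kappa>2 in auto)
    finally show ?thesis by (simp add: x_def algebra_simps)
  qed
  show ?thesis
    by (rule that[OF triv \<kappa>(1,5,6,8,2,4,7,3) G inner(2) form])
qed

lemma derivation_local_vector:
  obtains V0 Z where "open V0" "x0 \<in> V0"
    "\<And>p. proj p \<in> V0 \<Longrightarrow> Z p \<in> tangent_space total_space p"
    "\<And>p T. proj p \<in> V0 \<Longrightarrow> T \<in> equivariant \<Longrightarrow> tderiv (Z p) T = d T p"
    "\<And>f. f \<in> smooth_functions total_space \<Longrightarrow> smooth_map total_space euclid (proj -` V0) (\<lambda>p. Z p f)"
proof (rule derivation_local_form[where ?x0.0 = x0])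
  interpret mm: bounded_bilinear "(**) :: complex^'n^'n \<Rightarrow> complex^'n^'n \<Rightarrow> complex^'n^'n"
    by (rule bounded_bilinear_matrix_mult)
  fix U \<sigma> s \<kappa> K V0 G
  assume triv: "local_triv U \<sigma> s" and \<kappa>: "\<kappa> \<in> smooth_functions M"
    and K: "closed K" "K \<subseteq> U" "\<And>x. x \<notin> K \<Longrightarrow> \<kappa> x = (0::real)"
    and V0: "open V0" "V0 \<subseteq> K" "\<And>x. x \<in> V0 \<Longrightarrow> \<kappa> x = 1" and x0: "x0 \<in> V0"
    and G: "G \<in> equivariant" "\<And>p. proj p \<in> V0 \<Longrightarrow> trace (G p) = 0"
    and form: "\<And>p T. proj p \<in> V0 \<Longrightarrow> T \<in> equivariant \<Longrightarrow>
      d T p = tderiv (X (proj p)) (\<lambda>x. \<kappa> x *\<^sub>R T (s x (\<sigma> p))) + G p ** T p - T p ** G p"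
  obtain B :: "(complex^'n^'n) set" and g where B: "finite B" "B \<subseteq> affine_SL_directions"
    "\<And>N. bounded_linear (g N)" "\<And>K. trace K = 0 \<Longrightarrow> K = (\<Sum>N\<in>B. g N K *\<^sub>R N)"
    using traceless_decomposition by blast
  \<comment> \<open>The sign: \<open>vertical N\<close> acts on T as T N - N T, so it is the
    components of -G that produce G T - T G.\<close>
  define Z where "Z p = (\<lambda>f. horizontal \<kappa> \<sigma> s X p f + (\<Sum>N\<in>B. (- g N (G p)) * vertical N p f))" for p
  have BN: "N \<in> affine_SL_directions" if "N \<in> B" for N using that B(2) by auto
  show ?thesis
  proof (rule that[OF V0(1) x0])
    fix p assume p: "proj p \<in> V0"
    show "Z p \<in> tangent_space total_space p"
      unfolding Z_def
      by (intro tangent_space_sum horizontal_tangent[OF triv \<kappa> K V0 X p] vertical_tangent BN)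
    fix T assume T: "T \<in> equivariant"
    have "(\<Sum>N\<in>B. (- g N (G p)) *\<^sub>R tderiv (vertical N p) T)
        = (\<Sum>N\<in>B. (g N (G p) *\<^sub>R N) ** T p - T p ** (g N (G p) *\<^sub>R N))"
      by (intro sum.cong refl)
         (simp add: vertical_equivariant[OF BN T] mm.scaleR_left mm.scaleR_right scaleR_diff_right)
    also have "\<dots> = G p ** T p - T p ** G p"
      by (subst (3 4) B(4)[OF G(2)[OF p]]) (simp add: sum_subtractf mm.sum_left mm.sum_right)
    finally show "tderiv (Z p) T = d T p"
      unfolding Z_def tderiv_vector_sum form[OF p T]
      by (simp add: tderiv_horizontal[OF triv \<kappa> K V0 X equivariantD(1)[OF T]])
  next
    fix f :: "'p \<Rightarrow> real" assume f: "f \<in> smooth_functions total_space"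
    have "smooth_map total_space euclid (proj -` V0) (\<lambda>p. vertical N p f)" if "N \<in> B" for N
      using smooth_functions_restrict[OF curve_derivative_smooth[OF BN[OF that] f]] f
      by (simp add: vertical_def)
    then show "smooth_map total_space euclid (proj -` V0) (\<lambda>p. Z p f)"
      unfolding Z_def
      by (intro smooth_map_add smooth_map_sum horizontal_smooth[OF triv \<kappa> K V0 X f]
          smooth_map_bilinear[OF bounded_bilinear_mult]
          smooth_map_linear_compose[OF bounded_linear_minus[OF bounded_linear_ident]]
          smooth_map_linear_compose[OF B(3)] smooth_functions_restrict[OF equivariantD(1)[OF G(1)]])
  qed
qed

lemma derivation_lift:
  obtains Y where "Y \<in> right_invariant_fields P"
    "\<And>T p. T \<in> equivariant \<Longrightarrow> d T p = tderiv (Y p) T"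
proof -
  \<comment> \<open>The vector is characterized by its action on equivariant functions and not
    through a trivialization, so the local solutions Z all coincide with Y where they are defined,
    and Y inherits their smoothness.\<close>
  define good where "good p v \<longleftrightarrow> v \<in> tangent_space total_space p \<and> (\<forall>T\<in>equivariant. tderiv v T = d T p)" for p v
  have uniq: "v = w" if "good p v" "good p w" for p v w
    using that unfolding good_def by (auto intro: tangent_eqI)
  define Y where "Y p = (THE v. good p v)" for p
  have Y_eq: "Y p = v" if "good p v" for p v
    unfolding Y_def using that uniq by (intro the_equality) auto
  have good_Z: "\<exists>V0 Z. open V0 \<and> x0 \<in> V0 \<and> (\<forall>p\<in>proj -` V0. good p (Z p)) \<and>
      (\<forall>f\<in>smooth_functions total_space. smooth_map total_space euclid (proj -` V0) (\<lambda>p. Z p f))" for x0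
  proof (rule derivation_local_vector[where ?x0.0 = x0])
    fix V0 Z
    assume "open V0" "x0 \<in> V0"
      "\<And>p. proj p \<in> V0 \<Longrightarrow> Z p \<in> tangent_space total_space p"
      "\<And>p T. proj p \<in> V0 \<Longrightarrow> T \<in> equivariant \<Longrightarrow> tderiv (Z p) T = d T p"
      "\<And>f. f \<in> smooth_functions total_space \<Longrightarrow> smooth_map total_space euclid (proj -` V0) (\<lambda>p. Z p f)"
    then show ?thesis
      by (intro exI[of _ V0] exI[of _ Z]) (auto simp: good_def)
  qed
  have good_Y: "good p (Y p)" for p
    using good_Z[of "proj p"] Y_eq by fastforce
  have "Y \<in> vector_fields total_space"
    unfolding vector_fields_def
  proof (intro CollectI conjI allI ballI)
    show "Y p \<in> tangent_space total_space p" for p using good_Y by (simp add: good_def)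
    fix f :: "'p \<Rightarrow> real" assume f: "f \<in> smooth_functions total_space"
    show "(\<lambda>p. Y p f) \<in> smooth_functions total_space"
      unfolding smooth_functions_iff
    proof (rule smooth_map_local[OF total_atlas])
      fix p
      obtain V0 Z where Z: "open V0" "proj p \<in> V0" "\<forall>p\<in>proj -` V0. good p (Z p)"
        "smooth_map total_space euclid (proj -` V0) (\<lambda>p. Z p f)"
        using good_Z[of "proj p"] f by blast
      have "smooth_map total_space euclid (proj -` V0) (\<lambda>p. Y p f)"
      proof (rule smooth_map_euclid_cong[OF total_atlas Z(4)])
        fix r assume "r \<in> proj -` V0"
        with Z(3) have "good r (Z r)" by blast
        from Y_eq[OF this] show "Z r f = Y r f" by simp
      qed
      then show "\<exists>V. open V \<and> p \<in> V \<and> smooth_map total_space euclid (UNIV \<inter> V) (\<lambda>p. Y p f)"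
        using Z(1,2) open_proj_vimage by (intro exI[of _ "proj -` V0"]) auto
    qed
  qed
  \<comment> \<open>Pushing \<open>Y p\<close> by g gives a solution at p g, because d T is
    equivariant along with T; uniqueness identifies it with Y there.\<close>
  moreover have "differential total_space (\<lambda>q. act q g) (Y p) = Y (act p g)" if g: "g \<in> SL" for p g
  proof (rule Y_eq[symmetric])
    have Yp: "Y p \<in> tangent_space total_space p" using good_Y by (simp add: good_def)
    show "good (act p g) (differential total_space (\<lambda>q. act q g) (Y p))"
      unfolding good_def
    proof (intro conjI ballI act_push_tangent[OF Yp g])
      fix T assume T: "T \<in> equivariant"
      have "tderiv (Y p) (\<lambda>q. T (act q g)) = adjugate g ** tderiv (Y p) T ** g"
        by (rule tderiv_equivariant_act[OF Yp T g])
      also have "\<dots> = d T (act p g)"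
        using equivariant_act[OF d_equivariant[OF T] g] good_Y T by (simp add: good_def)
      finally show "tderiv (differential total_space (\<lambda>q. act q g) (Y p)) T = d T (act p g)"
        by (simp add: tderiv_act_push[OF equivariantD(1)[OF T]])
    qed
  qed
  ultimately have "Y \<in> right_invariant_fields P"
    by (simp add: right_invariant_fields_def)
  with good_Y show ?thesis
    by (intro that[of Y]) (auto simp: good_def)
qed

end

end

section \<open>Invariant vector fields\<close>

text \<open>Non-smooth arguments take care of themselves: \<open>differential\<close> is 0 on them
  by definition, and tangent vectors vanish there.\<close>

lemma right_invariant_fieldsI:
  assumes "X \<in> vector_fields (bundle_space P)"
    "\<And>g p f. g \<in> SL \<Longrightarrow> f \<in> smooth_functions (bundle_space P) \<Longrightarrow>
      X (bundle_act P p g) f = X p (\<lambda>q. f (bundle_act P q g))"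
  shows "X \<in> right_invariant_fields P"
  unfolding right_invariant_fields_def mem_Collect_eq
proof (intro conjI ballI allI ext)
  fix g p f assume g: "g \<in> (SL :: (complex^'d^'d) set)"
  show "differential (bundle_space P) (\<lambda>q. bundle_act P q g) (X p) f = X (bundle_act P p g) f"
    using assms(2)[OF g] tangent_nonsmooth[OF vector_fieldsD(1)[OF assms(1)]]
    by (simp add: differential_def comp_def)
qed (rule assms(1))

lemma vf_bracket_vector_field:
  assumes X: "X \<in> vector_fields M" and Y: "Y \<in> vector_fields M"
  shows "vf_bracket X Y \<in> vector_fields M"
  unfolding vector_fields_def
proof (intro CollectI conjI allI ballI tangent_spaceI)
  fix f g :: "'a \<Rightarrow> real" and a b p
  assume f: "f \<in> smooth_functions M" and g: "g \<in> smooth_functions M"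
  note XT = vector_fieldsD(1)[OF X] and YT = vector_fieldsD(1)[OF Y]
  note Xs = vector_fieldsD(2)[OF X f] vector_fieldsD(2)[OF X g]
  note Ys = vector_fieldsD(2)[OF Y f] vector_fieldsD(2)[OF Y g]
  have "(\<lambda>q. Y q (\<lambda>x. a * f x + b * g x)) = (\<lambda>q. a * Y q f + b * Y q g)"
    "(\<lambda>q. X q (\<lambda>x. a * f x + b * g x)) = (\<lambda>q. a * X q f + b * X q g)"
    using tangent_lincomb[OF YT f g] tangent_lincomb[OF XT f g] by auto
  then show "vf_bracket X Y p (\<lambda>x. a * f x + b * g x) = a * vf_bracket X Y p f + b * vf_bracket X Y p g"
    using tangent_lincomb[OF XT Ys, of p a b] tangent_lincomb[OF YT Xs, of p a b]
    by (simp add: vf_bracket_def algebra_simps)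
  have "(\<lambda>q. Y q (\<lambda>x. f x * g x)) = (\<lambda>q. f q * Y q g + g q * Y q f)"
    "(\<lambda>q. X q (\<lambda>x. f x * g x)) = (\<lambda>q. f q * X q g + g q * X q f)"
    using tangent_mult[OF YT f g] tangent_mult[OF XT f g] by auto
  then show "vf_bracket X Y p (\<lambda>x. f x * g x) = f p * vf_bracket X Y p g + g p * vf_bracket X Y p f"
    using tangent_add[OF XT smooth_functions_mult[OF f Ys(2)] smooth_functions_mult[OF g Ys(1)], of p]
      tangent_add[OF YT smooth_functions_mult[OF f Xs(2)] smooth_functions_mult[OF g Xs(1)], of p]
      tangent_mult[OF XT f Ys(2), of p] tangent_mult[OF XT g Ys(1), of p]
      tangent_mult[OF YT f Xs(2), of p] tangent_mult[OF YT g Xs(1), of p]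
    by (simp add: vf_bracket_def algebra_simps)
next
  \<comment> \<open>Here the inner functions q |-> Y q f and q |-> X q f are constantly 0, and
    tangent vectors kill constants.\<close>
  fix f :: "'a \<Rightarrow> real" and p assume "f \<notin> smooth_functions M"
  then show "vf_bracket X Y p f = 0"
    by (simp add: vf_bracket_def tangent_nonsmooth[OF vector_fieldsD(1)[OF X]]
        tangent_nonsmooth[OF vector_fieldsD(1)[OF Y]] tangent_const[OF vector_fieldsD(1)[OF X]]
        tangent_const[OF vector_fieldsD(1)[OF Y]])
next
  fix f :: "'a \<Rightarrow> real" assume f: "f \<in> smooth_functions M"
  have "(\<lambda>p. X p (\<lambda>q. Y q f) + (- 1) * Y p (\<lambda>q. X q f)) \<in> smooth_functions M"
    by (intro smooth_functions_add smooth_functions_mult smooth_functions_const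
        vector_fieldsD(2)[OF X] vector_fieldsD(2)[OF Y] f)
  then show "(\<lambda>p. vf_bracket X Y p f) \<in> smooth_functions M"
    by (simp add: vf_bracket_def)
qed

lemma vf_bracket_right_invariant:
  assumes X: "X \<in> right_invariant_fields P" and Y: "Y \<in> right_invariant_fields P"
  shows "vf_bracket X Y \<in> right_invariant_fields P"
proof (rule right_invariant_fieldsI)
  note XD = right_invariant_fieldsD[OF X] and YD = right_invariant_fieldsD[OF Y]
  show "vf_bracket X Y \<in> vector_fields (bundle_space P)"
    by (rule vf_bracket_vector_field[OF XD(1) YD(1)])
  fix g p and f :: "_ \<Rightarrow> real"
  assume g: "g \<in> (SL :: (complex^'d^'d) set)" and f: "f \<in> smooth_functions (bundle_space P)"
  show "vf_bracket X Y (bundle_act P p g) f = vf_bracket X Y p (\<lambda>q. f (bundle_act P q g))"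
    using XD(2)[OF g vector_fieldsD(2)[OF YD(1) f]] YD(2)[OF g vector_fieldsD(2)[OF XD(1) f]]
    by (simp add: vf_bracket_def XD(2)[OF g f] YD(2)[OF g f])
qed

lemma vf_add_right_invariant:
  assumes X: "X \<in> right_invariant_fields P" and Y: "Y \<in> right_invariant_fields P"
  shows "vf_add X Y \<in> right_invariant_fields P"
proof (rule right_invariant_fieldsI)
  note XD = right_invariant_fieldsD[OF X] and YD = right_invariant_fieldsD[OF Y]
  show "vf_add X Y \<in> vector_fields (bundle_space P)"
    using tangent_space_combination[OF vector_fieldsD(1)[OF XD(1)] vector_fieldsD(1)[OF YD(1)], of _ 1]
      smooth_functions_add[OF vector_fieldsD(2)[OF XD(1)] vector_fieldsD(2)[OF YD(1)]]
    by (simp add: vector_fields_def vf_add_def)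
qed (simp add: vf_add_def right_invariant_fieldsD(2)[OF X] right_invariant_fieldsD(2)[OF Y])

lemma tderiv_vf_bracket:
  "tderiv (vf_bracket X Y p) T = tderiv (X p) (\<lambda>q. tderiv (Y q) T) - tderiv (Y p) (\<lambda>q. tderiv (X q) T)"
  by (rule euclidean_eqI) (simp add: tderiv_inner inner_diff_left vf_bracket_def)

context SL_bundle
begin

lemma scale_right_invariant:
  assumes X: "X \<in> right_invariant_fields P" and f: "f \<in> smooth_functions M"
  shows "(\<lambda>p h. f (proj p) * X p h) \<in> right_invariant_fields P"
proof (rule right_invariant_fieldsI)
  note XD = right_invariant_fieldsD[OF X]
  show "(\<lambda>p h. f (proj p) * X p h) \<in> vector_fields total_space"
    unfolding vector_fields_def
  proof (intro CollectI conjI allI ballI)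
    fix p
    have "(\<lambda>h. 0) \<in> tangent_space total_space p"
      by (rule tangent_spaceI) simp_all
    from tangent_space_combination[OF this vector_fieldsD(1)[OF XD(1)], of "f (proj p)"]
    show "(\<lambda>h. f (proj p) * X p h) \<in> tangent_space total_space p" by simp
  qed (intro smooth_functions_mult smooth_functions_pullback_proj[OF f] vector_fieldsD(2)[OF XD(1)])
qed (simp add: right_invariant_fieldsD(2)[OF X] proj_act)

text \<open>Invariance of X moves the derivative from p g to p, where T gets replaced by its
  translate; by equivariance this is the conjugate of T by a constant matrix, and conjugation
  commutes with the derivative.\<close>

lemma right_invariant_equivariant:
  assumes X: "X \<in> right_invariant_fields P" and T: "T \<in> equivariant"
  shows "(\<lambda>p. tderiv (X p) T) \<in> equivariant"
  unfolding equivariant_def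
proof (intro CollectI conjI allI ballI)
  note XD = right_invariant_fieldsD[OF X]
  show "(\<lambda>p. tderiv (X p) T) \<in> smooth_functions total_space"
    by (rule vector_field_tderiv_smooth[OF XD(1) equivariantD(1)[OF T]])
  fix p g assume g: "g \<in> (SL :: (complex^'n^'n) set)"
  have "tderiv (X (act p g)) T = tderiv (X p) (\<lambda>q. T (act q g))"
    by (simp add: tderiv_def XD(2)[OF g smooth_functions_inner[OF equivariantD(1)[OF T]]])
  also have "\<dots> = adjugate g ** tderiv (X p) T ** g"
    by (rule tderiv_equivariant_act[OF vector_fieldsD(1)[OF XD(1)] T g])
  finally show "g ** tderiv (X (act p g)) T = tderiv (X p) T ** g"
    by (simp add: matrix_mul_assoc adjugate_SL(1)[OF g])
qed

text \<open>Evaluation at an arbitrarily chosen point of the fibre. For an invariant field another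
  point p g gives the same value, as f o proj is unchanged by the action of g.\<close>

definition pushforward :: "'p vfield \<Rightarrow> 'm vfield" where
  "pushforward X x f = (if f \<in> smooth_functions M
     then X (SOME p. proj p = x) (\<lambda>q. f (proj q)) else 0)"

context
  fixes X assumes X: "X \<in> right_invariant_fields P"
begin

lemma pushforward_proj:
  assumes "f \<in> smooth_functions M"
  shows "pushforward X (proj p) f = X p (\<lambda>q. f (proj q))"
proof -
  define p' where "p' = (SOME p'. proj p' = proj p)"
  have "proj p' = proj p" unfolding p'_def by (rule someI_ex) auto
  then obtain g where g: "g \<in> SL" "p = act p' g" by (rule fiber_transitive)
  with right_invariant_fieldsD(2)[OF X g(1) smooth_functions_pullback_proj[OF assms], of p']
  have "X p (\<lambda>q. f (proj q)) = X p' (\<lambda>q. f (proj q))"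
    by (simp add: proj_act)
  with assms show ?thesis by (simp add: pushforward_def p'_def)
qed

lemma tderiv_pushforward:
  assumes "f \<in> smooth_functions M"
  shows "tderiv (pushforward X (proj p)) f = tderiv (X p) (\<lambda>q. f (proj q))"
  by (simp add: tderiv_def pushforward_proj[OF smooth_functions_inner[OF assms]])

lemma pushforward_vector_field: "pushforward X \<in> vector_fields M"
  unfolding vector_fields_def
proof (intro CollectI conjI allI ballI)
  note XD = right_invariant_fieldsD[OF X]
  fix x
  obtain p where p: "x = proj p" using proj_surj by metis
  note Xp = vector_fieldsD(1)[OF XD(1), of p]
  show "pushforward X x \<in> tangent_space M x"
  proof (rule tangent_spaceI)
    fix f g :: "'m \<Rightarrow> real" and a b
    assume f: "f \<in> smooth_functions M" and g: "g \<in> smooth_functions M"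
    note fg = smooth_functions_pullback_proj[OF f] smooth_functions_pullback_proj[OF g]
    have "(\<lambda>x. a * f x + b * g x) \<in> smooth_functions M"
      by (intro smooth_functions_add smooth_functions_mult smooth_functions_const f g)
    then show "pushforward X x (\<lambda>x. a * f x + b * g x) = a * pushforward X x f + b * pushforward X x g"
      using tangent_lincomb[OF Xp fg] by (simp add: p pushforward_proj f g)
    show "pushforward X x (\<lambda>x. f x * g x) = f x * pushforward X x g + g x * pushforward X x f"
      using tangent_mult[OF Xp fg] by (simp add: p pushforward_proj f g smooth_functions_mult)
  qed (simp add: pushforward_def)
next
  fix f :: "'m \<Rightarrow> real" assume f: "f \<in> smooth_functions M"
  have "smooth_map M euclid UNIV (\<lambda>x. pushforward X x f)"
  proof (rule smooth_map_descend[OF open_UNIV])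
    show "smooth_map total_space euclid (proj -` UNIV) (\<lambda>p. X p (\<lambda>q. f (proj q)))"
      using vector_fieldsD(2)[OF right_invariant_fieldsD(1)[OF X] smooth_functions_pullback_proj[OF f]]
      by (simp add: smooth_functions_iff)
  qed (rule pushforward_proj[OF f])
  then show "(\<lambda>x. pushforward X x f) \<in> smooth_functions M"
    by (simp add: smooth_functions_iff)
qed

text \<open>Since \<open>proj\<close> is onto, a field on the base is fixed by its values at the
  points \<open>proj p\<close>, so X projects to one field only and the \<open>THE\<close> in the
  anchor picks it.\<close>

lemma Atiyah_anchor: "la_anchor (Atiyah_algebroid M P) X = pushforward X"
proof -
  have "projects_to M P X Y \<longleftrightarrow> Y = pushforward X" for Y
  proof
    have push: "pushforward X (proj p) = differential M proj (X p)" for p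
      by (rule ext) (simp add: differential_def comp_def pushforward_proj, simp add: pushforward_def)
    then show "Y = pushforward X \<Longrightarrow> projects_to M P X Y"
      by (simp add: projects_to_def)
    assume "projects_to M P X Y"
    then have "Y (proj p) = pushforward X (proj p)" for p
      by (simp add: projects_to_def push)
    then show "Y = pushforward X"
      using proj_surj by (metis ext)
  qed
  then show ?thesis
    by (simp add: Atiyah_algebroid_def) (rule the_equality, simp_all add: pushforward_vector_field)
qed

end

end

section \<open>Endomorphism sections as equivariant functions\<close>

lemma mat_vector_mult: "mat c *v v = c *s (v :: complex^'n)"
  by (simp add: vec_eq_iff matrix_vector_mult_def mat_def if_distrib[of "\<lambda>x. x * _"] cong: if_cong)

lemma SL_matrix_vector:
  fixes g :: "complex^'n^'n::finite"
  assumes "g \<in> SL"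
  shows "adjugate g *v (g *v v) = v" "g *v (adjugate g *v v) = v" "bij ((*v) g)"
proof -
  show *: "adjugate g *v (g *v v) = v" "g *v (adjugate g *v v) = v" for v
    by (simp_all add: matrix_vector_mul_assoc adjugate_SL[OF assms])
  then show "bij ((*v) g)" by (intro o_bij[of "(*v) (adjugate g)"]) auto
qed

locale associated_bundle = SL_bundle M P
  for M :: "('m::{t2_space,second_countable_topology}, 'e::euclidean_space) manifold"
    and P :: "('p::{t2_space,second_countable_topology}, 'f::euclidean_space, 'm, 'n::finite)
                principal_bundle" +
  fixes E :: "('v, 'm, 'n) vector_bundle" and q :: "'p \<Rightarrow> complex^'n \<Rightarrow> 'v"
  assumes vector_bundle: "SL_vector_bundle M E"
    and q_proj: "vb_proj E (q p v) = proj p"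
    and q_act: "g \<in> SL \<Longrightarrow> q (act p g) v = q p (g *v v)"
    and q_frame: "(U, \<tau>) \<in> frames E \<Longrightarrow> \<exists>h. smooth_map total_space euclid (proj -` U) h \<and>
      (\<forall>p\<in>proj -` U. h p \<in> SL \<and> (\<forall>v. q p v = \<tau> (proj p) (h p *v v)))"
begin

section \<open>Points of P as bases of the fibres of E\<close>

lemma obtain_frame:
  obtains U \<tau> where "(U, \<tau>) \<in> frames E" "x \<in> U"
proof -
  have "(\<Union>(U, \<tau>)\<in>frames E. U) = UNIV"
    using vector_bundle unfolding SL_vector_bundle_def by (rule conjunct1)
  then show ?thesis using that by blast
qed

lemma frameD:
  assumes "(U, \<tau>) \<in> frames E"
  shows "open U" "x \<in> U \<Longrightarrow> bij_betw (\<tau> x) UNIV (vb_proj E -` {x})"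
    "x \<in> U \<Longrightarrow> vb_add E (\<tau> x v) (\<tau> x w) = \<tau> x (v + w)"
    "x \<in> U \<Longrightarrow> vb_scale E a (\<tau> x v) = \<tau> x (a *s v)"
proof -
  have "\<forall>(U, \<tau>)\<in>frames E. open U \<and>
        (\<forall>x\<in>U. bij_betw (\<tau> x) UNIV (vb_proj E -` {x}) \<and>
          (\<forall>v w. vb_add E (\<tau> x v) (\<tau> x w) = \<tau> x (v + w)) \<and>
          (\<forall>a v. vb_scale E a (\<tau> x v) = \<tau> x (a *s v)))"
    using vector_bundle unfolding SL_vector_bundle_def by blast
  with assms show "open U" "x \<in> U \<Longrightarrow> bij_betw (\<tau> x) UNIV (vb_proj E -` {x})"
    "x \<in> U \<Longrightarrow> vb_add E (\<tau> x v) (\<tau> x w) = \<tau> x (v + w)"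
    "x \<in> U \<Longrightarrow> vb_scale E a (\<tau> x v) = \<tau> x (a *s v)" by blast+
qed

lemma frame_inj: "(U, \<tau>) \<in> frames E \<Longrightarrow> x \<in> U \<Longrightarrow> \<tau> x v = \<tau> x w \<longleftrightarrow> v = w"
  using frameD(2) by (metis bij_betw_imp_inj_on inj_eq)

lemma frame_matrix:
  assumes "(U, \<tau>) \<in> frames E"
  obtains h where "smooth_map total_space euclid (proj -` U) h" "\<And>p. proj p \<in> U \<Longrightarrow> h p \<in> SL"
    "\<And>p v. proj p \<in> U \<Longrightarrow> q p v = \<tau> (proj p) (h p *v v)"
proof -
  obtain h where h: "smooth_map total_space euclid (proj -` U) h"
    "\<forall>p\<in>proj -` U. h p \<in> SL \<and> (\<forall>v. q p v = \<tau> (proj p) (h p *v v))"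
    using q_frame[OF assms] by blast
  show ?thesis
    by (rule that[OF h(1)]) (use h(2) in blast)+
qed

text \<open>\<open>q p\<close> is a frame of E composed with an element of SL, and both are linear
  isomorphisms. Thus p stands for a basis of the fibre, with coordinate map inverse to
  \<open>q p\<close>.\<close>

lemma q_bij: "bij_betw (q p) UNIV (vb_proj E -` {proj p})"
  and q_add: "vb_add E (q p v) (q p w) = q p (v + w)"
  and q_scale: "vb_scale E a (q p v) = q p (a *s v)"
proof -
  obtain U \<tau> where U: "(U, \<tau>) \<in> frames E" "proj p \<in> U" by (rule obtain_frame)
  obtain h where h: "h p \<in> SL" "\<And>v. q p v = \<tau> (proj p) (h p *v v)"
    using q_frame[OF U(1)] U(2) by blast
  have "q p = \<tau> (proj p) \<circ> (*v) (h p)" using h(2) by auto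
  then show "bij_betw (q p) UNIV (vb_proj E -` {proj p})"
    using bij_betw_trans[OF SL_matrix_vector(3)[OF h(1)] frameD(2)[OF U]] by simp
  show "vb_add E (q p v) (q p w) = q p (v + w)"
    by (simp add: h(2) frameD(3)[OF U] matrix_vector_right_distrib)
  show "vb_scale E a (q p v) = q p (a *s v)"
    by (simp add: h(2) frameD(4)[OF U] vector_scalar_commute)
qed

lemma q_inj: "q p v = q p w \<longleftrightarrow> v = w"
  using q_bij by (metis bij_betw_imp_inj_on inj_eq)

lemma q_surj:
  assumes "vb_proj E u = proj p"
  obtains v where "u = q p v"
proof -
  have "u \<in> q p ` UNIV"
    using q_bij[of p] assms unfolding bij_betw_def by auto
  with that show ?thesis by blast
qed

lemma obtain_q:
  obtains p v where "u = q p v"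
  using proj_surj[of "vb_proj E u"] q_surj by metis

lemma endomorphism_eqI: "(\<And>p v. S (q p v) = T (q p v)) \<Longrightarrow> S = T"
  by (metis ext obtain_q)

text \<open>The matrix of T in the basis p of the fibre. It is unique by \<open>q_inj\<close>, and
  for sections of End(E) its existence is read off a frame.\<close>

definition endo_matrix :: "('v \<Rightarrow> 'v) \<Rightarrow> 'p \<Rightarrow> complex^'n^'n" where
  "endo_matrix T p = (THE A. \<forall>v. T (q p v) = q p (A *v v))"

lemma endo_matrix_eqI:
  assumes "\<And>v. T (q p v) = q p (A *v v)"
  shows "endo_matrix T p = A"
  unfolding endo_matrix_def
  using assms by (intro the_equality) (auto simp: q_inj matrix_eq)

text \<open>\<open>h p\<close> converts coordinates in the basis p into coordinates in the frame, so
  the matrix B of T in the frame turns into its conjugate by \<open>h p\<close>.\<close>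

lemma endo_matrix_frame:
  assumes "T \<in> end_sections M E" "(U, \<tau>) \<in> frames E"
  obtains B h where "smooth_map M euclid U B" "smooth_map total_space euclid (proj -` U) h"
    "\<And>p. proj p \<in> U \<Longrightarrow> h p \<in> SL"
    "\<And>p v. proj p \<in> U \<Longrightarrow> T (q p v) = q p ((adjugate (h p) ** B (proj p) ** h p) *v v)"
proof -
  obtain B :: "'m \<Rightarrow> complex^'n^'n" where B: "smooth_map M euclid U B"
    "\<And>x v. x \<in> U \<Longrightarrow> T (\<tau> x v) = \<tau> x (B x *v v)"
  proof -
    have "\<forall>(U, \<tau>)\<in>frames E. \<exists>B :: 'm \<Rightarrow> complex^'n^'n.
        smooth_map M euclid U B \<and> (\<forall>x\<in>U. \<forall>v. T (\<tau> x v) = \<tau> x (B x *v v))"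
      using assms(1) unfolding end_sections_def by simp
    from bspec[OF this assms(2)] obtain B :: "'m \<Rightarrow> complex^'n^'n" where
      "smooth_map M euclid U B" "\<forall>x\<in>U. \<forall>v. T (\<tau> x v) = \<tau> x (B x *v v)"
      unfolding prod.case by blast
    then show ?thesis by (intro that[of B]) simp_all
  qed
  obtain h where h: "smooth_map total_space euclid (proj -` U) h"
    "\<And>p. proj p \<in> U \<Longrightarrow> h p \<in> SL" "\<And>p v. proj p \<in> U \<Longrightarrow> q p v = \<tau> (proj p) (h p *v v)"
    using frame_matrix[OF assms(2)] by blast
  show ?thesis
  proof (rule that[OF B(1) h(1,2)])
    fix p v assume p: "proj p \<in> U"
    show "T (q p v) = q p ((adjugate (h p) ** B (proj p) ** h p) *v v)"
      by (simp add: h(3)[OF p] B(2)[OF p] matrix_vector_mul_assoc[symmetric] SL_matrix_vector[OF h(2)[OF p]])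
  qed
qed

lemma endo_matrix:
  assumes "T \<in> end_sections M E"
  shows "T (q p v) = q p (endo_matrix T p *v v)"
proof -
  obtain U \<tau> where U: "(U, \<tau>) \<in> frames E" "proj p \<in> U" by (rule obtain_frame)
  obtain B h where "\<And>p v. proj p \<in> U \<Longrightarrow> T (q p v) = q p ((adjugate (h p) ** B (proj p) ** h p) *v v)"
    using endo_matrix_frame[OF assms U(1)] by metis
  with U(2) have *: "T (q p v) = q p ((adjugate (h p) ** B (proj p) ** h p) *v v)" for v by blast
  with endo_matrix_eqI[OF *] show ?thesis by simp
qed

lemma endo_matrix_equivariant:
  assumes T: "T \<in> end_sections M E"
  shows "endo_matrix T \<in> equivariant"
  unfolding equivariant_def
proof (intro CollectI conjI allI ballI)
  show "endo_matrix T \<in> smooth_functions total_space"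
    unfolding smooth_functions_iff
  proof (rule smooth_map_local[OF total_atlas])
    fix p
    obtain U \<tau> where U: "(U, \<tau>) \<in> frames E" "proj p \<in> U" by (rule obtain_frame)
    obtain B h where Bh: "smooth_map M euclid U B" "smooth_map total_space euclid (proj -` U) h"
      "\<And>p. proj p \<in> U \<Longrightarrow> h p \<in> SL"
      "\<And>p v. proj p \<in> U \<Longrightarrow> T (q p v) = q p ((adjugate (h p) ** B (proj p) ** h p) *v v)"
      using endo_matrix_frame[OF T U(1)] by metis
    have "smooth_map total_space euclid (proj -` U) (\<lambda>p. adjugate (h p) ** B (proj p) ** h p)"
      by (intro smooth_map_matrix_mult smooth_map_pullback_proj[OF Bh(1)] Bh(2)
          smooth_map_post[OF Bh(2) smooth_on_adjugate subset_UNIV total_atlas])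
    then have "smooth_map total_space euclid (proj -` U) (endo_matrix T)"
      by (rule smooth_map_euclid_cong[OF total_atlas])
         (rule endo_matrix_eqI[symmetric], use Bh(4) in auto)
    then show "\<exists>V. open V \<and> p \<in> V \<and> smooth_map total_space euclid (UNIV \<inter> V) (endo_matrix T)"
      using U(2) open_proj_vimage[OF frameD(1)[OF U(1)]] by (intro exI[of _ "proj -` U"]) simp
  qed
  fix p g assume g: "g \<in> (SL :: (complex^'n^'n) set)"
  have "q p ((g ** endo_matrix T (act p g)) *v v) = q p ((endo_matrix T p ** g) *v v)" for v
    using endo_matrix[OF T, of "act p g" v] endo_matrix[OF T, of p "g *v v"]
    by (simp add: q_act[OF g] matrix_vector_mul_assoc)
  then show "g ** endo_matrix T (act p g) = endo_matrix T p ** g"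
    by (simp add: q_inj matrix_eq)
qed

text \<open>The endomorphism with matrix \<open>A p\<close> in the basis p, for one chosen p in each
  fibre. Equivariance of A says precisely that the basis p g yields the same endomorphism.\<close>

definition matrix_endo :: "('p \<Rightarrow> complex^'n^'n) \<Rightarrow> 'v \<Rightarrow> 'v" where
  "matrix_endo A u = (let p = SOME p. proj p = vb_proj E u in q p (A p *v inv (q p) u))"

lemma matrix_endo:
  assumes A: "A \<in> equivariant"
  shows "matrix_endo A (q p v) = q p (A p *v v)"
proof -
  define p' where "p' = (SOME p'. proj p' = proj p)"
  have "proj p' = proj p" unfolding p'_def by (rule someI_ex) auto
  then obtain g where g: "g \<in> SL" "p = act p' g" by (rule fiber_transitive)
  have "inv (q p') (q p v) = g *v v"
    using g by (intro inv_f_eq) (auto simp: inj_def q_inj q_act)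
  then have "matrix_endo A (q p v) = q p' ((A p' ** g) *v v)"
    by (simp add: matrix_endo_def q_proj p'_def[symmetric] matrix_vector_mul_assoc)
  also have "\<dots> = q p (A p *v v)"
    using equivariantD(2)[OF A g(1), of p'] by (simp add: g q_act matrix_vector_mul_assoc)
  finally show ?thesis .
qed

lemma matrix_endo_in_end_sections:
  assumes A: "A \<in> equivariant"
  shows "matrix_endo A \<in> end_sections M E"
  unfolding end_sections_def
proof (intro CollectI conjI allI impI ballI)
  fix u
  obtain p v where u: "u = q p v" by (rule obtain_q)
  show "vb_proj E (matrix_endo A u) = vb_proj E u"
    by (simp add: u matrix_endo[OF A] q_proj)
  show "matrix_endo A (vb_scale E a u) = vb_scale E a (matrix_endo A u)" for a
    by (simp add: u matrix_endo[OF A] q_scale vector_scalar_commute)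
  fix w assume "vb_proj E u = vb_proj E w"
  then have "vb_proj E w = proj p" by (simp add: u q_proj)
  then obtain v' where w: "w = q p v'" by (rule q_surj)
  show "matrix_endo A (vb_add E u w) = vb_add E (matrix_endo A u) (matrix_endo A w)"
    by (simp add: u w matrix_endo[OF A] q_add matrix_vector_right_distrib)
next
  fix c assume "c \<in> frames E"
  then obtain U \<tau> where c: "c = (U, \<tau>)" and U: "(U, \<tau>) \<in> frames E" by (cases c) auto
  obtain h where h: "smooth_map total_space euclid (proj -` U) h"
    "\<And>p. proj p \<in> U \<Longrightarrow> h p \<in> SL" "\<And>p v. proj p \<in> U \<Longrightarrow> q p v = \<tau> (proj p) (h p *v v)"
    using frame_matrix[OF U] by metis
  \<comment> \<open>The matrix in the frame is h A h^-1. Passing from p' to p = p' g multiplies h by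
    g on the right and conjugates A by g, so this product is constant on fibres and descends to the
    base.\<close>
  define f where "f p = h p ** A p ** adjugate (h p)" for p
  define B where "B x = f (SOME p. proj p = x)" for x
  have Bf: "B (proj p) = f p" if p: "proj p \<in> U" for p
  proof -
    define p' where "p' = (SOME p'. proj p' = proj p)"
    have pp: "proj p' = proj p" unfolding p'_def by (rule someI_ex) auto
    then obtain g where g: "g \<in> SL" "p = act p' g" by (rule fiber_transitive)
    have p': "proj p' \<in> U" using p pp by simp
    have "\<tau> (proj p) (h p *v v) = \<tau> (proj p) ((h p' ** g) *v v)" for v
      using h(3)[OF p, of v] h(3)[OF p', of "g *v v"] g pp by (simp add: q_act matrix_vector_mul_assoc)
    then have hp: "h p = h p' ** g"
      by (simp add: frame_inj[OF U p] matrix_eq)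
    have "f p = h p' ** (g ** A p) ** adjugate (h p' ** g)"
      by (simp add: f_def hp matrix_mul_assoc)
    also have "\<dots> = h p' ** A p' ** (g ** adjugate (h p' ** g))"
      using equivariantD(2)[OF A g(1), of p'] g(2) by (simp add: matrix_mul_assoc)
    also have "\<dots> = f p'"
      by (simp add: f_def adjugate_mult[OF g(1) h(2)[OF p']])
    finally show ?thesis by (simp add: B_def p'_def)
  qed
  have "smooth_map total_space euclid (proj -` U) f"
    unfolding f_def
    by (intro smooth_map_matrix_mult h(1) smooth_functions_restrict[OF equivariantD(1)[OF A]]
        smooth_map_post[OF h(1) smooth_on_adjugate subset_UNIV total_atlas])
  then have "smooth_map M euclid U B"
    by (rule smooth_map_descend[OF frameD(1)[OF U]]) (rule Bf)
  moreover have "matrix_endo A (\<tau> x v) = \<tau> x (B x *v v)" if x: "x \<in> U" for x v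
  proof -
    obtain p where p: "x = proj p" using proj_surj by metis
    have pU: "proj p \<in> U" using x p by simp
    have \<tau>: "\<tau> x v = q p (adjugate (h p) *v v)"
      by (simp add: p h(3)[OF pU] SL_matrix_vector[OF h(2)[OF pU]])
    have "matrix_endo A (\<tau> x v) = \<tau> (proj p) (h p *v (A p *v (adjugate (h p) *v v)))"
      unfolding \<tau> matrix_endo[OF A] by (rule h(3)[OF pU])
    also have "\<dots> = \<tau> x (B x *v v)"
      by (simp add: p Bf[OF pU] f_def matrix_vector_mul_assoc matrix_mul_assoc)
    finally show ?thesis .
  qed
  ultimately show "case c of (U, \<tau>) \<Rightarrow> \<exists>B :: 'm \<Rightarrow> complex^'n^'n.
      smooth_map M euclid U B \<and> (\<forall>x\<in>U. \<forall>v. matrix_endo A (\<tau> x v) = \<tau> x (B x *v v))"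
    by (auto simp: c)
qed

lemma endo_matrix_inverse: "A \<in> equivariant \<Longrightarrow> endo_matrix (matrix_endo A) = A"
  by (rule ext, rule endo_matrix_eqI) (simp add: matrix_endo)

lemma matrix_endo_inverse: "T \<in> end_sections M E \<Longrightarrow> matrix_endo (endo_matrix T) = T"
  by (rule endomorphism_eqI) (simp add: matrix_endo[OF endo_matrix_equivariant] endo_matrix)

lemma end_sections_cases:
  assumes "T \<in> end_sections M E"
  obtains A where "A \<in> equivariant" "T = matrix_endo A"
  using matrix_endo_inverse[OF assms] endo_matrix_equivariant[OF assms] that by metis

lemma matrix_endo_inj:
  "A \<in> equivariant \<Longrightarrow> A' \<in> equivariant \<Longrightarrow> matrix_endo A = matrix_endo A' \<longleftrightarrow> A = A'"
  by (metis endo_matrix_inverse)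

lemma end_add_matrix_endo:
  "A \<in> equivariant \<Longrightarrow> A' \<in> equivariant \<Longrightarrow>
    end_add E (matrix_endo A) (matrix_endo A') = matrix_endo (\<lambda>p. A p + A' p)"
  by (rule endomorphism_eqI)
     (simp add: end_add_def matrix_endo equivariant_add q_add matrix_vector_mult_add_rdistrib)

lemma comp_matrix_endo:
  "A \<in> equivariant \<Longrightarrow> A' \<in> equivariant \<Longrightarrow>
    matrix_endo A \<circ> matrix_endo A' = matrix_endo (\<lambda>p. A p ** A' p)"
  by (rule endomorphism_eqI) (simp add: matrix_endo equivariant_mult matrix_vector_mul_assoc)

lemma end_scale_matrix_endo:
  "f \<in> smooth_functions M \<Longrightarrow> A \<in> equivariant \<Longrightarrow>
    end_scale E f (matrix_endo A) = matrix_endo (\<lambda>p. mat (f (proj p)) ** A p)"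
  by (rule endomorphism_eqI)
     (simp add: end_scale_def matrix_endo equivariant_mult equivariant_mat q_scale q_proj
       matrix_vector_mul_assoc[symmetric] mat_vector_mult)

lemma end_scale_id:
  assumes "f \<in> smooth_functions M"
  shows "end_scale E f id = matrix_endo (\<lambda>p. mat (f (proj p)))"
proof -
  have "id = matrix_endo (\<lambda>p. mat 1)"
    by (rule endomorphism_eqI) (simp add: matrix_endo equivariant_mat[OF smooth_functions_const])
  then show ?thesis
    using end_scale_matrix_endo[OF assms equivariant_mat[OF smooth_functions_const[of 1]]] by simp
qed

end

section \<open>The isomorphism\<close>

context associated_bundle
begin

definition to_derivation :: "'p vfield \<Rightarrow> ('v \<Rightarrow> 'v) \<Rightarrow> 'v \<Rightarrow> 'v" where
  "to_derivation X = (\<lambda>T\<in>end_sections M E. matrix_endo (\<lambda>p. tderiv (X p) (endo_matrix T)))"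

lemma to_derivation_matrix_endo:
  "A \<in> equivariant \<Longrightarrow> to_derivation X (matrix_endo A) = matrix_endo (\<lambda>p. tderiv (X p) A)"
  by (simp add: to_derivation_def matrix_endo_in_end_sections endo_matrix_inverse)

lemma to_derivation_eqI:
  assumes "D \<in> extensional (end_sections M E)"
    "\<And>A. A \<in> equivariant \<Longrightarrow> D (matrix_endo A) = matrix_endo (\<lambda>p. tderiv (X p) A)"
  shows "to_derivation X = D"
proof (rule extensionalityI[OF _ assms(1)])
  show "to_derivation X \<in> extensional (end_sections M E)"
    by (simp add: to_derivation_def)
  fix T assume "T \<in> end_sections M E"
  then show "to_derivation X T = D T"
    by (elim end_sections_cases) (simp add: to_derivation_matrix_endo assms(2))
qed

lemma to_derivation_center:
  assumes X: "X \<in> right_invariant_fields P"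
  shows "center_restriction M E (to_derivation X) (pushforward X)"
  unfolding center_restriction_def
proof
  fix f :: "'m \<Rightarrow> complex" assume f: "f \<in> smooth_functions M"
  note XD = right_invariant_fieldsD[OF X]
  have "tderiv (X p) (\<lambda>p. mat (f (proj p))) = (mat (vf_apply_complex (pushforward X) f (proj p)) :: complex^'n^'n)"
    for p
    using tderiv_linear[OF smooth_total vector_fieldsD(1)[OF XD(1)] bounded_linear_mat
        smooth_functions_pullback_proj[OF f]]
    by (simp add: vf_apply_complex_eq tderiv_pushforward[OF X f])
  moreover have "vf_apply_complex (pushforward X) f \<in> smooth_functions M"
    unfolding vf_apply_complex_eq
    by (rule vector_field_tderiv_smooth[OF pushforward_vector_field[OF X] f])
  ultimately show "to_derivation X (end_scale E f id) = end_scale E (vf_apply_complex (pushforward X) f) id"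
    by (simp add: end_scale_id f to_derivation_matrix_endo equivariant_mat)
qed

lemma to_derivation_carrier:
  assumes X: "X \<in> right_invariant_fields P"
  shows "to_derivation X \<in> la_carrier (Der_algebroid M E)"
proof -
  note XD = right_invariant_fieldsD[OF X]
  note Xp = vector_fieldsD(1)[OF XD(1)]
  note XT = right_invariant_equivariant[OF X]
  have "to_derivation X \<in> derivations M E"
    unfolding derivations_def
  proof (intro CollectI conjI ballI allI)
    show "to_derivation X \<in> end_sections M E \<rightarrow>\<^sub>E end_sections M E"
      unfolding to_derivation_def
      by (intro restrict_PiE_iff[THEN iffD2] ballI matrix_endo_in_end_sections XT endo_matrix_equivariant)
    fix S T assume "S \<in> end_sections M E" "T \<in> end_sections M E"
    then obtain A B where A: "A \<in> equivariant" "S = matrix_endo A" and B: "B \<in> equivariant" "T = matrix_endo B"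
      by (elim end_sections_cases)
    note AB = equivariantD(1)[OF A(1)] equivariantD(1)[OF B(1)]
    show "to_derivation X (end_add E S T) = end_add E (to_derivation X S) (to_derivation X T)"
      by (simp add: A B end_add_matrix_endo to_derivation_matrix_endo equivariant_add XT
          tderiv_add[OF smooth_total Xp AB])
    show "to_derivation X (end_scale E (\<lambda>_. a) T) = end_scale E (\<lambda>_. a) (to_derivation X T)" for a
    proof -
      have "tderiv (X p) (\<lambda>p. mat a ** B p) = mat a ** tderiv (X p) B" for p
        by (rule tderiv_linear[OF smooth_total Xp
              bounded_bilinear.bounded_linear_right[OF bounded_bilinear_matrix_mult] AB(2)])
      then show ?thesis
        by (simp add: B end_scale_matrix_endo smooth_functions_const to_derivation_matrix_endo XT
            equivariant_mult[OF equivariant_mat[OF smooth_functions_const] B(1)])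
    qed
    show "to_derivation X (S \<circ> T) = end_add E (to_derivation X S \<circ> T) (S \<circ> to_derivation X T)"
      by (simp add: A B comp_matrix_endo end_add_matrix_endo to_derivation_matrix_endo equivariant_mult XT
          tderiv_matrix_mult[OF smooth_total Xp AB])
  qed
  then show ?thesis
    using to_derivation_center[OF X] pushforward_vector_field[OF X] by (auto simp: Der_algebroid_def)
qed

text \<open>On a real function, viewed as a complex one, the value of the field can be read off the
  resulting scalar matrix, as \<open>mat\<close> is injective. This makes the \<open>THE\<close> in
  the anchor well defined.\<close>

lemma center_restriction_unique:
  assumes "X \<in> vector_fields M" "Y \<in> vector_fields M"
    "center_restriction M E D X" "center_restriction M E D Y"
  shows "X = Y"
proof (intro ext)
  fix x and f :: "'m \<Rightarrow> real"
  show "X x f = Y x f"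
  proof (cases "f \<in> smooth_functions M")
    case True
    let ?f = "\<lambda>x. complex_of_real (f x)"
    have f: "?f \<in> smooth_functions M"
      by (rule smooth_functions_linear[OF bounded_linear_of_real True])
    have sm: "vf_apply_complex X ?f \<in> smooth_functions M" "vf_apply_complex Y ?f \<in> smooth_functions M"
      unfolding vf_apply_complex_eq
      by (intro vector_field_tderiv_smooth[OF assms(1) f] vector_field_tderiv_smooth[OF assms(2) f])+
    have "end_scale E (vf_apply_complex X ?f) id = end_scale E (vf_apply_complex Y ?f) id"
      using assms(3,4) f unfolding center_restriction_def by metis
    then have "(\<lambda>p. mat (vf_apply_complex X ?f (proj p)) :: complex^'n^'n)
        = (\<lambda>p. mat (vf_apply_complex Y ?f (proj p)))"
      by (simp only: end_scale_id[OF sm(1)] end_scale_id[OF sm(2)] matrix_endo_inj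
          equivariant_mat[OF sm(1)] equivariant_mat[OF sm(2)])
    moreover obtain p where "proj p = x" using proj_surj by blast
    ultimately have "vf_apply_complex X ?f x = vf_apply_complex Y ?f x"
      by (metis mat_eq_iff)
    then show ?thesis by (simp add: vf_apply_complex_def)
  next
    case False
    then show ?thesis
      by (simp add: tangent_nonsmooth[OF vector_fieldsD(1)[OF assms(1)]]
          tangent_nonsmooth[OF vector_fieldsD(1)[OF assms(2)]])
  qed
qed

lemma Der_anchor:
  assumes "X \<in> vector_fields M" "center_restriction M E D X"
  shows "la_anchor (Der_algebroid M E) D = X"
  unfolding Der_algebroid_def lie_algebroid.simps
  using assms by (blast intro: the_equality center_restriction_unique)

section \<open>Bijectivity of the map from invariant fields to derivations\<close>

lemma to_derivation_inj: "inj_on to_derivation (right_invariant_fields P)"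
proof (rule inj_onI, rule ext)
  fix X Y p
  assume X: "X \<in> right_invariant_fields P" and Y: "Y \<in> right_invariant_fields P"
    and eq: "to_derivation X = to_derivation Y"
  show "X p = Y p"
  proof (rule tangent_eqI)
    show "X p \<in> tangent_space total_space p" "Y p \<in> tangent_space total_space p"
      by (intro vector_fieldsD(1) right_invariant_fieldsD(1) X Y)+
    fix T assume T: "T \<in> equivariant"
    have "matrix_endo (\<lambda>p. tderiv (X p) T) = matrix_endo (\<lambda>p. tderiv (Y p) T)"
      using to_derivation_matrix_endo[OF T] eq by metis
    then have "(\<lambda>p. tderiv (X p) T) = (\<lambda>p. tderiv (Y p) T)"
      by (simp only: matrix_endo_inj right_invariant_equivariant[OF X T] right_invariant_equivariant[OF Y T])
    then show "tderiv (X p) T = tderiv (Y p) T" by metis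
  qed
qed

text \<open>Through \<open>matrix_endo\<close>, D becomes an operator d on equivariant functions. By
  \<open>matrix_endo_inj\<close> the identities for D turn into the pointwise ones that
  \<open>derivation_lift\<close> asks for, and the invariant field found there induces D
  again.\<close>

lemma to_derivation_surj:
  assumes D: "D \<in> la_carrier (Der_algebroid M E)"
  shows "D \<in> to_derivation ` right_invariant_fields P"
proof -
  from D obtain X where der: "D \<in> derivations M E" and X: "X \<in> vector_fields M" "center_restriction M E D X"
    by (auto simp: Der_algebroid_def)
  from der have ext: "D \<in> extensional (end_sections M E)"
    and in_sections: "\<And>T. T \<in> end_sections M E \<Longrightarrow> D T \<in> end_sections M E"
    and add: "\<And>S T. S \<in> end_sections M E \<Longrightarrow> T \<in> end_sections M E \<Longrightarrow>
      D (end_add E S T) = end_add E (D S) (D T)"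
    and mult: "\<And>S T. S \<in> end_sections M E \<Longrightarrow> T \<in> end_sections M E \<Longrightarrow>
      D (S \<circ> T) = end_add E (D S \<circ> T) (S \<circ> D T)"
    by (auto simp: derivations_def PiE_iff)
  define d where "d A = endo_matrix (D (matrix_endo A))" for A
  have in_end: "D (matrix_endo A) \<in> end_sections M E" if "A \<in> equivariant" for A
    by (intro in_sections matrix_endo_in_end_sections that)
  have d: "d A \<in> equivariant" if "A \<in> equivariant" for A
    unfolding d_def by (intro endo_matrix_equivariant in_end that)
  have Dd: "D (matrix_endo A) = matrix_endo (d A)" if "A \<in> equivariant" for A
    using matrix_endo_inverse[OF in_end[OF that]] by (simp add: d_def)
  have d_add: "d (\<lambda>p. A p + B p) p = d A p + d B p" if AB: "A \<in> equivariant" "B \<in> equivariant" for A B p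
  proof -
    have "matrix_endo (d (\<lambda>p. A p + B p)) = matrix_endo (\<lambda>p. d A p + d B p)"
      using add[OF matrix_endo_in_end_sections[OF AB(1)] matrix_endo_in_end_sections[OF AB(2)]]
      by (simp add: end_add_matrix_endo AB Dd equivariant_add d)
    then have "d (\<lambda>p. A p + B p) = (\<lambda>p. d A p + d B p)"
      by (simp only: matrix_endo_inj d equivariant_add AB)
    then show ?thesis by metis
  qed
  have d_mult: "d (\<lambda>p. A p ** B p) p = d A p ** B p + A p ** d B p"
    if AB: "A \<in> equivariant" "B \<in> equivariant" for A B p
  proof -
    have "matrix_endo (d (\<lambda>p. A p ** B p)) = matrix_endo (\<lambda>p. d A p ** B p + A p ** d B p)"
      using mult[OF matrix_endo_in_end_sections[OF AB(1)] matrix_endo_in_end_sections[OF AB(2)]]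
      by (simp add: comp_matrix_endo end_add_matrix_endo AB Dd equivariant_mult d)
    then have "d (\<lambda>p. A p ** B p) = (\<lambda>p. d A p ** B p + A p ** d B p)"
      by (simp only: matrix_endo_inj d equivariant_add equivariant_mult AB)
    then show ?thesis by metis
  qed
  have d_mat: "d (\<lambda>p. mat (f (proj p))) p = mat (tderiv (X (proj p)) f)" if f: "f \<in> smooth_functions M" for f p
  proof -
    have sm: "(\<lambda>x. tderiv (X x) f) \<in> smooth_functions M"
      by (rule vector_field_tderiv_smooth[OF X(1) f])
    have "matrix_endo (d (\<lambda>p. mat (f (proj p)))) = D (end_scale E f id)"
      by (simp add: end_scale_id[OF f] Dd equivariant_mat[OF f])
    also have "\<dots> = end_scale E (\<lambda>x. tderiv (X x) f) id"
      using X(2) f by (simp add: center_restriction_def vf_apply_complex_eq[abs_def])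
    also have "\<dots> = matrix_endo (\<lambda>p. mat (tderiv (X (proj p)) f))"
      by (rule end_scale_id[OF sm])
    finally have "d (\<lambda>p. mat (f (proj p))) = (\<lambda>p. mat (tderiv (X (proj p)) f))"
      by (simp only: matrix_endo_inj d equivariant_mat[OF f] equivariant_mat[OF sm])
    then show ?thesis by metis
  qed
  obtain Y where Y: "Y \<in> right_invariant_fields P" "\<And>T p. T \<in> equivariant \<Longrightarrow> d T p = tderiv (Y p) T"
    using derivation_lift[OF X(1) d d_add d_mult d_mat] by blast
  have "to_derivation Y = D"
  proof (rule to_derivation_eqI[OF ext])
    fix A assume A: "A \<in> equivariant"
    then have "d A = (\<lambda>p. tderiv (Y p) A)" using Y(2) by auto
    then show "D (matrix_endo A) = matrix_endo (\<lambda>p. tderiv (Y p) A)" by (simp add: Dd[OF A])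
  qed
  with Y(1) show ?thesis by blast
qed

lemma to_derivation_bij:
  "bij_betw to_derivation (right_invariant_fields P) (la_carrier (Der_algebroid M E))"
  using to_derivation_inj to_derivation_surj to_derivation_carrier by (auto simp: bij_betw_def)

section \<open>Compatibility with the algebroid operations\<close>

lemma to_derivation_add:
  assumes X: "X \<in> right_invariant_fields P" and Y: "Y \<in> right_invariant_fields P"
  shows "to_derivation (vf_add X Y) = la_add (Der_algebroid M E) (to_derivation X) (to_derivation Y)"
proof (rule to_derivation_eqI)
  fix A assume A: "A \<in> equivariant"
  have "tderiv (vf_add X Y p) A = tderiv (X p) A + tderiv (Y p) A" for p
    by (simp add: tderiv_def vf_add_def scaleR_add_left sum.distrib)
  then show "la_add (Der_algebroid M E) (to_derivation X) (to_derivation Y) (matrix_endo A)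
      = matrix_endo (\<lambda>p. tderiv (vf_add X Y p) A)"
    by (simp add: Der_algebroid_def matrix_endo_in_end_sections[OF A] to_derivation_matrix_endo[OF A]
        end_add_matrix_endo right_invariant_equivariant[OF X A] right_invariant_equivariant[OF Y A])
qed (simp add: Der_algebroid_def)

lemma to_derivation_scale:
  assumes X: "X \<in> right_invariant_fields P" and f: "f \<in> smooth_functions M"
  shows "to_derivation (\<lambda>p h. f (proj p) * X p h) = la_scale (Der_algebroid M E) f (to_derivation X)"
proof (rule to_derivation_eqI)
  fix A assume A: "A \<in> equivariant"
  have "tderiv (\<lambda>h. f (proj p) * X p h) A = mat (complex_of_real (f (proj p))) ** tderiv (X p) A" for p
    by (simp add: tderiv_def mat_of_real scaleR_sum_right)
  then show "la_scale (Der_algebroid M E) f (to_derivation X) (matrix_endo A)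
      = matrix_endo (\<lambda>p. tderiv (\<lambda>h. f (proj p) * X p h) A)"
    by (simp add: Der_algebroid_def matrix_endo_in_end_sections[OF A] to_derivation_matrix_endo[OF A]
        end_scale_matrix_endo right_invariant_equivariant[OF X A]
        smooth_functions_linear[OF bounded_linear_of_real f])
qed (simp add: Der_algebroid_def)

lemma to_derivation_bracket:
  assumes X: "X \<in> right_invariant_fields P" and Y: "Y \<in> right_invariant_fields P"
  shows "to_derivation (vf_bracket X Y) = la_bracket (Der_algebroid M E) (to_derivation X) (to_derivation Y)"
proof (rule to_derivation_eqI)
  fix A assume A: "A \<in> equivariant"
  note XA = right_invariant_equivariant[OF X A] and YA = right_invariant_equivariant[OF Y A]
  note XYA = right_invariant_equivariant[OF X YA] and YXA = right_invariant_equivariant[OF Y XA]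
  \<comment> \<open>The difference is written with the scalar matrix of -1, because the bracket of
    derivations subtracts through \<open>end_scale\<close> by -1.\<close>
  have "tderiv (vf_bracket X Y p) A
      = tderiv (X p) (\<lambda>p. tderiv (Y p) A) + mat (- 1) ** tderiv (Y p) (\<lambda>p. tderiv (X p) A)" for p
    using mat_of_real[of "- 1" "tderiv (Y p) (\<lambda>p. tderiv (X p) A)"] by (simp add: tderiv_vf_bracket)
  then show "la_bracket (Der_algebroid M E) (to_derivation X) (to_derivation Y) (matrix_endo A)
      = matrix_endo (\<lambda>p. tderiv (vf_bracket X Y p) A)"
    by (simp add: Der_algebroid_def matrix_endo_in_end_sections[OF A] to_derivation_matrix_endo A XA YA
        end_scale_matrix_endo[OF smooth_functions_const YXA] end_add_matrix_endo XYA
        equivariant_mult[OF equivariant_mat[OF smooth_functions_const] YXA])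
qed (simp add: Der_algebroid_def)

lemma Der_isomorphic_Atiyah:
  "lie_algebroid_isomorphic M (Der_algebroid M E) (Atiyah_algebroid M P)"
proof -
  let ?R = "right_invariant_fields P" and ?D = "Der_algebroid M E" and ?A = "Atiyah_algebroid M P"
  \<comment> \<open>\<open>to_derivation\<close> goes from fields to derivations, opposite to the
    isomorphism claimed. Its inverse respects the operations because every element of the carrier is
    the image of an invariant field.\<close>
  define \<Phi> where "\<Phi> = inv_into ?R to_derivation"
  have carrier: "la_carrier ?A = ?R" by (simp add: Atiyah_algebroid_def)
  have bij: "bij_betw \<Phi> (la_carrier ?D) (la_carrier ?A)"
    unfolding \<Phi>_def carrier by (rule bij_betw_inv_into[OF to_derivation_bij])
  have \<Phi>: "\<Phi> (to_derivation X) = X" if "X \<in> ?R" for X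
    unfolding \<Phi>_def by (rule inv_into_f_f[OF to_derivation_inj that])
  have "lie_algebroid_morphism M ?D ?A \<Phi>"
    unfolding lie_algebroid_morphism_def
  proof (intro conjI ballI)
    show "\<Phi> \<in> la_carrier ?D \<rightarrow> la_carrier ?A"
      using bij by (auto dest: bij_betwE)
    fix D D' assume "D \<in> la_carrier ?D" "D' \<in> la_carrier ?D"
    then obtain X Y where X: "X \<in> ?R" "D = to_derivation X" and Y: "Y \<in> ?R" "D' = to_derivation Y"
      by (blast dest: to_derivation_surj)
    show "\<Phi> (la_add ?D D D') = la_add ?A (\<Phi> D) (\<Phi> D')"
      by (simp add: X Y \<Phi> to_derivation_add[symmetric] vf_add_right_invariant Atiyah_algebroid_def)
    show "\<Phi> (la_bracket ?D D D') = la_bracket ?A (\<Phi> D) (\<Phi> D')"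
      by (simp add: X Y \<Phi> to_derivation_bracket[symmetric] vf_bracket_right_invariant Atiyah_algebroid_def)
  next
    fix f :: "'m \<Rightarrow> real" and D assume f: "f \<in> smooth_functions M" and "D \<in> la_carrier ?D"
    then obtain X where X: "X \<in> ?R" "D = to_derivation X"
      by (blast dest: to_derivation_surj)
    show "\<Phi> (la_scale ?D f D) = la_scale ?A f (\<Phi> D)"
      by (simp add: X \<Phi> to_derivation_scale[symmetric] scale_right_invariant f Atiyah_algebroid_def)
  next
    fix D assume "D \<in> la_carrier ?D"
    then obtain X where X: "X \<in> ?R" "D = to_derivation X"
      by (blast dest: to_derivation_surj)
    show "la_anchor ?A (\<Phi> D) = la_anchor ?D D"
      by (simp add: X \<Phi> Atiyah_anchor Der_anchor[OF pushforward_vector_field to_derivation_center])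
  qed
  with bij show ?thesis
    unfolding lie_algebroid_isomorphic_def by blast
qed

end

theorem proposition4p7:
  fixes M :: "('m::{t2_space,second_countable_topology}, 'e::euclidean_space) manifold"
    and P :: "('p::{t2_space,second_countable_topology}, 'f::euclidean_space, 'm, 'n::finite)
                principal_bundle"
    and E :: "('v, 'm, 'n) vector_bundle"
  assumes "smooth_manifold M"
    and "SL_vector_bundle M E"
    and "principal_SL_bundle M P"
    and "associated P E"
  shows "lie_algebroid_isomorphic M (Der_algebroid M E) (Atiyah_algebroid M P)"
proof -
  from \<open>associated P E\<close> obtain q :: "'p \<Rightarrow> complex^'n \<Rightarrow> 'v" where
    q: "\<forall>p v. vb_proj E (q p v) = bundle_proj P p"
    "\<forall>p v. \<forall>g\<in>SL. q (bundle_act P p g) v = q p (g *v v)"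
    "\<forall>(U, \<tau>)\<in>frames E. \<exists>h.
       smooth_map (bundle_space P) euclid (bundle_proj P -` U) h \<and>
       (\<forall>p\<in>bundle_proj P -` U. h p \<in> SL \<and> (\<forall>v. q p v = \<tau> (bundle_proj P p) (h p *v v)))"
    unfolding associated_def by blast
  interpret associated_bundle M P E q
    using assms q by unfold_locales auto
  show ?thesis by (rule Der_isomorphic_Atiyah)
qed

end
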